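(* For any star-regular mesh cell $K\subset\mathbb R^D$ and every integer $k\ge 0$, the number $$\overline M_{\star}^{D,k}:=\frac{\bigl(\lfloor\frac k2\rfloor+1\bigr)\bigl(\lfloor\frac{k+1}2\rfloor+D\bigr)}{D}$$ is an admissible interior weight for polynomials of degree at most $k$, i.e. $\overline M_K^k\le\overline M_\star^{D,k}$. In particular, for the regular simplex $K$ of dimension $D$, $\overline M_K^k\le\overline M_\star^{D,k}$.
   Context: A star-regular mesh cell is a star-convex polytope $K\subset\mathbb R^D$ that can be centered on the origin so that $\hat{\mathbf n}\cdot\mathbf x$ is constant on its boundary ($\hat{\mathbf n}$ the outward unit normal); regular polytopes are star-regular. $\overline{\mathcal C}(U)$ is the average of $U$ over $K$, $\overline{\mathcal B}(U)$ is the average of $U$ over $\partial K$, and $\overline M_K^k:=\sup\{\overline{\mathcal B}(U)/\overline{\mathcal C}(U)\}$ over real polynomials $U$ in $D$ variables of degree at most $k$ with $U\ge0$ in $K$ and $\overline{\mathcal C}(U)>0$. A number $\overline M$ is an admissible interior weight if $\overline M\ge\overline M_K^k$. *)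

theory Defs
  imports "HOL-Analysis.Analysis"
begin

section \<open>Star-regular mesh cells\<close>

text \<open>Polytopes need not be convex here; full dimensionality of the pieces excludes
  lower-dimensional spikes.\<close>

definition solid_polytope :: "'a::euclidean_space set \<Rightarrow> bool" where
  "solid_polytope K \<longleftrightarrow>
     (\<exists>\<F>. finite \<F> \<and> \<F> \<noteq> {} \<and> (\<forall>P\<in>\<F>. polytope P \<and> interior P \<noteq> {}) \<and> K = \<Union>\<F>)"

text \<open>For a polytope the boundary is flat near every point in the relative interior of a facet,
  so there \<open>K\<close> locally is a half space.  At the remaining boundary points, which form a set of
  surface measure zero, there is no unit normal.\<close>

definition outward_unit_normal :: "'a::euclidean_space set \<Rightarrow> 'a \<Rightarrow> 'a \<Rightarrow> bool" where
  "outward_unit_normal K x n \<longleftrightarrow>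
     x \<in> frontier K \<and> norm n = 1 \<and>
     (\<exists>e>0. K \<inter> ball x e = {y \<in> ball x e. n \<bullet> (y - x) \<le> 0})"

definition star_regular :: "'a::euclidean_space set \<Rightarrow> bool" where
  "star_regular K \<longleftrightarrow>
     solid_polytope K \<and> starlike K \<and>
     (\<exists>p c. \<forall>x n. outward_unit_normal ((\<lambda>y. y - p) ` K) x n \<longrightarrow> n \<bullet> x = c)"

definition regular_simplex :: "nat \<Rightarrow> 'a::euclidean_space set \<Rightarrow> bool" where
  "regular_simplex d K \<longleftrightarrow>
     (\<exists>C l. \<not> affine_dependent C \<and> int (card C) = int d + 1 \<and> K = convex hull C \<and>
        (\<forall>u\<in>C. \<forall>v\<in>C. u \<noteq> v \<longrightarrow> dist u v = l))"

section \<open>Hausdorff measure\<close>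

text \<open>The normalising constant \<open>unit_ball_vol s / 2 ^ s\<close> is omitted, as only averages
  with respect to this measure are used.  Empty covering sets must contribute \<open>0\<close> also
  for \<open>s = 0\<close>, where nonempty ones contribute \<open>1\<close> (counting measure).  Covering sets are
  required to be bounded because \<^const>\<open>diameter\<close> is meaningless otherwise.\<close>

definition hausdorff_pre :: "nat \<Rightarrow> real \<Rightarrow> 'a::metric_space set \<Rightarrow> ennreal" where
  "hausdorff_pre s \<delta> A =
     (INF C \<in> {C :: nat \<Rightarrow> 'a set. A \<subseteq> (\<Union>i. C i) \<and> (\<forall>i. bounded (C i) \<and> diameter (C i) \<le> \<delta>)}.
        \<Sum>i. if C i = {} then 0 else ennreal (diameter (C i) ^ s))"

definition hausdorff_outer :: "nat \<Rightarrow> 'a::metric_space set \<Rightarrow> ennreal" where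
  "hausdorff_outer s A = (SUP \<delta>\<in>{0<..}. hausdorff_pre s \<delta> A)"

text \<open>This is a metric outer measure, hence countably additive on the Borel sets.\<close>

definition hausdorff_measure :: "nat \<Rightarrow> 'a::metric_space measure" where
  "hausdorff_measure s = measure_of UNIV (sets borel) (hausdorff_outer s)"

section \<open>Averages and the interior weight\<close>

definition average :: "'a measure \<Rightarrow> 'a set \<Rightarrow> ('a \<Rightarrow> real) \<Rightarrow> real" where
  "average M A f = (LINT x:A|M. f x) / measure M A"

definition cell_average :: "'a::euclidean_space set \<Rightarrow> ('a \<Rightarrow> real) \<Rightarrow> real" where
  "cell_average K U = average lborel K U"

definition boundary_average :: "'a::euclidean_space set \<Rightarrow> ('a \<Rightarrow> real) \<Rightarrow> real" where
  "boundary_average K U = average (hausdorff_measure (DIM('a) - 1)) (frontier K) U"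

definition polynomial_of_degree_le :: "nat \<Rightarrow> (real^'n \<Rightarrow> real) \<Rightarrow> bool" where
  "polynomial_of_degree_le k U \<longleftrightarrow>
     (\<exists>c :: ('n \<Rightarrow> nat) \<Rightarrow> real. \<forall>x.
        U x = (\<Sum>\<alpha> | (\<Sum>i\<in>UNIV. \<alpha> i) \<le> k. c \<alpha> * (\<Prod>i\<in>UNIV. (x $ i) ^ \<alpha> i)))"

text \<open>The supremum is taken in the extended reals, so that it is not presupposed to be finite.\<close>

definition interior_weight_bound :: "(real^'n) set \<Rightarrow> nat \<Rightarrow> ereal" where
  "interior_weight_bound K k =
     Sup {ereal (boundary_average K U / cell_average K U) | U.
            polynomial_of_degree_le k U \<and> (\<forall>x\<in>K. 0 \<le> U x) \<and> 0 < cell_average K U}"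

definition admissible_interior_weight :: "(real^'n) set \<Rightarrow> nat \<Rightarrow> real \<Rightarrow> bool" where
  "admissible_interior_weight K k M \<longleftrightarrow> interior_weight_bound K k \<le> ereal M"

definition star_weight :: "nat \<Rightarrow> nat \<Rightarrow> real" where
  "star_weight D k =
     (real_of_int \<lfloor>real k / 2\<rfloor> + 1) * (real_of_int \<lfloor>(real k + 1) / 2\<rfloor> + real D) / real D"

end

theory Submission
  imports Defs "HOL-Computational_Algebra.Polynomial"
begin

text \<open>Centre the cell \<open>K\<close> so that every outward unit normal satisfies \<open>n \<bullet> x = c\<close>. If a ray from the
origin meets the boundary at \<open>x\<close>, where the normal is \<open>n\<close>, it crosses the boundary with slope
\<open>n \<bullet> x = c\<close>; a bounded cell forces \<open>c > 0\<close>, so that crossings lead outwards only and almost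
every ray from the origin leaves \<open>K\<close> exactly once and never returns
(\<open>constant_support_cone_decomposition\<close>). Hence, up to null sets, \<open>K\<close> is the disjoint union of the
cones with apex \<open>0\<close> over its facets, all of which have height \<open>c\<close>.

Because the heights agree, the surface measure of a piece of the boundary is a fixed multiple of
the volume of the cone over it (\<open>rigid_measure_on_hyperplane\<close>): on a hyperplane both are
translation invariant, hence proportional by uniqueness of Haar measure, and a rotation carries
one hyperplane to another, so the factor is common to all facets. In polar coordinates on these cones
(\<open>flat_cone_polar\<close>) the average over \<open>K\<close> becomes the boundary average of the radial means
\<open>\<integral> D t^(D - 1) U (t x) dt\<close>, \<open>0 < t < 1\<close>, while the boundary average involves \<open>U x\<close> itself. Everything thus
reduces to one variable: for a real polynomial \<open>u\<close> of degree at most \<open>k\<close> that is nonnegative on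
\<open>[0,1]\<close>,

\<open>u 1 \<le> (k div 2 + 1) ((k + 1) div 2 + D) \<integral> t^(D - 1) u t dt\<close>

(\<open>nonneg_poly_endpoint_bound\<close>). For even \<open>k\<close> this is Gauss-Radau quadrature with node \<open>1\<close>: the
rule is exact in degree \<open>k\<close>, its weights are positive, and the weight at \<open>1\<close> is the reciprocal of
the constant. For odd \<open>k\<close> the additional node \<open>0\<close> does the same (Gauss-Lobatto).

The Hausdorff measure enters only through its invariance under isometries. If it gives the
boundary measure \<open>0\<close> or \<open>\<infinity>\<close>, the boundary average is \<open>0\<close> by the convention \<open>x / 0 = 0\<close> and the
bound is trivial; otherwise a patch of a hyperplane has finite measure and the argument above applies.

A regular simplex is star-regular about its centroid, with \<open>c\<close> its inradius.\<close>

section \<open>Nonnegative polynomials on the unit interval\<close>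

text \<open>With \<open>n = D - 1\<close> the weight \<open>x ^ n\<close> is, up to a factor, the radial density of Lebesgue measure in
dimension \<open>D\<close>.\<close>

definition moment :: "nat \<Rightarrow> real poly \<Rightarrow> real" where
  "moment n p = integral {0..1} (\<lambda>x. poly p x * x ^ n)"

lemma moment_integrable: "(\<lambda>x. poly p x * x ^ n) integrable_on {0..1::real}"
  by (intro integrable_continuous_interval continuous_intros)

lemma moment_add: "moment n (p + q) = moment n p + moment n q"
  unfolding moment_def poly_add distrib_right by (intro integral_add moment_integrable)

lemma moment_smult: "moment n (smult c p) = c * moment n p"
  unfolding moment_def by (simp add: mult.assoc)

lemma moment_0 [simp]: "moment n 0 = 0"
  by (simp add: moment_def)

lemma moment_sum: "moment n (\<Sum>i\<in>S. f i) = (\<Sum>i\<in>S. moment n (f i))"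
  by (induction S rule: infinite_finite_induct) (simp_all add: moment_add)

lemma moment_monom: "moment n (monom c j) = c / real (j + n + 1)"
proof -
  have d: "((\<lambda>x. x ^ Suc N / real (Suc N)) has_real_derivative x ^ N) (at x within {0..1})" for x :: real and N
    by (auto intro!: derivative_eq_intros simp del: power_Suc of_nat_Suc)
  have "((\<lambda>x. x ^ (j + n)) has_integral
      (1 ^ Suc (j + n) / real (Suc (j + n)) - 0 ^ Suc (j + n) / real (Suc (j + n)))) {0..1::real}"
    using d by (intro fundamental_theorem_of_calculus)
      (auto simp del: power_Suc of_nat_Suc simp flip: has_real_derivative_iff_has_vector_derivative)
  then have "integral {0..1::real} (\<lambda>x. x ^ (j + n)) = 1 / real (j + n + 1)"
    by (simp add: integral_unique)
  moreover have "moment n (monom c j) = c * integral {0..1::real} (\<lambda>x. x ^ (j + n))"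
    unfolding moment_def by (simp add: poly_monom power_add mult.assoc)
  ultimately show ?thesis by simp
qed

lemma moment_nonneg:
  assumes "\<And>x. 0 \<le> x \<Longrightarrow> x \<le> 1 \<Longrightarrow> 0 \<le> poly p x"
  shows "0 \<le> moment n p"
  unfolding moment_def using assms by (intro integral_nonneg moment_integrable) auto

lemma moment_eq_0_imp:
  assumes "\<And>x. 0 \<le> x \<Longrightarrow> x \<le> 1 \<Longrightarrow> 0 \<le> poly p x" and "moment n p = 0"
  shows "p = 0"
proof -
  have "poly p x * x ^ n = 0" if "x \<in> {0..1}" for x
  proof -
    have "integral {0..1} (\<lambda>x. poly p x * x ^ n) = 0 \<longleftrightarrow> (\<forall>x\<in>{0..1}. poly p x * x ^ n = 0)"
      using assms(1) by (intro integral_eq_0_iff continuous_intros) auto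
    with assms(2) that show ?thesis by (auto simp: moment_def)
  qed
  then have "poly p x = 0" if "x \<in> {0<..1}" for x using that by (metis atLeastAtMost_iff greaterThanAtMost_iff less_imp_le
      mult_eq_0_iff order_less_irrefl power_not_zero)
  then have "{0<..1} \<subseteq> {x. poly p x = 0}" by blast
  moreover have "infinite {0<..1::real}" by simp
  ultimately show "p = 0" using poly_roots_finite[of p] finite_subset by blast
qed

lemma degree_coeff_prod_linear:
  fixes c :: "'b \<Rightarrow> real"
  assumes "finite S"
  shows "degree (\<Prod>j\<in>S. [:c j, 1:]) = card S \<and> coeff (\<Prod>j\<in>S. [:c j, 1:]) (card S) = 1"
  using assms
proof (induction S)
  case (insert x S)
  have "lead_coeff ([:c x, 1:] * (\<Prod>j\<in>S. [:c j, 1:])) = 1"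
    unfolding lead_coeff_mult using insert by simp
  moreover have "degree ([:c x, 1:] * (\<Prod>j\<in>S. [:c j, 1:])) = 1 + card S"
    using insert by (subst degree_mult_eq) auto
  ultimately show ?case using insert by simp
qed simp

lemma coeff_prod_linear_subleading:
  fixes c :: "nat \<Rightarrow> real"
  shows "coeff (\<Prod>j\<le>m. [:c j, 1:]) m = (\<Sum>j\<le>m. c j)"
proof (induction m)
  case (Suc m)
  have "coeff (\<Prod>j\<le>m. [:c j, 1:]) (Suc m) = 1"
    using degree_coeff_prod_linear[of "{..m}" c] by simp
  with Suc show ?case by simp
qed simp

lemma poly_eq_of_card:
  fixes p q :: "real poly"
  assumes "finite S" "\<And>x. x \<in> S \<Longrightarrow> poly p x = poly q x" "degree p < card S" "degree q < card S"
  shows "p = q"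
proof (rule ccontr)
  assume "p \<noteq> q"
  then have "p - q \<noteq> 0" by simp
  then have "card {x. poly (p - q) x = 0} \<le> degree (p - q)" and "finite {x. poly (p - q) x = 0}"
    by (rule card_poly_roots_bound, rule poly_roots_finite)
  moreover have "S \<subseteq> {x. poly (p - q) x = 0}" using assms(2) by auto
  ultimately have "card S \<le> degree (p - q)" by (meson card_mono order_trans)
  moreover have "degree (p - q) < card S" using assms(3,4) by (metis degree_diff_less)
  ultimately show False by simp
qed

text \<open>The kernel that represents evaluation at \<open>1\<close>. Testing \<open>Q = (\<Sum>j\<le>m. q j x^j)\<close> against monomials turns
the reproducing property into \<open>(\<Sum>j\<le>m. q j / (s + j + n + 1)) = 1\<close> for \<open>s = 0, ..., m\<close>. Partial
fractions solve this system: the left side minus \<open>1\<close> has to be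
\<open>- (\<Prod>i\<le>m. s - i) / (\<Prod>j\<le>m. s + j + n + 1)\<close>. The value \<open>Q 1\<close> is the sum of the residues, which can be
read off from the subleading coefficients of the two products.\<close>

lemma reproducing_kernel:
  obtains Q :: "real poly" where
    "degree Q \<le> m" "poly Q 1 = real (m + 1) * real (m + n + 1)"
    "\<And>f. degree f \<le> m \<Longrightarrow> moment n (Q * f) = poly f 1"
proof -
  define d :: "nat \<Rightarrow> real" where "d = (\<lambda>j. real (n + 1 + j))"
  define A where "A = (\<Prod>j\<le>m. [:d j, 1:])"
  define B where "B = (\<Prod>j\<le>m. [:- real j, 1:])"
  define A' where "A' = (\<lambda>j. \<Prod>l\<in>{..m} - {j}. [:d l, 1:])"
  \<comment> \<open>the residue of \<open>- B / A\<close> at its pole \<open>- d j\<close>\<close>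
  define q where "q = (\<lambda>j. - poly B (- d j) / poly (A' j) (- d j))"
  have A: "degree A = Suc m" "coeff A (Suc m) = 1" "coeff A m = (\<Sum>j\<le>m. d j)"
    using degree_coeff_prod_linear[of "{..m}" d] coeff_prod_linear_subleading[of d m]
    by (auto simp: A_def)
  have B: "degree B = Suc m" "coeff B (Suc m) = 1" "coeff B m = (\<Sum>j\<le>m. - real j)"
    using degree_coeff_prod_linear[of "{..m}" "\<lambda>j. - real j"]
      coeff_prod_linear_subleading[of "\<lambda>j. - real j" m]
    by (auto simp: B_def)
  have A': "degree (A' j) = m" "coeff (A' j) m = 1" if "j \<le> m" for j
    using that degree_coeff_prod_linear[of "{..m} - {j}" d] by (auto simp: A'_def card_Diff_singleton)
  have A_split: "A = [:d j, 1:] * A' j" if "j \<le> m" for j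
    using that unfolding A_def A'_def by (subst prod.remove[of _ j]) auto
  have A'0: "poly (A' j) (- d l) = 0" if "l \<le> m" "j \<noteq> l" for j l
    using that by (auto simp: A'_def poly_prod)
  have A'1: "poly (A' j) (- d j) \<noteq> 0" for j
    by (auto simp: A'_def poly_prod d_def)
  have dinj: "inj d" by (auto simp: d_def inj_def)
  \<comment> \<open>the partial fraction decomposition of \<open>1 - B / A\<close>, multiplied by \<open>A\<close>\<close>
  have AB: "A - B = (\<Sum>j\<le>m. smult (q j) (A' j))"
  proof (rule poly_eq_of_card[where S = "(\<lambda>j. - d j) ` {..m}"])
    have c: "card ((\<lambda>j. - d j) ` {..m}) = Suc m"
      using dinj by (subst card_image) (auto simp: inj_on_def)
    have "degree (A - B) \<le> m"
    proof (rule degree_le, intro allI impI)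
      fix i assume "m < i"
      show "coeff (A - B) i = 0"
      proof (cases "i = Suc m")
        case True then show ?thesis using A B by simp
      next
        case False
        then have "degree A < i" "degree B < i" using \<open>m < i\<close> A B by auto
        then show ?thesis by (simp add: coeff_eq_0)
      qed
    qed
    then show "degree (A - B) < card ((\<lambda>j. - d j) ` {..m})" using c by simp
    have "degree (\<Sum>j\<le>m. smult (q j) (A' j)) \<le> m"
      by (intro degree_sum_le) (auto intro: order_trans[OF degree_smult_le] simp: A')
    then show "degree (\<Sum>j\<le>m. smult (q j) (A' j)) < card ((\<lambda>j. - d j) ` {..m})" using c by simp
    fix x assume "x \<in> (\<lambda>j. - d j) ` {..m}"
    then obtain l where l: "l \<le> m" "x = - d l" by auto
    have "poly (\<Sum>j\<le>m. smult (q j) (A' j)) x = (\<Sum>j\<le>m. if j = l then q l * poly (A' l) x else 0)"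
      unfolding poly_sum using l A'0 by (intro sum.cong) auto
    also have "\<dots> = q l * poly (A' l) x" using l by (simp add: sum.delta)
    also have "\<dots> = - poly B x" using A'1[of l] l by (simp add: q_def)
    also have "\<dots> = poly (A - B) x" using A_split[of l] l by simp
    finally show "poly (A - B) x = poly (\<Sum>j\<le>m. smult (q j) (A' j)) x" by simp
  qed simp
  define Q where "Q = (\<Sum>j\<le>m. monom (q j) j)"
  have sum_q: "(\<Sum>j\<le>m. q j / real (j + i + n + 1)) = 1" if "i \<le> m" for i
  proof -
    have "poly B (real i) = 0" using that by (auto simp: B_def poly_prod)
    \<comment> \<open>\<open>B\<close> vanishes at \<open>i\<close>, so the decomposition there reads \<open>(\<Sum>j\<le>m. q j / (i + d j)) = 1\<close>\<close>
    then have "poly A (real i) = (\<Sum>j\<le>m. q j * poly (A' j) (real i))"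
      using arg_cong[OF AB, of "\<lambda>p. poly p (real i)"] by (simp add: poly_sum)
    also have "\<dots> = (\<Sum>j\<le>m. q j * (poly A (real i) / real (j + i + n + 1)))"
    proof (rule sum.cong)
      fix j assume "j \<in> {..m}"
      then have "poly A (real i) = real (j + i + n + 1) * poly (A' j) (real i)"
        using A_split[of j] by (simp add: d_def algebra_simps)
      then show "q j * poly (A' j) (real i) = q j * (poly A (real i) / real (j + i + n + 1))" by simp
    qed simp
    also have "\<dots> = poly A (real i) * (\<Sum>j\<le>m. q j / real (j + i + n + 1))"
      by (simp add: sum_distrib_left algebra_simps)
    finally have "poly A (real i) = poly A (real i) * (\<Sum>j\<le>m. q j / real (j + i + n + 1))" .
    moreover have "poly A (real i) \<noteq> 0"
    proof -
      have "real i + d j > 0" for j by (simp add: d_def)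
      then have "d j + real i \<noteq> 0" for j by (metis add.commute less_irrefl)
      then show ?thesis by (simp add: A_def poly_prod)
    qed
    ultimately show ?thesis by simp
  qed
  show thesis
  proof
    show "degree Q \<le> m"
      unfolding Q_def by (intro degree_sum_le) (auto intro: order_trans[OF degree_monom_le])
    have gs: "(\<Sum>j\<le>m. real j) = real m * (real m + 1) / 2" by (induction m) (auto simp: field_simps)
    have "poly Q 1 = (\<Sum>j\<le>m. q j)" by (simp add: Q_def poly_sum poly_monom)
    also have "\<dots> = coeff (\<Sum>j\<le>m. smult (q j) (A' j)) m" by (simp add: coeff_sum A')
    also have "\<dots> = (\<Sum>j\<le>m. d j) - (\<Sum>j\<le>m. - real j)" unfolding AB[symmetric] by (simp add: A B)
    also have "\<dots> = real (m + 1) * real (n + 1) + 2 * (\<Sum>j\<le>m. real j)"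
      by (simp add: d_def sum.distrib sum_negf algebra_simps)
    also have "\<dots> = real (m + 1) * real (m + n + 1)" unfolding gs by (simp add: algebra_simps)
    finally show "poly Q 1 = real (m + 1) * real (m + n + 1)" .
    fix f :: "real poly" assume f: "degree f \<le> m"
    have "f = (\<Sum>i\<le>m. monom (coeff f i) i)" using poly_as_sum_of_monoms'[OF f] by simp
    then have "Q * f = Q * (\<Sum>i\<le>m. monom (coeff f i) i)" by simp
    also have "\<dots> = (\<Sum>j\<le>m. \<Sum>i\<le>m. monom (q j * coeff f i) (j + i))"
      unfolding Q_def by (simp add: sum_product mult_monom)
    also have "\<dots> = (\<Sum>i\<le>m. \<Sum>j\<le>m. monom (q j * coeff f i) (j + i))"
      by (rule sum.swap)
    finally have "Q * f = (\<Sum>i\<le>m. \<Sum>j\<le>m. monom (q j * coeff f i) (j + i))" .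
    then have "moment n (Q * f) = (\<Sum>i\<le>m. \<Sum>j\<le>m. q j * coeff f i / real (j + i + n + 1))"
      by (simp add: moment_sum moment_monom)
    also have "\<dots> = (\<Sum>i\<le>m. coeff f i * (\<Sum>j\<le>m. q j / real (j + i + n + 1)))"
      by (simp add: sum_distrib_left mult.commute)
    also have "\<dots> = (\<Sum>i\<le>m. coeff f i)" using sum_q by simp
    also have "\<dots> = poly f 1"
      using f by (subst (2) poly_as_sum_of_monoms'[OF f, symmetric]) (simp add: poly_sum poly_monom)
    finally show "moment n (Q * f) = poly f 1" .
  qed
qed

text \<open>Multiplying by one linear factor for each sign change makes the sign constant. The induction splits
off a root \<open>a\<close> of \<open>p\<close> and toggles the membership of \<open>a\<close> in the set of sign changes.\<close>

lemma sign_change_roots: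
  fixes p :: "real poly"
  assumes "p \<noteq> 0"
  obtains A where "finite A" "A \<subseteq> {0<..<1}" "\<And>a. a \<in> A \<Longrightarrow> poly p a = 0"
    "(\<forall>x\<in>{0<..<1}. 0 \<le> poly (p * (\<Prod>a\<in>A. [:-a, 1:])) x) \<or>
     (\<forall>x\<in>{0<..<1}. poly (p * (\<Prod>a\<in>A. [:-a, 1:])) x \<le> 0)"
proof -
  have "\<exists>A. finite A \<and> A \<subseteq> {0<..<1} \<and> (\<forall>a\<in>A. poly p a = 0) \<and>
    ((\<forall>x\<in>{0<..<1}. 0 \<le> poly (p * (\<Prod>a\<in>A. [:-a, 1:])) x) \<or>
     (\<forall>x\<in>{0<..<1}. poly (p * (\<Prod>a\<in>A. [:-a, 1:])) x \<le> 0))"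
    using assms
  proof (induction "degree p" arbitrary: p rule: less_induct)
    case less
    show ?case
    proof (cases "\<exists>a\<in>{0<..<1}. poly p a = 0")
      case False
      have "(\<forall>x\<in>{0<..<1}. 0 \<le> poly p x) \<or> (\<forall>x\<in>{0<..<1}. poly p x \<le> 0)"
      proof (rule ccontr)
        assume "\<not> ?thesis"
        then obtain x y where xy: "x \<in> {0<..<1}" "y \<in> {0<..<1}" "poly p x < 0" "0 < poly p y" by force
        have "connected (poly p ` {0<..<1})"
          by (intro connected_continuous_image continuous_intros) auto
        then have "0 \<in> poly p ` {0<..<1}"
          using xy by (meson connectedD_interval image_eqI less_imp_le)
        with False show False by force
      qed
      then show ?thesis by (intro exI[of _ "{}"]) auto
    next
      case True
      then obtain a where a: "a \<in> {0<..<1}" "poly p a = 0" by auto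
      then obtain r where r: "p = [:-a, 1:] * r" by (metis dvdE poly_eq_0_iff_dvd)
      with less have "r \<noteq> 0" by auto
      then have "degree p = Suc (degree r)" unfolding r by (subst degree_mult_eq) auto
      with less \<open>r \<noteq> 0\<close> obtain A where A: "finite A" "A \<subseteq> {0<..<1}" "\<forall>a\<in>A. poly r a = 0"
        "(\<forall>x\<in>{0<..<1}. 0 \<le> poly (r * (\<Prod>a\<in>A. [:-a, 1:])) x) \<or>
         (\<forall>x\<in>{0<..<1}. poly (r * (\<Prod>a\<in>A. [:-a, 1:])) x \<le> 0)"
        by (metis lessI)
      show ?thesis
      proof (cases "a \<in> A")
        case True
        have "r * (\<Prod>b\<in>A. [:-b, 1:]) = p * (\<Prod>b\<in>A - {a}. [:-b, 1:])"
          unfolding r prod.remove[OF A(1) True] by (simp only: mult_ac)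
        then show ?thesis using A r by (intro exI[of _ "A - {a}"]) auto
      next
        case False
        have "p * (\<Prod>b\<in>insert a A. [:-b, 1:]) = [:-a, 1:]\<^sup>2 * (r * (\<Prod>b\<in>A. [:-b, 1:]))"
          unfolding r prod.insert[OF A(1) False] power2_eq_square by (simp only: mult_ac)
        then have "poly (p * (\<Prod>b\<in>insert a A. [:-b, 1:])) x = (x - a)\<^sup>2 * poly (r * (\<Prod>b\<in>A. [:-b, 1:])) x" for x
          by (simp only: poly_mult poly_power) (simp add: algebra_simps)
        then have "(\<forall>x\<in>{0<..<1}. 0 \<le> poly (p * (\<Prod>b\<in>insert a A. [:-b, 1:])) x) \<or>
            (\<forall>x\<in>{0<..<1}. poly (p * (\<Prod>b\<in>insert a A. [:-b, 1:])) x \<le> 0)"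
          using A(4) by (metis mult_nonneg_nonneg mult_nonneg_nonpos zero_le_power2)
        moreover have "\<forall>b\<in>insert a A. poly p b = 0" using A(3) a r by auto
        ultimately show ?thesis using A(1,2) a(1) by (intro exI[of _ "insert a A"]) blast
      qed
    qed
  qed
  then show thesis using that by blast
qed

text \<open>The kernel is orthogonal to all multiples of \<open>1 - x\<close> of degree at most \<open>m\<close>. With fewer than \<open>m\<close>
sign changes in \<open>(0,1)\<close>, one of these multiples would have the same sign as the kernel throughout.\<close>

lemma radau_nodes:
  obtains Q A where
    "degree Q = m" "poly Q 1 = real (m + 1) * real (m + n + 1)"
    "\<And>f. degree f \<le> m \<Longrightarrow> moment n (Q * f) = poly f 1"
    "finite A" "card A = m" "A \<subseteq> {0<..<1}" "\<And>a. a \<in> A \<Longrightarrow> poly Q a = 0"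
proof -
  obtain Q where Q: "degree Q \<le> m" "poly Q 1 = real (m + 1) * real (m + n + 1)"
    "\<And>f. degree f \<le> m \<Longrightarrow> moment n (Q * f) = poly f 1"
    by (rule reproducing_kernel[of m n]) (rule that)
  have "Q \<noteq> 0" using Q(2) by auto
  from sign_change_roots[OF this] obtain A where A: "finite A" "A \<subseteq> {0<..<1}" "\<And>a. a \<in> A \<Longrightarrow> poly Q a = 0"
    "(\<forall>x\<in>{0<..<1}. 0 \<le> poly (Q * (\<Prod>a\<in>A. [:-a, 1:])) x) \<or>
     (\<forall>x\<in>{0<..<1}. poly (Q * (\<Prod>a\<in>A. [:-a, 1:])) x \<le> 0)" by metis
  define g where "g = (\<Prod>a\<in>A. [:-a, 1:])"
  have g: "degree g = card A" "g \<noteq> 0"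
    using degree_coeff_prod_linear[OF A(1), of uminus] A(1) by (auto simp: g_def)
  have "m \<le> card A"
  proof (rule ccontr)
    assume "\<not> m \<le> card A"
    have z: "moment n (Q * ([:1, -1:] * g)) = 0"
    proof -
      have "degree ([:1, -1:] * g) \<le> m"
        using \<open>\<not> m \<le> card A\<close> g by (subst degree_mult_eq) auto
      then show ?thesis using Q(3) by simp
    qed
    define h where "h = Q * ([:1, -1:] * g)"
    have "h \<noteq> 0" using \<open>Q \<noteq> 0\<close> g unfolding h_def mult_eq_0_iff by simp
    have hx: "poly h x = (1 - x) * poly (Q * g) x" for x by (simp add: h_def algebra_simps)
    have closed: "closed {x. 0 \<le> poly p x}" for p :: "real poly"
      by (intro closed_Collect_le continuous_intros)
    have ext: "\<forall>x. 0 \<le> x \<longrightarrow> x \<le> 1 \<longrightarrow> 0 \<le> poly p x" if "\<forall>x\<in>{0<..<1}. 0 \<le> poly p x" for p :: "real poly"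
    proof -
      have "closure {0<..<1} \<subseteq> {x. 0 \<le> poly p x}"
        using that by (intro closure_minimal closed) auto
      then show ?thesis by auto
    qed
    from A(4) show False
    proof
      assume "\<forall>x\<in>{0<..<1}. 0 \<le> poly (Q * (\<Prod>a\<in>A. [:-a, 1:])) x"
      then have "\<forall>x\<in>{0<..<1}. 0 \<le> poly h x" unfolding hx g_def[symmetric] by auto
      with ext[of h] z \<open>h \<noteq> 0\<close> show False unfolding h_def[symmetric] by (metis moment_eq_0_imp)
    next
      assume "\<forall>x\<in>{0<..<1}. poly (Q * (\<Prod>a\<in>A. [:-a, 1:])) x \<le> 0"
      then have "\<forall>x\<in>{0<..<1}. 0 \<le> poly (- h) x"
        unfolding poly_minus hx g_def[symmetric] by (auto simp: mult_nonneg_nonpos)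
      moreover have "moment n (- h) = 0" using z moment_smult[of n "-1" h] by (simp add: h_def)
      ultimately show False using ext[of "- h"] \<open>h \<noteq> 0\<close> by (metis moment_eq_0_imp neg_equal_0_iff_equal)
    qed
  qed
  moreover have "card A \<le> degree Q"
  proof -
    have "A \<subseteq> {x. poly Q x = 0}" using A(3) by auto
    then show ?thesis
      using card_poly_roots_bound[OF \<open>Q \<noteq> 0\<close>] poly_roots_finite[OF \<open>Q \<noteq> 0\<close>]
      by (meson card_mono order_trans)
  qed
  ultimately show thesis using Q A that[of Q A] by simp
qed

text \<open>Interpolation at the roots of the kernel and at \<open>1\<close> leaves a remainder divisible by \<open>(x - 1) Q\<close>,
whose integral vanishes; hence the rule is exact in degree \<open>2 m\<close>. Applied to the square of a
Lagrange polynomial it shows that the weights are nonnegative. The Lagrange polynomial of the node \<open>1\<close>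
is \<open>Q / Q 1\<close>, so the weight there is \<open>1 / Q 1\<close>.\<close>

lemma radau_quadrature:
  obtains w A where
    "finite A" "card A = m" "A \<subseteq> {0<..<1}" "\<And>a. a \<in> A \<Longrightarrow> 0 \<le> w a"
    "\<And>u. degree u \<le> 2 * m \<Longrightarrow>
       moment n u = poly u 1 / (real (m + 1) * real (m + n + 1)) + (\<Sum>a\<in>A. w a * poly u a)"
proof -
  obtain Q A where Q: "degree Q = m" "poly Q 1 = real (m + 1) * real (m + n + 1)"
    "\<And>f. degree f \<le> m \<Longrightarrow> moment n (Q * f) = poly f 1"
    and A: "finite A" "card A = m" "A \<subseteq> {0<..<1}" "\<And>a. a \<in> A \<Longrightarrow> poly Q a = 0"
    by (rule radau_nodes[of m n]) (rule that)
  define B where "B = insert 1 A"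
  define l where "l = (\<lambda>a. smult (1 / (\<Prod>b\<in>B - {a}. a - b)) (\<Prod>b\<in>B - {a}. [:-b, 1:]))"
  have "1 \<notin> A" using A(3) by auto
  then have B: "finite B" "card B = Suc m" using A by (auto simp: B_def)
  have l_deg: "degree (l a) \<le> m" if "a \<in> B" for a
    unfolding l_def using that B degree_coeff_prod_linear[of "B - {a}" uminus]
    by (intro order_trans[OF degree_smult_le]) auto
  have l_val: "poly (l a) b = (if a = b then 1 else 0)" if "b \<in> B" for a b
    using that B(1) by (auto simp: l_def poly_prod)
  have l1: "l 1 = smult (1 / poly Q 1) Q"
  proof (rule poly_eq_of_card[OF B(1)])
    fix x assume "x \<in> B"
    then show "poly (l 1) x = poly (smult (1 / poly Q 1) Q) x"
      using A(4) Q(2) by (auto simp: l_val) (auto simp: B_def)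
  qed (use B l_deg[of 1] Q(1) in \<open>auto simp: B_def\<close>)
  have quad: "moment n u = (\<Sum>a\<in>B. poly u a * moment n (l a))" if u: "degree u \<le> 2 * m" for u
  proof -
    define L where "L = (\<Sum>a\<in>B. smult (poly u a) (l a))"
    have Q0: "Q \<noteq> 0" using Q(2) by auto
    have L: "poly L b = poly u b" if "b \<in> B" for b
      using that B(1) by (simp add: L_def poly_sum l_val if_distrib sum.delta cong: if_cong)
    have L_deg: "degree L \<le> m"
      unfolding L_def using l_deg B(1)
      by (intro degree_sum_le) (auto intro: order_trans[OF degree_smult_le])
    define r where "r = (u - L) mod ([:-1, 1:] * Q)"
    define s where "s = (u - L) div ([:-1, 1:] * Q)"
    have degF: "degree ([:-1, 1:] * Q) = Suc m" using Q0 Q(1) by (subst degree_mult_eq) auto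
    have split: "u - L = [:-1, 1:] * Q * s + r" unfolding r_def s_def by simp
    have "r = 0"
    proof (rule poly_eq_of_card[OF B(1)])
      fix x assume x: "x \<in> B"
      have "poly ([:-1, 1:] * Q) x = 0" using x A(4) by (auto simp: B_def)
      then have "poly r x = poly (u - L) x" unfolding split by simp
      then show "poly r x = poly 0 x" using L[OF x] by simp
    next
      have "degree r < Suc m"
        using degree_mod_less'[of "[:-1, 1:] * Q" "u - L"] degF Q0 unfolding r_def
        by (metis degree_0 less_Suc_eq_0_disj less_nat_zero_code degree_mod_less not_less_zero
          zero_less_Suc)
      then show "degree r < card B" using B by simp
    qed (use B in simp)
    have "degree ([:-1, 1:] * s) \<le> m"
    proof (cases "s = 0")
      case False
      have "degree (u - L) \<le> 2 * m" using u L_deg by (intro degree_diff_le) auto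
      moreover have "degree (u - L) = Suc m + degree s"
        unfolding split \<open>r = 0\<close> using False Q0 degF by (simp only: add_0_right, subst degree_mult_eq) auto
      ultimately show ?thesis using False by (subst degree_mult_eq) auto
    qed simp
    then have "moment n (Q * ([:-1, 1:] * s)) = 0" using Q(3) by simp
    moreover have "u = L + Q * ([:-1, 1:] * s)" using split \<open>r = 0\<close> by (simp add: algebra_simps)
    ultimately have "moment n u = moment n L" by (metis moment_add add_0_right)
    then show ?thesis by (simp add: L_def moment_sum moment_smult)
  qed
  have w_pos: "0 \<le> moment n (l a)" if "a \<in> B" for a
  proof -
    have "degree (l a * l a) \<le> 2 * m" using l_deg[OF that] degree_mult_le[of "l a" "l a"] by simp
    then have "moment n (l a * l a) = (\<Sum>b\<in>B. poly (l a * l a) b * moment n (l b))" by (rule quad)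
    also have "\<dots> = (\<Sum>b\<in>B. if a = b then moment n (l a) else 0)"
      by (intro sum.cong) (auto simp: l_val)
    also have "\<dots> = moment n (l a)" using that B(1) by simp
    finally show ?thesis using moment_nonneg[of "l a * l a" n] by simp
  qed
  have "moment n (l 1) = 1 / (real (m + 1) * real (m + n + 1))"
    unfolding l1 moment_smult using Q(2) Q(3)[of 1] by simp
  then show thesis using quad w_pos A \<open>1 \<notin> A\<close>
    by (intro that[of A "\<lambda>a. moment n (l a)"]) (auto simp: B_def mult.commute)
qed

text \<open>For odd degree, write \<open>v = v 0 + x q\<close> and apply the Radau rule for the weight \<open>x ^ (n + 1)\<close> to \<open>q\<close>.
This produces a rule with the additional node \<open>0\<close>, whose weight is nonnegative because the rule is
exact for \<open>1 - x\<close> times the square of the node polynomial.\<close>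

lemma nonneg_poly_endpoint_bound:
  fixes u :: "real poly"
  assumes deg: "degree u \<le> k" and nonneg: "\<And>x. 0 \<le> x \<Longrightarrow> x \<le> 1 \<Longrightarrow> 0 \<le> poly u x"
  shows "poly u 1 \<le> real (k div 2 + 1) * real ((k + 1) div 2 + n + 1) * moment n u"
proof (cases "even k")
  case True
  define m where "m = k div 2"
  have k: "k = 2 * m" "(k + 1) div 2 = m" using True by (auto simp: m_def)
  obtain w A where A: "finite A" "card A = m" "A \<subseteq> {0<..<1}" "\<And>a. a \<in> A \<Longrightarrow> 0 \<le> w a"
    and quad: "\<And>u. degree u \<le> 2 * m \<Longrightarrow>
       moment n u = poly u 1 / (real (m + 1) * real (m + n + 1)) + (\<Sum>a\<in>A. w a * poly u a)"
    by (rule radau_quadrature[of m n]) (rule that)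
  have "0 \<le> (\<Sum>a\<in>A. w a * poly u a)"
    using A nonneg by (intro sum_nonneg mult_nonneg_nonneg) (auto simp: subset_iff)
  then have "poly u 1 / (real (m + 1) * real (m + n + 1)) \<le> moment n u"
    using quad[of u] deg k by simp
  then show ?thesis unfolding m_def[symmetric] k(2)
    by (simp add: divide_le_eq mult_ac del: of_nat_add of_nat_mult)
next
  case False
  define m where "m = k div 2"
  have k: "k = 2 * m + 1" "(k + 1) div 2 = m + 1" using False by (auto simp: m_def elim: oddE)
  obtain w A where A: "finite A" "card A = m" "A \<subseteq> {0<..<1}" "\<And>a. a \<in> A \<Longrightarrow> 0 \<le> w a"
    and quad: "\<And>u. degree u \<le> 2 * m \<Longrightarrow>
       moment (n + 1) u = poly u 1 / (real (m + 1) * real (m + (n + 1) + 1)) + (\<Sum>a\<in>A. w a * poly u a)"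
    by (rule radau_quadrature[of m "n + 1"]) (rule that)
  define W where "W = 1 / real (n + 1) - 1 / (real (m + 1) * real (m + n + 2)) - (\<Sum>a\<in>A. w a / a)"
  have lobatto: "moment n v = W * poly v 0 + poly v 1 / (real (m + 1) * real (m + n + 2)) +
      (\<Sum>a\<in>A. w a / a * poly v a)" if v: "degree v \<le> 2 * m + 1" for v
  proof -
    obtain c q where v_eq: "v = pCons c q" by (cases v)
    have "degree q \<le> 2 * m" using v by (auto simp: v_eq degree_pCons_eq_if split: if_splits)
    have "moment n (pCons 0 q) = moment (n + 1) q" by (simp add: moment_def mult_ac)
    moreover have "v = monom c 0 + pCons 0 q" by (simp add: v_eq monom_0)
    ultimately have "moment n v = c / real (n + 1) + moment (n + 1) q"
      by (simp add: moment_add moment_monom)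
    also have "\<dots> = c / real (n + 1) + (poly q 1 / (real (m + 1) * real (m + n + 2)) + (\<Sum>a\<in>A. w a * poly q a))"
      using quad[OF \<open>degree q \<le> 2 * m\<close>] by simp
    also have "poly q 1 = poly v 1 - c" by (simp add: v_eq)
    also have "(\<Sum>a\<in>A. w a * poly q a) = (\<Sum>a\<in>A. w a / a * poly v a - w a / a * c)"
      using A(3) by (intro sum.cong) (auto simp: v_eq field_simps subset_iff)
    also have "\<dots> = (\<Sum>a\<in>A. w a / a * poly v a) - (\<Sum>a\<in>A. w a / a) * c"
      by (simp add: sum_subtractf sum_distrib_right)
    also have "c = poly v 0" by (simp add: v_eq)
    finally show ?thesis by (simp add: W_def algebra_simps diff_divide_distrib)
  qed
  have "0 \<le> W"
  proof -
    define g where "g = (\<Prod>a\<in>A. [:-a, 1:])"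
    define v where "v = [:1, -1:] * (g * g)"
    have "degree g = m"
      using degree_coeff_prod_linear[OF A(1), of uminus] A(2) by (simp add: g_def)
    then have "degree v \<le> 2 * m + 1"
      unfolding v_def using degree_mult_le[of "[:1, -1:]" "g * g"] degree_mult_le[of g g] by simp
    then have "moment n v = W * poly v 0 + poly v 1 / (real (m + 1) * real (m + n + 2)) +
      (\<Sum>a\<in>A. w a / a * poly v a)" by (rule lobatto)
    moreover have "poly v 1 = 0" by (simp add: v_def)
    moreover have "(\<Sum>a\<in>A. w a / a * poly v a) = 0"
      using A(1) by (intro sum.neutral) (auto simp: v_def g_def poly_prod)
    moreover have "0 \<le> moment n v"
      by (intro moment_nonneg) (auto simp: v_def algebra_simps mult_left_le_one_le)
    moreover have "0 < poly v 0"
    proof -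
      have "poly g 0 \<noteq> 0" using A(1,3) by (auto simp: g_def poly_prod)
      then show ?thesis by (auto simp: v_def zero_less_mult_iff linorder_neq_iff)
    qed
    ultimately show ?thesis by (simp add: zero_le_mult_iff)
  qed
  have "0 \<le> (\<Sum>a\<in>A. w a / a * poly u a)"
    using A nonneg by (intro sum_nonneg mult_nonneg_nonneg divide_nonneg_nonneg) (auto simp: subset_iff less_imp_le)
  moreover have "0 \<le> W * poly u 0" using \<open>0 \<le> W\<close> nonneg[of 0] by simp
  ultimately have "poly u 1 / (real (m + 1) * real (m + n + 2)) \<le> moment n u"
    using lobatto[of u] deg k by simp
  moreover have "m + 1 + n + 1 = m + n + 2" by simp
  ultimately show ?thesis unfolding m_def[symmetric] k(2)
    by (simp add: divide_le_eq mult_ac del: of_nat_add of_nat_mult)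
qed

section \<open>Translation-invariant measures and linear maps\<close>

text \<open>The standard proof of uniqueness of Haar measure: evaluate
\<open>\<integral> \<integral> 1_A x 1_B (x + y) d\<mu> d\<nu>\<close> in both orders. The measures live on the ambient space and are only
supported on \<open>V\<close>, so that hyperplanes can be treated without introducing a type for them.\<close>

lemma haar_unique_on:
  fixes \<mu> \<nu> :: "'a::euclidean_space measure" and V :: "'a set"
  assumes sm: "sigma_finite_measure \<mu>" "sets \<mu> = sets borel"
    and sn: "sigma_finite_measure \<nu>" "sets \<nu> = sets borel"
    and V: "V \<in> sets borel" "\<And>x. x \<in> V \<Longrightarrow> - x \<in> V"
    and supp: "emeasure \<mu> (- V) = 0" "emeasure \<nu> (- V) = 0"
    and inv: "\<And>v. v \<in> V \<Longrightarrow> distr \<mu> borel (\<lambda>x. v + x) = \<mu>"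
             "\<And>v. v \<in> V \<Longrightarrow> distr \<nu> borel (\<lambda>x. v + x) = \<nu>"
    and A: "A \<in> sets borel" and B: "B \<in> sets borel"
  shows "emeasure \<mu> A * emeasure \<nu> B = emeasure \<mu> B * emeasure \<nu> (uminus ` A)"
proof -
  interpret m: sigma_finite_measure \<mu> by fact
  interpret n: sigma_finite_measure \<nu> by fact
  interpret pair_sigma_finite \<nu> \<mu> ..
  interpret p': pair_sigma_finite \<mu> \<nu> ..
  have [measurable_cong]: "sets \<mu> = sets borel" "sets \<nu> = sets borel" by fact+
  have [measurable]: "A \<in> sets borel" "B \<in> sets borel" "V \<in> sets borel" by fact+
  have AEm: "AE x in \<mu>. x \<in> V" using supp(1) V(1)
    by (intro AE_I[where N = "- V"]) (auto simp: sm)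
  have AEn: "AE x in \<nu>. x \<in> V" using supp(2) V(1)
    by (intro AE_I[where N = "- V"]) (auto simp: sn)
  have shiftn: "(\<integral>\<^sup>+y. f (v + y) \<partial>\<nu>) = (\<integral>\<^sup>+y. f y \<partial>\<nu>)" if "v \<in> V" "f \<in> borel_measurable borel" for v f
    using that by (subst (2) inv(2)[OF that(1), symmetric]) (simp add: nn_integral_distr)
  have shiftm: "(\<integral>\<^sup>+y. f (v + y) \<partial>\<mu>) = (\<integral>\<^sup>+y. f y \<partial>\<mu>)" if "v \<in> V" "f \<in> borel_measurable borel" for v f
    using that by (subst (2) inv(1)[OF that(1), symmetric]) (simp add: nn_integral_distr)
  have mA: "uminus ` A = {x. - x \<in> A}" by force
  have "emeasure \<mu> A * emeasure \<nu> B = (\<integral>\<^sup>+x. indicator A x * emeasure \<nu> B \<partial>\<mu>)"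
    by (simp add: nn_integral_multc)
  also have "\<dots> = (\<integral>\<^sup>+x. \<integral>\<^sup>+y. indicator A x * indicator B (x + y) \<partial>\<nu> \<partial>\<mu>)"
  proof (rule nn_integral_cong_AE, use AEm in eventually_elim)
    fix x assume x: "x \<in> V"
    have "(\<integral>\<^sup>+y. indicator A x * indicator B (x + y) \<partial>\<nu>) = indicator A x * (\<integral>\<^sup>+y. indicator B (x + y) \<partial>\<nu>)"
      by (rule nn_integral_cmult) measurable
    also have "(\<integral>\<^sup>+y. indicator B (x + y) \<partial>\<nu>) = emeasure \<nu> B"
      by (subst shiftn[OF x]) auto
    finally show "indicator A x * emeasure \<nu> B = (\<integral>\<^sup>+y. indicator A x * indicator B (x + y) \<partial>\<nu>)" by simp
  qed
  also have "\<dots> = (\<integral>\<^sup>+y. \<integral>\<^sup>+x. indicator A x * indicator B (x + y) \<partial>\<mu> \<partial>\<nu>)"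
    by (rule Fubini') measurable
  also have "\<dots> = (\<integral>\<^sup>+y. \<integral>\<^sup>+x. indicator A (- y + x) * indicator B x \<partial>\<mu> \<partial>\<nu>)"
  proof (rule nn_integral_cong_AE, use AEn in eventually_elim)
    fix y assume y: "y \<in> V"
    show "(\<integral>\<^sup>+x. indicator A x * indicator B (x + y) \<partial>\<mu>) = (\<integral>\<^sup>+x. indicator A (- y + x) * indicator B x \<partial>\<mu>)"
      by (subst shiftm[OF y, symmetric]) (simp_all add: add_ac)
  qed
  also have "\<dots> = (\<integral>\<^sup>+x. \<integral>\<^sup>+y. indicator A (- y + x) * indicator B x \<partial>\<nu> \<partial>\<mu>)"
    by (rule p'.Fubini') measurable
  also have "\<dots> = (\<integral>\<^sup>+x. indicator B x * emeasure \<nu> (uminus ` A) \<partial>\<mu>)"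
  proof (rule nn_integral_cong_AE, use AEm in eventually_elim)
    fix x assume x: "x \<in> V"
    have "(\<integral>\<^sup>+y. indicator A (- y + x) * indicator B x \<partial>\<nu>) = (\<integral>\<^sup>+y. indicator A (- y + x) \<partial>\<nu>) * indicator B x"
      by (rule nn_integral_multc) measurable
    also have "(\<integral>\<^sup>+y. indicator A (- y + x) \<partial>\<nu>) = (\<integral>\<^sup>+y. indicator (uminus ` A) (- x + y) \<partial>\<nu>)"
      by (intro nn_integral_cong) (auto simp: mA indicator_def)
    also have "\<dots> = (\<integral>\<^sup>+y. indicator (uminus ` A) y \<partial>\<nu>)"
      using V(2)[OF x] by (rule shiftn) (simp add: mA)
    also have "\<dots> = emeasure \<nu> (uminus ` A)"
      by (rule nn_integral_indicator) (simp add: mA)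
    finally show "(\<integral>\<^sup>+y. indicator A (- y + x) * indicator B x \<partial>\<nu>) = indicator B x * emeasure \<nu> (uminus ` A)"
      by (simp add: mult.commute)
  qed
  also have "\<dots> = emeasure \<mu> B * emeasure \<nu> (uminus ` A)"
    by (simp add: nn_integral_multc)
  finally show ?thesis .
qed

text \<open>The image of Lebesgue measure under a linear bijection is again translation invariant, so
\<open>haar_unique_on\<close> applies with \<open>V = UNIV\<close>.\<close>

lemma lborel_linear_scaling:
  fixes f :: "'a::euclidean_space \<Rightarrow> 'a"
  assumes f: "linear f" and fg: "\<And>x. f (g x) = x" "\<And>x. g (f x) = x"
  obtains \<alpha> :: ennreal where "\<And>A. A \<in> sets borel \<Longrightarrow> emeasure lborel (f -` A) = \<alpha> * emeasure lborel A"
proof -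
  have g: "linear g"
  proof (rule linearI)
    show "g (x + y) = g x + g y" for x y
    proof -
      have "g x + g y = g (f (g x + g y))" by (simp only: fg)
      also have "f (g x + g y) = x + y" by (simp only: linear_add[OF f] fg)
      finally show ?thesis by simp
    qed
    show "g (c *\<^sub>R x) = c *\<^sub>R g x" for c x
    proof -
      have "c *\<^sub>R g x = g (f (c *\<^sub>R g x))" by (simp only: fg)
      also have "f (c *\<^sub>R g x) = c *\<^sub>R x" by (simp only: linear_scale[OF f] fg)
      finally show ?thesis by simp
    qed
  qed
  have [measurable]: "f \<in> borel_measurable borel" "g \<in> borel_measurable borel"
    using f g by (auto intro!: borel_measurable_continuous_onI linear_continuous_on simp: linear_conv_bounded_linear)
  define \<mu> where "\<mu> = distr lborel borel f"
  define B where "B = ball (0::'a) 1"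
  have mu: "emeasure \<mu> A = emeasure lborel (f -` A)" if "A \<in> sets borel" for A
    using that by (simp add: \<mu>_def emeasure_distr)
  have sf: "sigma_finite_measure \<mu>"
  proof
    have vi: "f -` (g -` S) = S" for S using fg by auto
    have gB: "g -` ball 0 r \<in> sets borel" for r
      using measurable_sets[of g borel borel "ball 0 r"] by simp
    have "(\<Union>k::nat. g -` ball 0 (real k)) = UNIV"
      by (auto intro: reals_Archimedean2)
    then show "\<exists>A. countable A \<and> A \<subseteq> sets \<mu> \<and> \<Union> A = space \<mu> \<and> (\<forall>a\<in>A. emeasure \<mu> a \<noteq> \<infinity>)"
      using gB emeasure_bounded_finite[OF bounded_ball[of "0::'a"]]
      by (intro exI[of _ "range (\<lambda>k::nat. g -` ball 0 (real k))"]) (auto simp: \<mu>_def emeasure_distr vi less_top)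
  qed
  have "emeasure \<mu> A * emeasure lborel B = emeasure \<mu> B * emeasure lborel A" if "A \<in> sets borel" for A
  proof -
    have "emeasure \<mu> B * emeasure lborel A = emeasure \<mu> A * emeasure lborel (uminus ` B)"
    proof (rule haar_unique_on[where V = UNIV])
      show "distr \<mu> borel ((+) v) = \<mu>" for v
      proof -
        have "distr \<mu> borel ((+) v) = distr (distr lborel borel ((+) (g v))) borel f"
          unfolding \<mu>_def by (subst (1 2) distr_distr) (auto simp: comp_def linear_add[OF f] fg)
        then show ?thesis by (simp add: \<mu>_def lborel_distr_plus)
      qed
      show "sigma_finite_measure (lborel :: 'a measure)" ..
    qed (use that sf in \<open>auto simp: B_def \<mu>_def lborel_distr_plus\<close>)
    moreover have "uminus ` B = B" by (auto simp: B_def image_iff intro!: bexI[of _ "- _"])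
    ultimately show ?thesis by simp
  qed
  moreover have "emeasure lborel B \<noteq> 0" "emeasure lborel B \<noteq> \<infinity>"
    using emeasure_bounded_finite[OF bounded_ball[of "0::'a" 1]] content_ball_pos[of 1 "0::'a"]
    by (auto simp: B_def emeasure_eq_ennreal_measure less_top)
  ultimately have "emeasure \<mu> A = (emeasure \<mu> B / emeasure lborel B) * emeasure lborel A" if "A \<in> sets borel" for A
    using that by (metis ennreal_times_divide infinity_ennreal_def mult.commute mult_divide_eq_ennreal)
  then have "emeasure lborel (f -` A) = (emeasure \<mu> B / emeasure lborel B) * emeasure lborel A"
    if "A \<in> sets borel" for A
    using that mu[OF that] by simp
  then show thesis by (rule that)
qed

text \<open>The scaling factor is \<open>1\<close> because the unit ball is mapped to itself.\<close>

lemma lborel_vimage_orthogonal: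
  fixes f :: "'a::euclidean_space \<Rightarrow> 'a"
  assumes f: "orthogonal_transformation f" and A: "A \<in> sets borel"
  shows "emeasure lborel (f -` A) = emeasure lborel A"
proof -
  obtain g where g: "\<And>x. f (g x) = x" "\<And>x. g (f x) = x"
    using f by (metis bij_is_inj bij_is_surj inv_f_f orthogonal_transformation_bij surj_f_inv_f)
  obtain \<alpha> where a: "\<And>A. A \<in> sets borel \<Longrightarrow> emeasure lborel (f -` A) = \<alpha> * emeasure lborel A"
    using lborel_linear_scaling[of f g] f g by (metis orthogonal_transformation_def)
  define B where "B = ball (0::'a) 1"
  have "f -` B = B" using orthogonal_transformation_norm[OF f] by (auto simp: B_def)
  then have "emeasure lborel B = \<alpha> * emeasure lborel B" using a[of B] by (simp add: B_def)
  moreover have "emeasure lborel B \<noteq> 0" "emeasure lborel B \<noteq> \<infinity>"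
    using emeasure_bounded_finite[OF bounded_ball[of "0::'a" 1]] content_ball_pos[of 1 "0::'a"]
    by (auto simp: B_def emeasure_eq_ennreal_measure less_top)
  ultimately have "\<alpha> = 1"
    by (metis ennreal_mult_divide_eq ennreal_divide_self infinity_ennreal_def less_top)
  then show ?thesis using a A by simp
qed

text \<open>The reflection in the hyperplane orthogonal to \<open>n\<close> conjugates the shear along \<open>v\<close> to the shear along
\<open>- v\<close>, its inverse. Hence the scaling factor equals its own reciprocal.\<close>

lemma lborel_vimage_shear:
  fixes n v :: "'a::euclidean_space"
  assumes nv: "n \<bullet> v = 0" and n: "norm n = 1" and A: "A \<in> sets borel"
  shows "emeasure lborel ((\<lambda>x. x + (n \<bullet> x) *\<^sub>R v) -` A) = emeasure lborel A"
proof -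
  define T where "T = (\<lambda>v x. x + (n \<bullet> x) *\<^sub>R (v::'a))"
  define R where "R = (\<lambda>x. x - (2 * (n \<bullet> x)) *\<^sub>R n)"
  have linT: "linear (T w)" for w
    by (rule linearI) (auto simp: T_def inner_add_right algebra_simps)
  have linR: "linear R"
    by (rule linearI) (auto simp: R_def inner_add_right algebra_simps)
  have nn: "n \<bullet> n = 1" using n by (simp add: dot_square_norm)
  have R: "orthogonal_transformation R"
    unfolding orthogonal_transformation_def using linR nn
    by (auto simp: R_def inner_diff_left inner_diff_right inner_commute algebra_simps)
  have inv: "T v (T (- v) x) = x" "T (- v) (T v x) = x" for x
    using nv by (simp_all add: T_def inner_add_right inner_diff_right)
  have conj: "R (T v (R x)) = T (- v) x" for x
    using nv nn by (simp add: T_def R_def inner_add_right inner_diff_right algebra_simps inner_commute)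
  have [measurable]: "T w \<in> borel_measurable borel" "R \<in> borel_measurable borel" for w
    unfolding T_def R_def by measurable
  obtain \<alpha> where a: "\<And>A. A \<in> sets borel \<Longrightarrow> emeasure lborel (T v -` A) = \<alpha> * emeasure lborel A"
    using lborel_linear_scaling[of "T v" "T (- v)"] linT inv by metis
  have vs: "T w -` S \<in> sets borel" "R -` S \<in> sets borel" if "S \<in> sets borel" for w S
    using measurable_sets[of "T w" borel borel S] measurable_sets[of R borel borel S] that by simp_all
  have a': "emeasure lborel (T (- v) -` A) = \<alpha> * emeasure lborel A" if "A \<in> sets borel" for A
  proof -
    have "T (- v) -` A = R -` (T v -` (R -` A))" using conj by auto
    then show ?thesis
      using that by (simp add: lborel_vimage_orthogonal[OF R] a vs)
  qed
  define B where "B = ball (0::'a) 1"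
  have "T v -` (T (- v) -` B) = B" using inv by auto
  then have "emeasure lborel B = (\<alpha> * \<alpha>) * emeasure lborel B"
    using a[of "T (- v) -` B"] a'[of B] vs by (simp add: B_def mult.assoc)
  moreover have "emeasure lborel B \<noteq> 0" "emeasure lborel B \<noteq> \<infinity>"
    using emeasure_bounded_finite[OF bounded_ball[of "0::'a" 1]] content_ball_pos[of 1 "0::'a"]
    by (auto simp: B_def emeasure_eq_ennreal_measure less_top)
  ultimately have "\<alpha> * \<alpha> = 1"
    by (metis ennreal_mult_divide_eq ennreal_divide_self infinity_ennreal_def less_top)
  then have "\<alpha> = 1"
  proof (cases \<alpha>)
    case (real r)
    then have "r * r = 1" using \<open>\<alpha> * \<alpha> = 1\<close> by (simp flip: ennreal_mult)
    then have "r = 1" using real by (metis abs_of_nonneg abs_1 power2_eq_1_iff power2_eq_square abs_minus)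
    then show ?thesis using real by simp
  qed (use \<open>\<alpha> * \<alpha> = 1\<close> in simp)
  then show ?thesis using a[OF A] by (simp add: T_def)
qed

section \<open>Isometry invariance of the Hausdorff measure\<close>

lemma diameter_isometric_image:
  assumes "\<And>x y. dist (g x) (g y) = dist x y"
  shows "diameter (g ` S) = diameter S"
proof -
  have "(\<lambda>(x, y). dist x y) ` (g ` S \<times> g ` S) = (\<lambda>(x, y). dist x y) ` (S \<times> S)"
    using assms by (force simp: image_iff)
  then show ?thesis by (simp add: diameter_def)
qed

lemma hausdorff_pre_isometry_le:
  assumes dist: "\<And>x y. dist (g x) (g y) = dist x y"
  shows "hausdorff_pre s \<delta> (g ` A) \<le> hausdorff_pre s \<delta> A"
  unfolding hausdorff_pre_def
proof (rule INF_greatest)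
  fix C assume C: "C \<in> {C :: nat \<Rightarrow> 'a set. A \<subseteq> (\<Union>i. C i) \<and> (\<forall>i. bounded (C i) \<and> diameter (C i) \<le> \<delta>)}"
  have "bounded (g ` S)" if "bounded S" for S
  proof -
    from that obtain e x where "\<forall>y\<in>S. dist x y \<le> e" by (auto simp: bounded_def)
    then show ?thesis unfolding bounded_def by (intro exI[of _ "g x"] exI[of _ e]) (auto simp: dist)
  qed
  then have "(\<lambda>i. g ` C i) \<in> {C. g ` A \<subseteq> (\<Union>i. C i) \<and> (\<forall>i. bounded (C i) \<and> diameter (C i) \<le> \<delta>)}"
    using C by (simp add: diameter_isometric_image[of g, OF dist]) blast
  then show "(INF C\<in>{C. g ` A \<subseteq> (\<Union>i. C i) \<and> (\<forall>i. bounded (C i) \<and> diameter (C i) \<le> \<delta>)}.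
        \<Sum>i. if C i = {} then 0 else ennreal (diameter (C i) ^ s))
      \<le> (\<Sum>i. if C i = {} then 0 else ennreal (diameter (C i) ^ s))"
    by (rule INF_lower2) (simp add: diameter_isometric_image[of g, OF dist] cong: if_cong)
qed

lemma hausdorff_outer_isometry:
  assumes dist: "\<And>x y. dist (f x) (f y) = dist x y" and "bij f"
  shows "hausdorff_outer s (f -` A) = hausdorff_outer s A"
proof (rule antisym)
  have "dist (inv f x) (inv f y) = dist x y" for x y
    using dist[of "inv f x" "inv f y"] \<open>bij f\<close> by (simp add: bij_is_surj surj_f_inv_f)
  then show "hausdorff_outer s (f -` A) \<le> hausdorff_outer s A"
    unfolding hausdorff_outer_def bij_vimage_eq_inv_image[OF \<open>bij f\<close>]
    by (intro SUP_mono) (blast intro: hausdorff_pre_isometry_le)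
  have "f ` (f -` A) = A" using \<open>bij f\<close> by (simp add: bij_is_surj surj_image_vimage_eq)
  then have "hausdorff_pre s \<delta> A \<le> hausdorff_pre s \<delta> (f -` A)" for \<delta>
    using hausdorff_pre_isometry_le[of f s \<delta> "f -` A", OF dist] by simp
  then show "hausdorff_outer s A \<le> hausdorff_outer s (f -` A)"
    unfolding hausdorff_outer_def by (intro SUP_mono) blast
qed

lemma sets_hausdorff_measure [simp, measurable_cong]: "sets (hausdorff_measure s) = sets borel"
  unfolding hausdorff_measure_def using sets.sigma_sets_eq[of borel] by (simp add: sets_measure_of_conv)

text \<open>\<^const>\<open>measure_of\<close> turns a set function that is not countably additive into the zero measure, hence
the case distinction hidden in \<open>emeasure_measure_of_conv\<close>; both cases are invariant.\<close>

lemma emeasure_hausdorff_isometry: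
  fixes f :: "'a::metric_space \<Rightarrow> 'a"
  assumes dist: "\<And>x y. dist (f x) (f y) = dist x y" and "bij f" and A: "A \<in> sets borel"
  shows "emeasure (hausdorff_measure s) (f -` A) = emeasure (hausdorff_measure s) A"
proof -
  have "continuous_on UNIV f"
    unfolding continuous_on_iff by (metis dist)
  then have "f \<in> borel_measurable borel" by (rule borel_measurable_continuous_onI)
  then have "f -` A \<in> sets borel" using measurable_sets[of f borel borel A] A by simp
  moreover have "hausdorff_outer s (f -` A) = hausdorff_outer s A"
    by (rule hausdorff_outer_isometry[OF dist \<open>bij f\<close>])
  ultimately show ?thesis
    using A unfolding hausdorff_measure_def emeasure_measure_of_conv by (simp add: sets.sigma_sets_eq[of borel, simplified])
qed

lemma hausdorff_translation:
  fixes A :: "'a::euclidean_space set"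
  assumes "A \<in> sets borel"
  shows "emeasure (hausdorff_measure s) ((+) v -` A) = emeasure (hausdorff_measure s) A"
proof (rule emeasure_hausdorff_isometry[OF _ _ assms])
  show "bij ((+) v)" by (rule bij_plus)
qed simp

lemma hausdorff_orthogonal:
  fixes f :: "'a::euclidean_space \<Rightarrow> 'a"
  assumes "orthogonal_transformation f" "A \<in> sets borel"
  shows "emeasure (hausdorff_measure s) (f -` A) = emeasure (hausdorff_measure s) A"
proof (rule emeasure_hausdorff_isometry[OF _ _ assms(2)])
  show "bij f" using assms(1) by (rule orthogonal_transformation_bij)
  show "dist (f x) (f y) = dist x y" for x y
    using assms(1) by (metis dist_norm linear_diff orthogonal_transformation orthogonal_transformation_norm)
qed

section \<open>Hyperplane measures as cone volumes\<close>

text \<open>For \<open>A\<close> in the hyperplane \<open>n \<bullet> x = c\<close> this is the cone with base \<open>A\<close> and apex \<open>0\<close> (without the apex):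
\<open>(c / (n \<bullet> x)) x\<close> is the projection of \<open>x\<close> from the apex to the hyperplane.\<close>

definition flat_cone :: "'a::euclidean_space \<Rightarrow> real \<Rightarrow> 'a set \<Rightarrow> 'a set" where
  "flat_cone n c A = {x. 0 < n \<bullet> x \<and> n \<bullet> x \<le> c \<and> (c / (n \<bullet> x)) *\<^sub>R x \<in> A}"

lemma flat_cone_borel [measurable]:
  assumes [measurable]: "A \<in> sets borel"
  shows "flat_cone n c A \<in> sets borel"
  unfolding flat_cone_def by measurable

text \<open>The volume of the cone as a function of its base, with the base moved from the hyperplane
\<open>n \<bullet> x = c\<close> to the parallel subspace so that it makes sense to speak of translation invariance.\<close>

definition cone_base_measure :: "'a::euclidean_space \<Rightarrow> real \<Rightarrow> 'a measure" where
  "cone_base_measure n c =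
     distr (density lborel (indicator {x. 0 < n \<bullet> x \<and> n \<bullet> x \<le> c})) borel (\<lambda>x. (c / (n \<bullet> x)) *\<^sub>R x - c *\<^sub>R n)"

lemma emeasure_cone_base:
  assumes [measurable]: "A \<in> sets borel"
  shows "emeasure (cone_base_measure n c) A =
    emeasure lborel {x. 0 < n \<bullet> x \<and> n \<bullet> x \<le> c \<and> (c / (n \<bullet> x)) *\<^sub>R x - c *\<^sub>R n \<in> A}"
proof -
  have *: "(\<lambda>x. (c / (n \<bullet> x)) *\<^sub>R x - c *\<^sub>R n) \<in> borel_measurable borel" by measurable
  have "(\<lambda>x. (c / (n \<bullet> x)) *\<^sub>R x - c *\<^sub>R n) -` A \<in> sets borel"
    using measurable_sets[OF * assms] by simp
  then show ?thesis
    unfolding cone_base_measure_def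
    by (subst emeasure_distr) (auto simp: emeasure_restricted intro!: arg_cong[of _ _ "emeasure lborel"])
qed

text \<open>Moving the base by \<open>v\<close> within its hyperplane changes the cone by a shear.\<close>

lemma cone_base_translation_invariant:
  assumes n: "norm n = 1" and v: "n \<bullet> v = 0" and c: "0 < c"
  shows "distr (cone_base_measure n c) borel ((+) v) = cone_base_measure n c"
proof (rule measure_eqI)
  fix A assume "A \<in> sets (distr (cone_base_measure n c) borel ((+) v))"
  then have A [measurable]: "A \<in> sets borel" by simp
  have A': "(+) v -` A \<in> sets borel"
    using measurable_sets[of "(+) v" borel borel A] by simp
  define S where "S = {x. 0 < n \<bullet> x \<and> n \<bullet> x \<le> c \<and> (c / (n \<bullet> x)) *\<^sub>R x - c *\<^sub>R n \<in> A}"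
  have "S \<in> sets borel" unfolding S_def by measurable
  have "emeasure (distr (cone_base_measure n c) borel ((+) v)) A = emeasure (cone_base_measure n c) ((+) v -` A)"
    by (subst emeasure_distr) (auto simp: cone_base_measure_def)
  also have "\<dots> = emeasure lborel ((\<lambda>x. x + (n \<bullet> x) *\<^sub>R (v /\<^sub>R c)) -` S)"
  proof -
    have "{x. 0 < n \<bullet> x \<and> n \<bullet> x \<le> c \<and> (c / (n \<bullet> x)) *\<^sub>R x - c *\<^sub>R n \<in> (+) v -` A} =
       (\<lambda>x. x + (n \<bullet> x) *\<^sub>R (v /\<^sub>R c)) -` S"
      using v c by (auto simp: S_def inner_add_right algebra_simps)
    then show ?thesis using A' by (simp add: emeasure_cone_base)
  qed
  also have "\<dots> = emeasure lborel S"
    using v n \<open>S \<in> sets borel\<close> by (intro lborel_vimage_shear) auto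
  also have "\<dots> = emeasure (cone_base_measure n c) A" by (simp add: emeasure_cone_base S_def)
  finally show "emeasure (distr (cone_base_measure n c) borel ((+) v)) A = emeasure (cone_base_measure n c) A" .
qed (simp add: cone_base_measure_def)

lemma cone_base_ball:
  assumes n: "norm n = 1" and c: "0 < c" and r: "0 < r"
  shows "emeasure (cone_base_measure n c) (ball 0 r) \<noteq> 0" "emeasure (cone_base_measure n c) (ball 0 r) \<noteq> \<infinity>"
proof -
  define S where "S = {x. 0 < n \<bullet> x \<and> n \<bullet> x \<le> c \<and> (c / (n \<bullet> x)) *\<^sub>R x - c *\<^sub>R n \<in> ball 0 r}"
  have S: "emeasure (cone_base_measure n c) (ball 0 r) = emeasure lborel S"
    by (simp add: emeasure_cone_base S_def)
  have nn: "n \<bullet> n = 1" using n by (simp add: dot_square_norm)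
  have "bounded S"
  proof (rule boundedI)
    fix x assume x: "x \<in> S"
    then have pos: "0 < n \<bullet> x" "n \<bullet> x \<le> c" and "norm ((c / (n \<bullet> x)) *\<^sub>R x - c *\<^sub>R n) < r"
      by (auto simp: S_def)
    then have "norm ((c / (n \<bullet> x)) *\<^sub>R x) \<le> r + c"
      using norm_triangle_sub[of "(c / (n \<bullet> x)) *\<^sub>R x" "c *\<^sub>R n"] n c by simp
    moreover have "norm x \<le> norm ((c / (n \<bullet> x)) *\<^sub>R x)"
      using pos c mult_right_mono[of "n \<bullet> x" c "norm x"] by (simp add: field_simps)
    ultimately show "norm x \<le> r + c" by linarith
  qed
  then show "emeasure (cone_base_measure n c) (ball 0 r) \<noteq> \<infinity>"
    using emeasure_bounded_finite[of S] unfolding S by (simp add: less_top)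
  \<comment> \<open>a nonempty open part of the cone; it contains the midpoint of the axis\<close>
  define T where "T = {x. 0 < n \<bullet> x} \<inter> {x. n \<bullet> x < c} \<inter> ((\<lambda>x. (c / (n \<bullet> x)) *\<^sub>R x - c *\<^sub>R n) -` ball 0 r \<inter> {x. 0 < n \<bullet> x})"
  have "open T"
    unfolding T_def
    by (intro open_Int open_halfspace_gt open_halfspace_lt continuous_on_open_vimage[THEN iffD1, rule_format])
      (auto intro!: continuous_intros open_halfspace_gt)
  moreover have "(c / 2) *\<^sub>R n \<in> T" using nn c r by (simp add: T_def)
  ultimately have "emeasure lborel T \<noteq> 0"
    using open_not_negligible[of T]
    by (auto simp: negligible_iff_null_sets null_sets_def intro: borel_open)
  moreover have "T \<subseteq> S" by (auto simp: T_def S_def)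
  moreover have "S \<in> sets borel" unfolding S_def mem_ball by measurable
  ultimately show "emeasure (cone_base_measure n c) (ball 0 r) \<noteq> 0"
    unfolding S by (metis emeasure_mono le_zero_eq sets_lborel)
qed

text \<open>After a shift, \<open>H\<close> restricted to a hyperplane and the cone volume are both translation invariant on
the subspace \<open>n \<bullet> x = 0\<close> and therefore proportional. The factor \<open>\<kappa>\<close> is the ratio of the two measures of a
ball in the subspace, and by invariance under rotations this ratio does not depend on \<open>n\<close>.
The finiteness assumption is what makes \<open>H\<close> sigma-finite on hyperplanes: countably many translates of
one ball cover the subspace.\<close>

lemma rigid_measure_on_hyperplane:
  fixes H :: "(real^'n) measure"
  assumes H: "sets H = sets borel"
    and tr: "\<And>v A. A \<in> sets borel \<Longrightarrow> emeasure H ((+) v -` A) = emeasure H A"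
    and orth: "\<And>f A. orthogonal_transformation f \<Longrightarrow> A \<in> sets borel \<Longrightarrow> emeasure H (f -` A) = emeasure H A"
    and fin: "norm e = 1" "0 < r" "emeasure H ({x. e \<bullet> x = 0} \<inter> ball 0 r) < \<infinity>" and c: "0 < c"
  obtains \<kappa> :: ennreal where
    "\<And>n A. norm n = 1 \<Longrightarrow> A \<in> sets borel \<Longrightarrow> A \<subseteq> {x. n \<bullet> x = c} \<Longrightarrow>
       emeasure H A = \<kappa> * emeasure lborel (flat_cone n c A)"
proof -
  define V where "V = (\<lambda>n::real^'n. {x. n \<bullet> x = 0})"
  define \<mu> where "\<mu> = (\<lambda>n. density H (indicator (V n)))"
  define \<nu> where "\<nu> = (\<lambda>n::real^'n. cone_base_measure n c)"
  have V [measurable]: "V n \<in> sets borel" for n unfolding V_def by measurable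
  have V_H: "V n \<in> sets H" for n using V H by simp
  have mu: "emeasure (\<mu> n) A = emeasure H (V n \<inter> A)" if "A \<in> sets borel" for n A
    using that V_H[of n] H by (simp add: \<mu>_def emeasure_restricted)
  have sets: "sets (\<mu> n) = sets borel" "sets (\<nu> n) = sets borel" "space (\<mu> n) = UNIV" for n
    using H sets_eq_imp_space_eq[OF H] by (auto simp: \<mu>_def \<nu>_def cone_base_measure_def)
  have vim: "f -` A \<in> sets borel" if "orthogonal_transformation f" "A \<in> sets borel" for f :: "real^'n \<Rightarrow> real^'n" and A
  proof -
    have "f \<in> borel_measurable borel"
      using that(1) by (intro borel_measurable_continuous_onI linear_continuous_on)
        (simp add: orthogonal_transformation_def linear_conv_bounded_linear)
    then show ?thesis using measurable_sets[of f borel borel A] that(2) by simp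
  qed
  have vimt: "(+) v -` A \<in> sets borel" if "A \<in> sets borel" for v :: "real^'n" and A
    using measurable_sets[of "(+) v" borel borel A] that by simp
  have mu_rot: "emeasure (\<mu> n) (ball 0 r) = emeasure (\<mu> e) (ball 0 r)"
    and nu_rot: "emeasure (\<nu> n) (ball 0 r) = emeasure (\<nu> e) (ball 0 r)" if n: "norm n = 1" for n
  proof -
    obtain f where f: "orthogonal_transformation f" "f n = e"
      using orthogonal_transformation_exists[of n e] n fin(1) by auto
    have lin: "linear f" using f(1) by (simp add: orthogonal_transformation_def)
    have inner: "e \<bullet> f x = n \<bullet> x" for x
      using f by (metis orthogonal_transformation_def)
    have norm: "norm (f x) = norm x" for x using f(1) by (rule orthogonal_transformation_norm)
    have "f -` (V e \<inter> ball 0 r) = V n \<inter> ball 0 r" by (auto simp: V_def inner norm)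
    then show "emeasure (\<mu> n) (ball 0 r) = emeasure (\<mu> e) (ball 0 r)"
      using orth[OF f(1), of "V e \<inter> ball 0 r"] by (simp add: mu)
    define S where "S = (\<lambda>n::real^'n. {x. 0 < n \<bullet> x \<and> n \<bullet> x \<le> c \<and> (c / (n \<bullet> x)) *\<^sub>R x - c *\<^sub>R n \<in> ball 0 r})"
    have S: "S n \<in> sets borel" for n unfolding S_def mem_ball by measurable
    have "norm ((c / (n \<bullet> x)) *\<^sub>R f x - c *\<^sub>R e) = norm ((c / (n \<bullet> x)) *\<^sub>R x - c *\<^sub>R n)" for x
      unfolding f(2)[symmetric] using norm[of "(c / (n \<bullet> x)) *\<^sub>R x - c *\<^sub>R n"]
      by (simp add: linear_diff[OF lin] linear_scale[OF lin])
    then have "f -` S e = S n" by (auto simp: S_def inner)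
    then show "emeasure (\<nu> n) (ball 0 r) = emeasure (\<nu> e) (ball 0 r)"
      using lborel_vimage_orthogonal[OF f(1) S[of e]] by (simp add: \<nu>_def emeasure_cone_base S_def)
  qed
  define a where "a = emeasure (\<mu> e) (ball 0 r)"
  define b where "b = emeasure (\<nu> e) (ball 0 r)"
  have a_fin: "a < \<infinity>" using fin(3) by (simp add: a_def mu) (simp add: V_def)
  have b: "b \<noteq> 0" "b \<noteq> \<infinity>"
    using cone_base_ball[OF fin(1) c fin(2)] by (auto simp: b_def \<nu>_def)
  have minus_ball: "uminus ` ball (0::real^'n) s = ball 0 s" for s
    by (auto simp: image_iff intro!: bexI[of _ "- _"])
  have mu_inv: "distr (\<mu> n) borel ((+) v) = \<mu> n" if "v \<in> V n" for n v
  proof (rule measure_eqI)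
    fix A assume "A \<in> sets (distr (\<mu> n) borel ((+) v))"
    then have A: "A \<in> sets borel" by simp
    have "(+) v \<in> measurable (\<mu> n) borel"
      by (subst measurable_cong_sets[OF sets(1) refl]) simp
    then have "emeasure (distr (\<mu> n) borel ((+) v)) A = emeasure H (V n \<inter> (+) v -` A)"
      using A vimt[OF A, of v] by (subst emeasure_distr) (auto simp: mu sets)
    also have "V n \<inter> (+) v -` A = (+) v -` (V n \<inter> A)"
      using that by (auto simp: V_def inner_add_right)
    also have "emeasure H \<dots> = emeasure (\<mu> n) A" using A V by (metis mu tr sets.Int)
    finally show "emeasure (distr (\<mu> n) borel ((+) v)) A = emeasure (\<mu> n) A" .
  qed (simp add: sets)
  have mu_sf: "sigma_finite_measure (\<mu> n)" if n: "norm n = 1" for n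
  proof
    obtain T where T: "countable T" "T \<subseteq> V n" "V n \<subseteq> closure T"
      using separable[of "V n"] by metis
    define \<A> where "\<A> = insert (- V n) ((\<lambda>t. ball t r) ` T)"
    have "x \<in> \<Union>\<A>" for x
    proof (cases "x \<in> V n")
      case True
      then obtain t where "t \<in> T" "dist t x < r"
        using T(3) fin(2) by (metis closure_approachable subsetD)
      then show ?thesis by (auto simp: \<A>_def)
    qed (auto simp: \<A>_def)
    moreover have "emeasure (\<mu> n) A \<noteq> \<infinity>" if "A \<in> \<A>" for A
    proof (cases "A = - V n")
      case False
      with that obtain t where t: "t \<in> T" "A = ball t r" by (auto simp: \<A>_def)
      have "(+) t -` ball t r = ball 0 r" by (auto simp: dist_norm)
      moreover have "(+) t \<in> measurable (\<mu> n) borel"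
        by (subst measurable_cong_sets[OF sets(1) refl]) simp
      ultimately have "emeasure (\<mu> n) (ball t r) = emeasure (\<mu> n) (ball 0 r)"
        using T(2) t(1) emeasure_distr[of "(+) t" "\<mu> n" borel "ball t r"]
        by (simp add: mu_inv[of t n] subset_iff sets)
      then show ?thesis using mu_rot[OF n] a_fin t by (simp add: a_def)
    qed (simp add: mu)
    ultimately show "\<exists>A. countable A \<and> A \<subseteq> sets (\<mu> n) \<and> \<Union> A = space (\<mu> n) \<and> (\<forall>a\<in>A. emeasure (\<mu> n) a \<noteq> \<infinity>)"
      using T(1) by (intro exI[of _ \<A>]) (auto simp: sets \<A>_def)
  qed
  have nu_sf: "sigma_finite_measure (\<nu> n)" if n: "norm n = 1" for n
  proof
    have "(\<Union>k::nat. ball 0 (real k + 1)) = (UNIV :: (real^'n) set)"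
    proof (intro set_eqI iffI UNIV_I)
      fix x :: "real^'n"
      obtain k :: nat where "norm x < real k" using reals_Archimedean2 by blast
      then show "x \<in> (\<Union>k::nat. ball 0 (real k + 1))" by (intro UN_I[of k]) auto
    qed
    then show "\<exists>A. countable A \<and> A \<subseteq> sets (\<nu> n) \<and> \<Union> A = space (\<nu> n) \<and> (\<forall>a\<in>A. emeasure (\<nu> n) a \<noteq> \<infinity>)"
      using cone_base_ball(2)[OF n c]
      by (intro exI[of _ "range (\<lambda>k::nat. ball 0 (real k + 1))"]) (auto simp: sets \<nu>_def cone_base_measure_def)
  qed
  show thesis
  proof
    fix n :: "real^'n" and A :: "(real^'n) set"
    assume n: "norm n = 1" and A: "A \<in> sets borel" and sub: "A \<subseteq> {x. n \<bullet> x = c}"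
    have nn: "n \<bullet> n = 1" using n by (simp add: dot_square_norm)
    define A' where "A' = (+) (c *\<^sub>R n) -` A"
    have A': "A' \<in> sets borel" using vimt[OF A] by (simp add: A'_def)
    have "A' \<subseteq> V n" using sub nn by (auto simp: A'_def V_def inner_add_right)
    then have "emeasure (\<mu> n) A' = emeasure H A'" using A' by (simp add: mu Int_absorb1)
    then have 1: "emeasure (\<mu> n) A' = emeasure H A" using tr[OF A] by (simp add: A'_def)
    have 2: "emeasure (\<nu> n) A' = emeasure lborel (flat_cone n c A)"
      using A' by (simp add: \<nu>_def emeasure_cone_base) (simp add: A'_def flat_cone_def)
    have "emeasure (\<mu> n) (ball 0 r) * emeasure (\<nu> n) A' = emeasure (\<mu> n) A' * emeasure (\<nu> n) (uminus ` ball 0 r)"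
    proof (rule haar_unique_on[where V = "V n"])
      have "{x. 0 < n \<bullet> x \<and> n \<bullet> x \<le> c \<and> (c / (n \<bullet> x)) *\<^sub>R x - c *\<^sub>R n \<in> - V n} = {}"
        using nn by (auto simp: V_def inner_diff_right)
      moreover have "- V n \<in> sets borel" using V by (rule borel_comp)
      ultimately show "emeasure (\<nu> n) (- V n) = 0"
        unfolding \<nu>_def by (simp only: emeasure_cone_base emeasure_empty)
      show "distr (\<nu> n) borel ((+) v) = \<nu> n" if "v \<in> V n" for v
        using that n c unfolding \<nu>_def by (intro cone_base_translation_invariant) (auto simp: V_def)
    qed (use n A' mu_sf nu_sf mu_inv in \<open>auto simp: sets mu\<close>, auto simp: V_def)
    then have "a * emeasure lborel (flat_cone n c A) = emeasure H A * b"
      unfolding minus_ball mu_rot[OF n] nu_rot[OF n] 1 2 a_def b_def .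
    then show "emeasure H A = (a / b) * emeasure lborel (flat_cone n c A)"
      using b by (metis ennreal_times_divide infinity_ennreal_def mult.commute mult_divide_eq_ennreal)
  qed
qed

lemma hyperplane_null_lborel:
  assumes "(w::'a::euclidean_space) \<noteq> 0"
  shows "{x. w \<bullet> x = 0} \<in> null_sets lborel"
proof -
  have "negligible {x. w \<bullet> x = 0}" using assms by (intro negligible_hyperplane) auto
  then have "{x. w \<bullet> x = 0} \<in> null_sets lebesgue" by (simp add: negligible_iff_null_sets)
  moreover have "{x. w \<bullet> x = 0} \<in> sets borel" by measurable
  ultimately show ?thesis by (simp add: null_sets_completion_iff)
qed

text \<open>The intersection of two nonparallel hyperplanes may be shifted so that one of them becomes
\<open>n \<bullet> x = c\<close>; the cone over it then lies in a hyperplane through \<open>0\<close>.\<close>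

lemma rigid_measure_codim_2_null:
  fixes H :: "(real^'n) measure"
  assumes tr: "\<And>v A. A \<in> sets borel \<Longrightarrow> emeasure H ((+) v -` A) = emeasure H A"
    and k: "\<And>n A. norm n = 1 \<Longrightarrow> A \<in> sets borel \<Longrightarrow> A \<subseteq> {x. n \<bullet> x = c} \<Longrightarrow>
       emeasure H A = \<kappa> * emeasure lborel (flat_cone n c A)"
    and c: "0 < c" and n: "norm n = 1" and m: "norm m = 1" "m \<noteq> n" "m \<noteq> - n"
  shows "emeasure H {x. n \<bullet> x = b \<and> m \<bullet> x = d} = 0"
proof -
  define S where "S = {x. n \<bullet> x = b \<and> m \<bullet> x = d}"
  define v where "v = (b - c) *\<^sub>R n"
  have nn: "n \<bullet> n = 1" using n by (simp add: dot_square_norm)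
  have S: "S \<in> sets borel" unfolding S_def by measurable
  have S': "(+) v -` S \<in> sets borel" using measurable_sets[of "(+) v" borel borel S] S by simp
  define q where "q = c *\<^sub>R m - (d - m \<bullet> v) *\<^sub>R n"
  have "q \<noteq> 0"
  proof
    assume "q = 0"
    then have q: "c *\<^sub>R m = (d - m \<bullet> v) *\<^sub>R n" by (simp add: q_def)
    then have "\<bar>c\<bar> * norm m = \<bar>d - m \<bullet> v\<bar> * norm n" by (metis norm_scaleR)
    then have "d - m \<bullet> v = c \<or> d - m \<bullet> v = - c" using n m by auto
    with q have "c *\<^sub>R m = c *\<^sub>R n \<or> c *\<^sub>R m = c *\<^sub>R (- n)" by auto
    then show False using c m by (simp only: scaleR_cancel_left) simp
  qed
  have "flat_cone n c ((+) v -` S) \<subseteq> {x. q \<bullet> x = 0}"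
  proof
    fix x assume x: "x \<in> flat_cone n c ((+) v -` S)"
    then have "0 < n \<bullet> x" "m \<bullet> (v + (c / (n \<bullet> x)) *\<^sub>R x) = d" by (auto simp: flat_cone_def S_def)
    then show "x \<in> {x. q \<bullet> x = 0}" by (simp add: q_def inner_diff_left inner_add_right inner_add_left field_simps)
  qed
  moreover have "{x. q \<bullet> x = 0} \<in> null_sets lborel" using \<open>q \<noteq> 0\<close> by (rule hyperplane_null_lborel)
  ultimately have "emeasure lborel (flat_cone n c ((+) v -` S)) = 0"
    using S' by (metis flat_cone_borel null_setsD1 null_sets_subset sets_lborel)
  moreover have "(+) v -` S \<subseteq> {x. n \<bullet> x = c}"
    using nn by (auto simp: S_def v_def inner_add_right)
  ultimately have "emeasure H ((+) v -` S) = 0" using k[OF n S'] by simp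
  then show ?thesis using tr[OF S] by (simp add: S_def)
qed

section \<open>Polar integration on a flat cone\<close>

lemma nn_integral_lborel_scale:
  fixes f :: "'a::euclidean_space \<Rightarrow> ennreal"
  assumes [measurable]: "f \<in> borel_measurable borel" and s: "0 < s"
  shows "(\<integral>\<^sup>+x. f x \<partial>lborel) = ennreal (s ^ DIM('a)) * (\<integral>\<^sup>+x. f (s *\<^sub>R x) \<partial>lborel)"
  using s by (subst lborel_affine[of s 0]) (simp_all add: nn_integral_density nn_integral_distr nn_integral_cmult)

lemma nn_integral_tail_power:
  assumes a: "0 < a" and d: "0 < d"
  shows "(\<integral>\<^sup>+s. ennreal (real d * inverse s ^ (d + 1)) * indicator {a..} s \<partial>lborel) = ennreal (inverse a ^ d)"
proof -
  have "(\<integral>\<^sup>+s. ennreal (real d * inverse s ^ (d + 1)) * indicator {a..} s \<partial>lborel) = ennreal (0 - (- (inverse a ^ d)))"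
  proof (rule nn_integral_FTC_atLeast)
    show "(\<lambda>s. real d * inverse s ^ (d + 1)) \<in> borel_measurable borel" by measurable
    fix x assume x: "a \<le> x"
    with a have "0 < x" by simp
    obtain e where e: "d = Suc e" using d by (cases d) auto
    show "((\<lambda>s. - (inverse s ^ d)) has_real_derivative real d * inverse x ^ (d + 1)) (at x)"
      using \<open>0 < x\<close>
      by (intro DERIV_cong[OF DERIV_minus[OF DERIV_power[OF DERIV_inverse]]]) (auto simp: e)
    show "0 \<le> real d * inverse x ^ (d + 1)" using \<open>0 < x\<close> by simp
  next
    have "((\<lambda>s::real. inverse s ^ d) \<longlongrightarrow> 0 ^ d) at_top"
      by (intro tendsto_power tendsto_inverse_0_at_top filterlim_ident)
    from tendsto_minus[OF this] show "((\<lambda>s::real. - (inverse s ^ d)) \<longlongrightarrow> 0) at_top"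
      using d by (simp add: zero_power)
  qed
  then show ?thesis by simp
qed

text \<open>The relative height \<open>\<gamma> x = (n \<bullet> x) / c\<close> serves as radial coordinate, \<open>x / \<gamma> x\<close> being the point of the
base. Substituting \<open>t = \<gamma> x s\<close> inside and then \<open>y = s x\<close> outside turns the
right-hand side into \<open>\<integral> g y (\<gamma> y)^D \<integral> D s^(- D - 1) ds dy\<close> with \<open>s \<ge> \<gamma> y\<close>, whose inner
integral is \<open>(\<gamma> y)^(- D)\<close>.\<close>

lemma flat_cone_polar:
  fixes n :: "'a::euclidean_space" and g :: "'a \<Rightarrow> ennreal"
  assumes c: "0 < c" and A [measurable]: "A \<in> sets borel" and g [measurable]: "g \<in> borel_measurable borel"
  shows "(\<integral>\<^sup>+x. indicator (flat_cone n c A) x * g x \<partial>lborel) =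
    (\<integral>\<^sup>+x. indicator (flat_cone n c A) x *
       (\<integral>\<^sup>+t. ennreal (real DIM('a) * t ^ (DIM('a) - 1)) * indicator {0<..1} t * g (t *\<^sub>R ((c / (n \<bullet> x)) *\<^sub>R x)) \<partial>lborel) \<partial>lborel)"
proof -
  define C where "C = flat_cone n c A"
  define d where "d = DIM('a)"
  obtain e where e: "d = Suc e" using DIM_positive[where 'a = 'a] by (cases "DIM('a)") (auto simp: d_def)
  then have "DIM('a) - 1 = e" by (simp add: d_def)
  define \<gamma> where "\<gamma> = (\<lambda>x. n \<bullet> x / c)"
  have [measurable]: "C \<in> sets borel" unfolding C_def by measurable
  have [measurable]: "\<gamma> \<in> borel_measurable borel" unfolding \<gamma>_def by measurable
  have C: "0 < \<gamma> x" "\<gamma> x \<le> 1" if "x \<in> C" for x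
    using that c by (auto simp: C_def flat_cone_def \<gamma>_def)
  have C_scale: "(inverse s *\<^sub>R x \<in> C \<and> \<gamma> (inverse s *\<^sub>R x) * s \<le> 1) \<longleftrightarrow> (x \<in> C \<and> \<gamma> x \<le> s)"
    if "0 < s" for s x
    using that c by (auto simp: C_def flat_cone_def \<gamma>_def field_simps)
  define F where "F = (\<lambda>x s. indicator C x * indicator {0<..} s * indicator {..1} (\<gamma> x * s) *
    ennreal (real d * \<gamma> x ^ d * s ^ e) * g (s *\<^sub>R x))"
  have [measurable]: "case_prod F \<in> borel_measurable (borel \<Otimes>\<^sub>M borel)" unfolding F_def by measurable
  have inner: "indicator C x *
       (\<integral>\<^sup>+t. ennreal (real d * t ^ e) * indicator {0<..1} t * g (t *\<^sub>R ((c / (n \<bullet> x)) *\<^sub>R x)) \<partial>lborel) =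
     (\<integral>\<^sup>+s. F x s \<partial>lborel)" for x
  proof (cases "x \<in> C")
    case True
    note pos = C[OF True]
    have "(\<integral>\<^sup>+t. ennreal (real d * t ^ e) * indicator {0<..1} t * g (t *\<^sub>R ((c / (n \<bullet> x)) *\<^sub>R x)) \<partial>lborel) =
      ennreal (\<gamma> x) * (\<integral>\<^sup>+s. ennreal (real d * (\<gamma> x * s) ^ e) * indicator {0<..1} (\<gamma> x * s) *
          g ((\<gamma> x * s) *\<^sub>R ((c / (n \<bullet> x)) *\<^sub>R x)) \<partial>lborel)"
      using pos by (subst nn_integral_real_affine[where c = "\<gamma> x" and t = 0]) auto
    also have "\<dots> = (\<integral>\<^sup>+s. ennreal (\<gamma> x) * (ennreal (real d * (\<gamma> x * s) ^ e) * indicator {0<..1} (\<gamma> x * s) *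
          g ((\<gamma> x * s) *\<^sub>R ((c / (n \<bullet> x)) *\<^sub>R x))) \<partial>lborel)"
      by (rule nn_integral_cmult[symmetric]) measurable
    also have "\<dots> = (\<integral>\<^sup>+s. F x s \<partial>lborel)"
    proof (rule nn_integral_cong)
      fix s :: real
      have 1: "\<gamma> x * s * (c / (n \<bullet> x)) = s" using pos c by (auto simp: \<gamma>_def)
      show "ennreal (\<gamma> x) * (ennreal (real d * (\<gamma> x * s) ^ e) * indicator {0<..1} (\<gamma> x * s) *
          g ((\<gamma> x * s) *\<^sub>R ((c / (n \<bullet> x)) *\<^sub>R x))) = F x s"
      proof (cases "0 < s")
        case True
        have "ennreal (\<gamma> x) * ennreal (real d * (\<gamma> x * s) ^ e) = ennreal (real d * \<gamma> x ^ d * s ^ e)"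
          using pos True by (simp add: e mult_ac power_mult_distrib flip: ennreal_mult)
        moreover have "indicator {0<..1} (\<gamma> x * s) = (indicator {..1} (\<gamma> x * s) :: ennreal)"
          using pos True by (auto simp: indicator_def)
        ultimately show ?thesis
          using \<open>x \<in> C\<close> True unfolding scaleR_scaleR 1 F_def by (simp add: mult.assoc[symmetric]) (simp add: mult_ac)
      next
        case False
        then have "\<not> 0 < \<gamma> x * s" using pos by (simp add: zero_less_mult_iff)
        then show ?thesis using False by (simp add: F_def)
      qed
    qed
    finally show ?thesis using True by simp
  qed (simp add: F_def)
  \<comment> \<open>the integrand after both substitutions, with \<open>y = s x\<close>\<close>
  define G where "G = (\<lambda>y s. indicator C y * (ennreal (\<gamma> y ^ d) * g y) *
      (ennreal (real d * inverse s ^ (d + 1)) * indicator {\<gamma> y..} s))"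
  have G_if: "G y s = (if \<gamma> y \<le> s then indicator C y * (ennreal (\<gamma> y ^ d) * g y) *
      ennreal (real d * inverse s ^ (d + 1)) else 0)" for y s
    by (simp add: G_def)
  have [measurable]: "case_prod G \<in> borel_measurable (borel \<Otimes>\<^sub>M borel)" unfolding G_if by measurable
  have swap: "(\<integral>\<^sup>+x. F x s \<partial>lborel) = (\<integral>\<^sup>+y. G y s \<partial>lborel)" for s
  proof (cases "0 < s")
    case True
    have "(\<integral>\<^sup>+x. F x s \<partial>lborel) = ennreal (inverse s ^ d) * (\<integral>\<^sup>+y. F (inverse s *\<^sub>R y) s \<partial>lborel)"
      unfolding d_def using True by (intro nn_integral_lborel_scale) auto
    also have "\<dots> = (\<integral>\<^sup>+y. ennreal (inverse s ^ d) * F (inverse s *\<^sub>R y) s \<partial>lborel)"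
      by (rule nn_integral_cmult[symmetric]) measurable
    also have "\<dots> = (\<integral>\<^sup>+y. G y s \<partial>lborel)"
    proof (rule nn_integral_cong)
      fix y
      have ind: "indicator C (inverse s *\<^sub>R y) * indicator {..1} (\<gamma> (inverse s *\<^sub>R y) * s) =
          (indicator C y * indicator {\<gamma> y..} s :: ennreal)"
        using C_scale[OF True, of y] by (auto simp: indicator_def)
      show "ennreal (inverse s ^ d) * F (inverse s *\<^sub>R y) s = G y s"
      proof (cases "y \<in> C")
        case y: True
        have "\<gamma> (inverse s *\<^sub>R y) = inverse s * \<gamma> y" by (simp add: \<gamma>_def)
        then have w: "inverse s ^ d * (real d * \<gamma> (inverse s *\<^sub>R y) ^ d * s ^ e) = \<gamma> y ^ d * (real d * inverse s ^ (d + 1))"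
          using True unfolding \<open>\<gamma> (inverse s *\<^sub>R y) = inverse s * \<gamma> y\<close> power_mult_distrib e
          by (simp add: field_simps)
        have "ennreal (inverse s ^ d) * F (inverse s *\<^sub>R y) s =
          (indicator C (inverse s *\<^sub>R y) * indicator {..1} (\<gamma> (inverse s *\<^sub>R y) * s)) *
          (ennreal (inverse s ^ d) * ennreal (real d * \<gamma> (inverse s *\<^sub>R y) ^ d * s ^ e)) * g y"
          using True by (simp add: F_def mult_ac)
        also have "ennreal (inverse s ^ d) * ennreal (real d * \<gamma> (inverse s *\<^sub>R y) ^ d * s ^ e) =
          ennreal (\<gamma> y ^ d) * ennreal (real d * inverse s ^ (d + 1))"
          unfolding w[symmetric] using True C(1)[OF y] by (simp only: ennreal_mult'[symmetric] ennreal_mult[symmetric] w zero_le_power less_imp_le inverse_nonnegative_iff_nonnegative)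
        finally show ?thesis unfolding ind G_def by (simp add: mult_ac)
      next
        case False
        then have "indicator C (inverse s *\<^sub>R y) * indicator {..1} (\<gamma> (inverse s *\<^sub>R y) * s) = (0::ennreal)"
          using ind by simp
        then have "F (inverse s *\<^sub>R y) s = 0" by (auto simp: F_def)
        then show ?thesis using False by (simp add: G_def)
      qed
    qed
    finally show ?thesis .
  next
    case False
    have "indicator C y * indicator {\<gamma> y..} s = (0::ennreal)" for y
      using C(1)[of y] False by (auto simp: indicator_def)
    then have "G y s = 0" for y
      unfolding G_def by (metis (no_types, opaque_lifting) mult.commute mult.left_commute mult_zero_right)
    then show ?thesis using False by (simp add: F_def)
  qed
  have "(\<integral>\<^sup>+x. indicator C x *
       (\<integral>\<^sup>+t. ennreal (real d * t ^ e) * indicator {0<..1} t * g (t *\<^sub>R ((c / (n \<bullet> x)) *\<^sub>R x)) \<partial>lborel) \<partial>lborel) =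
    (\<integral>\<^sup>+x. \<integral>\<^sup>+s. F x s \<partial>lborel \<partial>lborel)"
    by (simp only: inner)
  also have "\<dots> = (\<integral>\<^sup>+s. \<integral>\<^sup>+x. F x s \<partial>lborel \<partial>lborel)"
    by (rule lborel_pair.Fubini'[symmetric]) measurable
  also have "\<dots> = (\<integral>\<^sup>+s. \<integral>\<^sup>+y. G y s \<partial>lborel \<partial>lborel)"
    by (simp only: swap)
  also have "\<dots> = (\<integral>\<^sup>+y. \<integral>\<^sup>+s. G y s \<partial>lborel \<partial>lborel)"
    by (rule lborel_pair.Fubini') measurable
  also have "\<dots> = (\<integral>\<^sup>+y. indicator C y * g y \<partial>lborel)"
  proof (rule nn_integral_cong)
    fix y
    show "(\<integral>\<^sup>+s. G y s \<partial>lborel) = indicator C y * g y"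
    proof (cases "y \<in> C")
      case True
      have "(\<integral>\<^sup>+s. G y s \<partial>lborel) =
        ennreal (\<gamma> y ^ d) * g y * (\<integral>\<^sup>+s. ennreal (real d * inverse s ^ (d + 1)) * indicator {\<gamma> y..} s \<partial>lborel)"
        unfolding G_def using True by (subst nn_integral_cmult) auto
      also have "\<dots> = ennreal (\<gamma> y ^ d) * ennreal (inverse (\<gamma> y) ^ d) * g y"
        using C(1)[OF True] by (subst nn_integral_tail_power) (auto simp: e mult_ac)
      also have "ennreal (\<gamma> y ^ d) * ennreal (inverse (\<gamma> y) ^ d) = 1"
        using C(1)[OF True] by (simp flip: ennreal_mult power_mult_distrib)
      finally show ?thesis using True by simp
    qed (simp add: G_def)
  qed
  finally show ?thesis unfolding C_def \<open>DIM('a) - 1 = e\<close> d_def by (rule sym)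
qed

section \<open>Cells with constant support number\<close>

lemma polyhedron_unit_halfspaces:
  fixes P :: "'a::euclidean_space set"
  assumes "polyhedron P"
  obtains F where "finite F" "\<And>a b. (a, b) \<in> F \<Longrightarrow> norm a = 1" "P = {x. \<forall>(a, b)\<in>F. a \<bullet> x \<le> b}"
proof -
  obtain \<H> where H: "finite \<H>" "P = \<Inter>\<H>" "\<forall>h\<in>\<H>. \<exists>a b. a \<noteq> 0 \<and> h = {x. a \<bullet> x \<le> b}"
    using assms unfolding polyhedron_def by blast
  then obtain a b where ab: "\<And>h. h \<in> \<H> \<Longrightarrow> a h \<noteq> 0 \<and> h = {x. a h \<bullet> x \<le> b h}" by metis
  define F where "F = (\<lambda>h. (a h /\<^sub>R norm (a h), b h / norm (a h))) ` \<H>"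
  have "x \<in> h \<longleftrightarrow> (a h /\<^sub>R norm (a h)) \<bullet> x \<le> b h / norm (a h)" if "h \<in> \<H>" for h x
  proof -
    have "x \<in> h \<longleftrightarrow> a h \<bullet> x \<le> b h" using ab[OF that] by blast
    also have "\<dots> \<longleftrightarrow> (a h /\<^sub>R norm (a h)) \<bullet> x \<le> b h / norm (a h)"
      using ab[OF that] by (simp add: divide_simps)
    finally show ?thesis .
  qed
  then have "P = {x. \<forall>(a, b)\<in>F. a \<bullet> x \<le> b}" unfolding H(2) F_def by auto
  moreover have "finite F" using H(1) by (simp add: F_def)
  moreover have "norm a = 1" if "(a, b) \<in> F" for a b
    using that ab by (auto simp: F_def)
  ultimately show thesis using that by blast
qed

lemma solid_polytope_compact:
  assumes "solid_polytope K"
  shows "compact K" "interior K \<noteq> {}"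
proof -
  obtain \<F> where F: "finite \<F>" "\<F> \<noteq> {}" "\<forall>P\<in>\<F>. polytope P \<and> interior P \<noteq> {}" "K = \<Union>\<F>"
    using assms by (auto simp: solid_polytope_def)
  show "compact K" unfolding F(4) using F by (intro compact_Union) (auto intro: polytope_imp_compact)
  obtain P where "P \<in> \<F>" using F by auto
  then have "interior P \<subseteq> interior K" unfolding F(4) by (intro interior_mono) auto
  then show "interior K \<noteq> {}" using F \<open>P \<in> \<F>\<close> by auto
qed

text \<open>The set \<open>\<H>\<close> collects the half spaces of all the polytopes that make up \<open>K\<close>. Where only one
of the bounding hyperplanes, with normal \<open>n\<close>, passes through \<open>x\<close>, each of the polytopes is near \<open>x\<close>
empty, everything, or one of the two half spaces; both half spaces at once would make it flat. So \<open>K\<close> near \<open>x\<close> is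
of one of these kinds as well, and at a boundary point it must be a half space.\<close>

lemma solid_polytope_normals:
  fixes K :: "'a::euclidean_space set"
  assumes "solid_polytope K"
  obtains \<H> where "finite \<H>" "\<And>a b. (a, b) \<in> \<H> \<Longrightarrow> norm a = 1"
    "\<And>x. x \<in> frontier K \<Longrightarrow>
       \<forall>a b a' b'. (a, b) \<in> \<H> \<longrightarrow> (a', b') \<in> \<H> \<longrightarrow> a \<bullet> x = b \<longrightarrow> a' \<bullet> x = b' \<longrightarrow> a' = a \<or> a' = - a \<Longrightarrow>
       \<exists>n. outward_unit_normal K x n \<and> ((n, n \<bullet> x) \<in> \<H> \<or> (- n, - (n \<bullet> x)) \<in> \<H>)"
proof -
  obtain \<F> where F: "finite \<F>" "\<F> \<noteq> {}" "\<forall>P\<in>\<F>. polytope P \<and> interior P \<noteq> {}" "K = \<Union>\<F>"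
    using assms by (auto simp: solid_polytope_def)
  have "\<exists>G. finite G \<and> (\<forall>(a, b)\<in>G. norm a = 1) \<and> P = {x. \<forall>(a, b)\<in>G. a \<bullet> x \<le> b}" if "P \<in> \<F>" for P
  proof -
    have "polyhedron P" using F(3) that by (auto intro: polytope_imp_polyhedron)
    then obtain G where G: "finite G" "\<And>a b. (a, b) \<in> G \<Longrightarrow> norm a = 1" "P = {x. \<forall>(a, b)\<in>G. a \<bullet> x \<le> b}"
      by (rule polyhedron_unit_halfspaces) (rule that)
    show ?thesis
    proof (intro exI conjI)
      show "\<forall>(a, b)\<in>G. norm a = 1" using G(2) by auto
    qed (rule G(1), rule G(3))
  qed
  then have "\<forall>P\<in>\<F>. \<exists>G. finite G \<and> (\<forall>(a, b)\<in>G. norm a = 1) \<and> P = {x. \<forall>(a, b)\<in>G. a \<bullet> x \<le> b}" by blast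
  from bchoice[OF this] obtain G where
    G': "\<forall>P\<in>\<F>. finite (G P) \<and> (\<forall>(a, b)\<in>G P. norm a = 1) \<and> P = {x. \<forall>(a, b)\<in>G P. a \<bullet> x \<le> b}" by blast
  have G: "\<And>P. P \<in> \<F> \<Longrightarrow> finite (G P)" "\<And>P. P \<in> \<F> \<Longrightarrow> \<forall>(a, b)\<in>G P. norm a = 1"
    "\<And>P. P \<in> \<F> \<Longrightarrow> P = {x. \<forall>(a, b)\<in>G P. a \<bullet> x \<le> b}"
  proof -
    fix P assume "P \<in> \<F>"
    note * = bspec[OF G' this]
    show "finite (G P)" using * by (rule conjunct1)
    show "\<forall>(a, b)\<in>G P. norm a = 1" using * by (rule conjunct1[OF conjunct2])
    show "P = {x. \<forall>(a, b)\<in>G P. a \<bullet> x \<le> b}" using * by (rule conjunct2[OF conjunct2])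
  qed
  have memP: "y \<in> P \<longleftrightarrow> (\<forall>(a, b)\<in>G P. a \<bullet> y \<le> b)" if "P \<in> \<F>" for y P
    using arg_cong[OF G(3)[OF that], of "\<lambda>S. y \<in> S"] by (simp only: mem_Collect_eq)
  define \<H> where "\<H> = (\<Union>P\<in>\<F>. G P)"
  show thesis
  proof
    show "finite \<H>" using F(1) G(1) by (simp add: \<H>_def)
    show "norm a = 1" if "(a, b) \<in> \<H>" for a b using that G(2) by (auto simp: \<H>_def)
    fix x assume x: "x \<in> frontier K"
      and "\<forall>a b a' b'. (a, b) \<in> \<H> \<longrightarrow> (a', b') \<in> \<H> \<longrightarrow> a \<bullet> x = b \<longrightarrow> a' \<bullet> x = b' \<longrightarrow> a' = a \<or> a' = - a"
    then have one: "\<And>a b a' b'. (a, b) \<in> \<H> \<Longrightarrow> (a', b') \<in> \<H> \<Longrightarrow> a \<bullet> x = b \<Longrightarrow> a' \<bullet> x = b' \<Longrightarrow> a' = a \<or> a' = - a" by blast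
    have "closed K" using solid_polytope_compact(1)[OF assms] by (rule compact_imp_closed)
    then have xK: "x \<in> K" and xI: "x \<notin> interior K" using x by (auto simp: frontier_def)
    have cont: "((\<lambda>y. a \<bullet> y) \<longlongrightarrow> a \<bullet> x) (nhds x)" for a
      by (intro tendsto_intros) (simp add: filterlim_ident)
    have inactive: "\<forall>\<^sub>F y in nhds x. a \<bullet> y \<le> b \<longleftrightarrow> a \<bullet> x \<le> b" if "a \<bullet> x \<noteq> b" for a b
    proof (cases "a \<bullet> x < b")
      case True
      then show ?thesis using order_tendstoD(2)[OF cont True] by (auto elim: eventually_mono)
    next
      case False
      with that have "b < a \<bullet> x" by simp
      then show ?thesis using order_tendstoD(1)[OF cont \<open>b < a \<bullet> x\<close>] by (auto elim: eventually_mono)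
    qed
    have not_all: "\<not> (\<forall>\<^sub>F y in nhds x. y \<in> K)"
      using xI by (auto simp: eventually_nhds_metric mem_interior subset_iff dist_commute)
    define ok where "ok = (\<lambda>P. \<forall>(a, b)\<in>G P. a \<bullet> x \<le> b)"
    have okP: "ok P \<longleftrightarrow> x \<in> P" if "P \<in> \<F>" for P using memP[OF that] by (simp only: ok_def)
    show "\<exists>n. outward_unit_normal K x n \<and> ((n, n \<bullet> x) \<in> \<H> \<or> (- n, - (n \<bullet> x)) \<in> \<H>)"
    proof (cases "\<exists>a b. (a, b) \<in> \<H> \<and> a \<bullet> x = b")
      case False
      have "\<forall>\<^sub>F y in nhds x. \<forall>P\<in>\<F>. \<forall>(a, b)\<in>G P. a \<bullet> y \<le> b \<longleftrightarrow> a \<bullet> x \<le> b"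
        using F(1) G(1) False
        by (auto intro!: eventually_ball_finite inactive simp: \<H>_def split: prod.split)
      then have "\<forall>\<^sub>F y in nhds x. y \<in> K"
      proof eventually_elim
        case (elim y)
        obtain P where P: "P \<in> \<F>" "x \<in> P" using xK F(4) by auto
        have "a \<bullet> y \<le> b" if ab: "(a, b) \<in> G P" for a b
          using bspec[OF bspec[OF elim P(1)] ab] P memP[OF P(1), of x] ab by auto
        then have "y \<in> P" using memP[OF P(1)] by auto
        then show ?case using P F(4) by auto
      qed
      then show ?thesis using not_all by simp
    next
      case True
      then obtain n where n: "(n, n \<bullet> x) \<in> \<H>" by auto
      have n1: "norm n = 1" using n G(2) by (auto simp: \<H>_def)
      then have n0: "n \<noteq> 0" by auto
      define u where "u = (\<lambda>y. n \<bullet> (y - x))"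
      have act: "a = n \<or> a = - n" if "(a, b) \<in> \<H>" "a \<bullet> x = b" for a b
        using one[OF n that(1)] that(2) by auto
      \<comment> \<open>the two half spaces that the hyperplane through \<open>x\<close> can contribute to \<open>P\<close>; where \<open>ok P\<close> fails, another half space of \<open>P\<close> excludes a neighbourhood of \<open>x\<close>\<close>
      define N where "N = (\<lambda>P. (n, n \<bullet> x) \<in> G P)"
      define M where "M = (\<lambda>P. (- n, - (n \<bullet> x)) \<in> G P)"
      have flat: "\<not> (N P \<and> M P)" if P: "P \<in> \<F>" for P
      proof
        assume NM: "N P \<and> M P"
        have "P \<subseteq> {y. n \<bullet> y = n \<bullet> x}"
        proof
          fix y assume "y \<in> P"
          then have "\<forall>(a, b)\<in>G P. a \<bullet> y \<le> b" using memP[OF P] by simp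
          then have "n \<bullet> y \<le> n \<bullet> x" "(- n) \<bullet> y \<le> - (n \<bullet> x)"
            using NM unfolding N_def M_def by blast+
          then show "y \<in> {y. n \<bullet> y = n \<bullet> x}" by simp
        qed
        then have "interior P \<subseteq> {}" using interior_mono interior_hyperplane[OF n0] by metis
        then show False using F(3) P by auto
      qed
      have germ1: "\<forall>\<^sub>F y in nhds x. y \<in> P \<longleftrightarrow> ok P \<and> (N P \<longrightarrow> u y \<le> 0) \<and> (M P \<longrightarrow> 0 \<le> u y)"
        if P: "P \<in> \<F>" for P
      proof -
        have "\<forall>\<^sub>F y in nhds x. \<forall>p\<in>G P. fst p \<bullet> x \<noteq> snd p \<longrightarrow> (fst p \<bullet> y \<le> snd p \<longleftrightarrow> fst p \<bullet> x \<le> snd p)"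
          using G(1)[OF P] by (auto intro!: eventually_ball_finite inactive simp: eventually_conj_iff)
        then show ?thesis
        proof eventually_elim
          case (elim y)
          have "y \<in> P \<longleftrightarrow> (\<forall>(a, b)\<in>G P. a \<bullet> y \<le> b)" by (rule memP[OF P])
          also have "\<dots> \<longleftrightarrow> ok P \<and> (N P \<longrightarrow> u y \<le> 0) \<and> (M P \<longrightarrow> 0 \<le> u y)"
          proof
            assume L: "\<forall>(a, b)\<in>G P. a \<bullet> y \<le> b"
            have "ok P" unfolding ok_def using L elim by fastforce
            moreover have "u y \<le> 0" if "N P" using L that by (auto simp: N_def u_def inner_diff_right)
            moreover have "0 \<le> u y" if "M P" using L that by (auto simp: M_def u_def inner_diff_right)
            ultimately show "ok P \<and> (N P \<longrightarrow> u y \<le> 0) \<and> (M P \<longrightarrow> 0 \<le> u y)" by blast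
          next
            assume R: "ok P \<and> (N P \<longrightarrow> u y \<le> 0) \<and> (M P \<longrightarrow> 0 \<le> u y)"
            have "a \<bullet> y \<le> b" if ab: "(a, b) \<in> G P" for a b
            proof (cases "a \<bullet> x = b")
              case True
              have "(a, b) \<in> \<H>" using ab P by (auto simp: \<H>_def)
              then have "a = n \<or> a = - n" using True by (rule act)
              then show ?thesis using R ab True by (auto simp: N_def M_def u_def inner_diff_right)
            next
              case False
              then show ?thesis using elim ab R by (fastforce simp: ok_def)
            qed
            then show "\<forall>(a, b)\<in>G P. a \<bullet> y \<le> b" by auto
          qed
          finally show ?case .
        qed
      qed
      have germ: "\<forall>\<^sub>F y in nhds x. y \<in> K \<longleftrightarrow>
        (\<exists>P\<in>\<F>. ok P \<and> (N P \<longrightarrow> u y \<le> 0) \<and> (M P \<longrightarrow> 0 \<le> u y))"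
      proof -
        have "\<forall>\<^sub>F y in nhds x. \<forall>P\<in>\<F>. y \<in> P \<longleftrightarrow> ok P \<and> (N P \<longrightarrow> u y \<le> 0) \<and> (M P \<longrightarrow> 0 \<le> u y)"
          using germ1 F(1) by (intro eventually_ball_finite) auto
        then show ?thesis by eventually_elim (auto simp: F(4))
      qed
      have normalI: "outward_unit_normal K x m" if m1: "norm m = 1" and ev: "\<forall>\<^sub>F y in nhds x. y \<in> K \<longleftrightarrow> m \<bullet> (y - x) \<le> 0" for m
      proof -
        obtain e where "0 < e" "\<forall>y. dist y x < e \<longrightarrow> (y \<in> K \<longleftrightarrow> m \<bullet> (y - x) \<le> 0)"
          using ev by (auto simp: eventually_nhds_metric)
        then have "K \<inter> ball x e = {y \<in> ball x e. m \<bullet> (y - x) \<le> 0}" by (auto simp: dist_commute)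
        then show ?thesis using x m1 \<open>0 < e\<close> by (auto simp: outward_unit_normal_def)
      qed
      consider "\<exists>P\<in>\<F>. ok P \<and> \<not> N P \<and> \<not> M P" | "(\<exists>P\<in>\<F>. ok P \<and> N P) \<and> (\<exists>P\<in>\<F>. ok P \<and> M P)"
        | "\<forall>P\<in>\<F>. ok P \<longrightarrow> N P" | "\<forall>P\<in>\<F>. ok P \<longrightarrow> M P" by blast
      then show ?thesis
      proof cases
        case 1
        from germ have "\<forall>\<^sub>F y in nhds x. y \<in> K" by eventually_elim (use 1 in blast)
        then show ?thesis using not_all by simp
      next
        case 2
        then obtain P Q where PQ: "P \<in> \<F>" "ok P" "N P" "\<not> M P" "Q \<in> \<F>" "ok Q" "M Q" "\<not> N Q"
          using flat by blast
        from germ have "\<forall>\<^sub>F y in nhds x. y \<in> K"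
        proof eventually_elim
          case (elim y)
          have "u y \<le> 0 \<or> 0 \<le> u y" by linarith
          then show ?case using elim PQ by blast
        qed
        then show ?thesis using not_all by simp
      next
        case 3
        obtain P where P: "P \<in> \<F>" "ok P" using xK F(4) okP by auto
        from germ have "\<forall>\<^sub>F y in nhds x. y \<in> K \<longleftrightarrow> n \<bullet> (y - x) \<le> 0"
          by eventually_elim (use 3 P flat in \<open>auto simp: u_def\<close>)
        then show ?thesis using normalI[OF n1] n by blast
      next
        case 4
        obtain P where P: "P \<in> \<F>" "ok P" using xK F(4) okP by auto
        from germ have "\<forall>\<^sub>F y in nhds x. y \<in> K \<longleftrightarrow> (- n) \<bullet> (y - x) \<le> 0"
          by eventually_elim (use 4 P flat in \<open>auto simp: u_def\<close>)
        then show ?thesis using normalI[of "- n"] n1 n by auto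
      qed
    qed
  qed
qed

text \<open>Points where two of the bounding hyperplanes meet lie in finitely many sets of codimension two; the
rays through them fill a null set \<open>Z\<close> contained in hyperplanes through \<open>0\<close>. Any other ray meets the
boundary in points \<open>s x\<close> with a normal \<open>n\<close>, and \<open>n \<bullet> (s x) = c\<close> determines on which side of \<open>s\<close>
it runs inside \<open>K\<close>. At the last point of \<open>K\<close> on a ray it must leave, so \<open>c > 0\<close>; with \<open>c > 0\<close> it can never enter, so
\<open>K\<close> contains the whole segment from \<open>0\<close> to that last point.\<close>

lemma constant_support_cone_decomposition:
  fixes K :: "'a::euclidean_space set"
  assumes K: "solid_polytope K"
    and supp: "\<And>x n. outward_unit_normal K x n \<Longrightarrow> n \<bullet> x = c"
  obtains \<N> F \<C> Z where
    "0 < c" "finite \<N>" "\<And>n. n \<in> \<N> \<Longrightarrow> norm n = 1"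
    "\<And>n. n \<in> \<N> \<Longrightarrow> F n \<in> sets borel" "\<And>n. n \<in> \<N> \<Longrightarrow> F n \<subseteq> {x. n \<bullet> x = c}"
    "\<And>n n'. n \<in> \<N> \<Longrightarrow> n' \<in> \<N> \<Longrightarrow> n \<noteq> n' \<Longrightarrow> F n \<inter> F n' = {}"
    "finite \<C>" "\<And>a b a' b'. (a, b, a', b') \<in> \<C> \<Longrightarrow> norm a = 1 \<and> norm a' = 1 \<and> a' \<noteq> a \<and> a' \<noteq> - a"
    "(\<Union>n\<in>\<N>. F n) \<subseteq> frontier K"
    "frontier K \<subseteq> (\<Union>n\<in>\<N>. F n) \<union> (\<Union>(a, b, a', b')\<in>\<C>. {x. a \<bullet> x = b \<and> a' \<bullet> x = b'})"
    "Z \<in> null_sets lborel"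
    "\<And>x. x \<notin> Z \<Longrightarrow> x \<in> K \<longleftrightarrow> (\<exists>n\<in>\<N>. x \<in> flat_cone n c (F n))"
    "\<And>x n n'. x \<notin> Z \<Longrightarrow> n \<in> \<N> \<Longrightarrow> n' \<in> \<N> \<Longrightarrow> x \<in> flat_cone n c (F n) \<Longrightarrow> x \<in> flat_cone n' c (F n') \<Longrightarrow> n = n'"
    "\<And>x n t. x \<notin> Z \<Longrightarrow> n \<in> \<N> \<Longrightarrow> x \<in> flat_cone n c (F n) \<Longrightarrow> 0 < t \<Longrightarrow> t \<le> 1 \<Longrightarrow> t *\<^sub>R ((c / (n \<bullet> x)) *\<^sub>R x) \<in> K"
    "\<exists>x n. outward_unit_normal K x n"
proof -
  obtain \<H> where H: "finite \<H>" "\<And>a b. (a, b) \<in> \<H> \<Longrightarrow> norm a = 1"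
    and normal: "\<And>x. x \<in> frontier K \<Longrightarrow>
       \<forall>a b a' b'. (a, b) \<in> \<H> \<longrightarrow> (a', b') \<in> \<H> \<longrightarrow> a \<bullet> x = b \<longrightarrow> a' \<bullet> x = b' \<longrightarrow> a' = a \<or> a' = - a \<Longrightarrow>
       \<exists>n. outward_unit_normal K x n \<and> ((n, n \<bullet> x) \<in> \<H> \<or> (- n, - (n \<bullet> x)) \<in> \<H>)"
    by (rule solid_polytope_normals[OF K]) (rule that)
  have cK: "compact K" and iK: "interior K \<noteq> {}" using solid_polytope_compact[OF K] by auto
  then have clK: "closed K" by (simp add: compact_imp_closed)
  define \<C> where "\<C> = {(a, b, a', b'). (a, b) \<in> \<H> \<and> (a', b') \<in> \<H> \<and> a' \<noteq> a \<and> a' \<noteq> - a}"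
  define N where "N = (\<Union>(a, b, a', b')\<in>\<C>. {x. a \<bullet> x = b \<and> a' \<bullet> x = b'})"
  \<comment> \<open>a half space of \<open>\<H>\<close> may lie on either side of the hyperplane, so normals occur up to sign\<close>
  define \<N> where "\<N> = {n. (n, c) \<in> \<H> \<or> (- n, - c) \<in> \<H>}"
  define F where "F = (\<lambda>n. (frontier K \<inter> {x. n \<bullet> x = c}) - N)"
  \<comment> \<open>\<open>t *\<^sub>R x\<close> can satisfy both equations for some \<open>t > 0\<close> only if \<open>w \<bullet> x = 0\<close>; if \<open>b = b' = 0\<close>, the second choice would be \<open>0\<close>\<close>
  define w where "w = (\<lambda>(a::'a, b::real, a'::'a, b'::real). if b = 0 \<and> b' = 0 then a else b' *\<^sub>R a - b *\<^sub>R a')"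
  define Z where "Z = {0} \<union> (\<Union>p\<in>\<C>. {x. w p \<bullet> x = 0})"
  have finC: "finite \<C>"
  proof -
    have "\<C> \<subseteq> (\<lambda>p. (fst (fst p), snd (fst p), snd p)) ` (\<H> \<times> \<H>)"
    proof
      fix p assume "p \<in> \<C>"
      then obtain a b q where "p = (a, b, q)" "(a, b) \<in> \<H>" "q \<in> \<H>" by (auto simp: \<C>_def)
      then show "p \<in> (\<lambda>p. (fst (fst p), snd (fst p), snd p)) ` (\<H> \<times> \<H>)"
        by (intro image_eqI[of _ _ "((a, b), q)"]) auto
    qed
    then show ?thesis using H(1) by (meson finite_SigmaI finite_imageI finite_subset)
  qed
  have CD: "norm a = 1 \<and> norm a' = 1 \<and> a' \<noteq> a \<and> a' \<noteq> - a" if "(a, b, a', b') \<in> \<C>" for a b a' b'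
    using that H(2) by (auto simp: \<C>_def)
  have finN: "finite \<N>"
  proof -
    have "\<N> \<subseteq> fst ` \<H> \<union> (\<lambda>p. - fst p) ` \<H>" by (force simp: \<N>_def image_iff)
    then show ?thesis using H(1) by (meson finite_UnI finite_imageI finite_subset)
  qed
  have w0: "w p \<noteq> 0" if p: "p \<in> \<C>" for p
  proof -
    obtain a b a' b' where p_eq: "p = (a, b, a', b')" by (cases p)
    note ab = CD[OF p[unfolded p_eq]]
    show ?thesis
    proof
      assume "w p = 0"
      then have nz: "\<not> (b = 0 \<and> b' = 0)" and eq: "b' *\<^sub>R a = b *\<^sub>R a'"
        using ab by (auto simp: w_def p_eq split: if_splits)
      then have "\<bar>b'\<bar> * norm a = \<bar>b\<bar> * norm a'" by (metis norm_scaleR)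
      then have "b' = b \<or> b' = - b" using ab by auto
      then have "b *\<^sub>R a' = b *\<^sub>R a \<or> b *\<^sub>R a' = b *\<^sub>R (- a)" using eq by auto
      moreover have "b \<noteq> 0" using nz \<open>b' = b \<or> b' = - b\<close> by auto
      ultimately show False using ab by (simp only: scaleR_cancel_left) simp
    qed
  qed
  have Z: "Z \<in> null_sets lborel"
  proof -
    have "(\<Union>p\<in>\<C>. {x. w p \<bullet> x = 0}) \<in> null_sets lborel"
      using finC by (intro null_sets_UN' countable_finite hyperplane_null_lborel w0)
    then show ?thesis unfolding Z_def by (intro null_sets.Un) (auto intro: null_setsI)
  qed
  have ZN: "t *\<^sub>R x \<notin> N" if "x \<notin> Z" "0 < t" for x t
  proof
    assume "t *\<^sub>R x \<in> N"
    then obtain a b a' b' where p: "(a, b, a', b') \<in> \<C>" and eq: "t * (a \<bullet> x) = b" "t * (a' \<bullet> x) = b'"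
      by (auto simp: N_def)
    have "w (a, b, a', b') \<bullet> x = 0"
      unfolding eq[symmetric] w_def using that(2) by (simp add: inner_diff_left)
    then show False using that(1) p by (auto simp: Z_def)
  qed
  have reg: "\<exists>n\<in>\<N>. outward_unit_normal K y n \<and> y \<in> F n" if y: "y \<in> frontier K" "y \<notin> N" for y
  proof -
    have "\<forall>a b a' b'. (a, b) \<in> \<H> \<longrightarrow> (a', b') \<in> \<H> \<longrightarrow> a \<bullet> y = b \<longrightarrow> a' \<bullet> y = b' \<longrightarrow> a' = a \<or> a' = - a"
      using y(2) by (auto simp: N_def \<C>_def)
    from normal[OF y(1) this] obtain n where n: "outward_unit_normal K y n"
      "(n, n \<bullet> y) \<in> \<H> \<or> (- n, - (n \<bullet> y)) \<in> \<H>" by blast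
    then show ?thesis using supp[OF n(1)] y by (intro bexI[of _ n]) (auto simp: \<N>_def F_def)
  qed
  have ray_ball: "t *\<^sub>R x \<in> ball (s *\<^sub>R x) e" if "\<bar>t - s\<bar> < e / norm x" "x \<noteq> 0" for s t e and x :: 'a
  proof -
    have "dist (s *\<^sub>R x) (t *\<^sub>R x) = \<bar>t - s\<bar> * norm x"
      unfolding dist_norm scaleR_diff_left[symmetric] norm_scaleR by (simp add: abs_minus_commute)
    also have "\<dots> < e" using that by (simp add: pos_less_divide_eq)
    finally show ?thesis by simp
  qed
  have step: "\<exists>d>0. \<forall>t. \<bar>t - s\<bar> < d \<longrightarrow> (t *\<^sub>R x \<in> K \<longleftrightarrow> (t - s) * c \<le> 0)"
    if n: "outward_unit_normal K (s *\<^sub>R x) n" and s: "0 < s" and x0: "x \<noteq> 0" for s x n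
  proof -
    obtain e where e: "0 < e" "K \<inter> ball (s *\<^sub>R x) e = {y \<in> ball (s *\<^sub>R x) e. n \<bullet> (y - s *\<^sub>R x) \<le> 0}"
      using n by (auto simp: outward_unit_normal_def)
    have nx: "n \<bullet> x = c / s" using supp[OF n] s by (simp add: field_simps)
    show ?thesis
    proof (intro exI conjI allI impI)
      show "0 < e / norm x" using e(1) x0 by simp
      fix t assume t: "\<bar>t - s\<bar> < e / norm x"
      have "t *\<^sub>R x \<in> ball (s *\<^sub>R x) e"
        using t x0 by (rule ray_ball)
      then have "t *\<^sub>R x \<in> K \<longleftrightarrow> n \<bullet> (t *\<^sub>R x - s *\<^sub>R x) \<le> 0" using e(2) by blast
      also have "\<dots> \<longleftrightarrow> (t - s) * c \<le> 0"
        using s unfolding scaleR_diff_left[symmetric] inner_scaleR_right nx by (simp add: divide_le_0_iff)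
      finally show "t *\<^sub>R x \<in> K \<longleftrightarrow> (t - s) * c \<le> 0" .
    qed
  qed
  have frontierI: "s *\<^sub>R x \<in> frontier K" if sK: "s *\<^sub>R x \<in> K" and x0: "x \<noteq> 0"
    and out: "\<And>d. 0 < d \<Longrightarrow> \<exists>t. \<bar>t - s\<bar> < d \<and> t *\<^sub>R x \<notin> K" for s x
  proof -
    have "s *\<^sub>R x \<notin> interior K"
    proof
      assume "s *\<^sub>R x \<in> interior K"
      then obtain e where e: "0 < e" "ball (s *\<^sub>R x) e \<subseteq> K" by (auto simp: mem_interior)
      obtain t where t: "\<bar>t - s\<bar> < e / norm x" "t *\<^sub>R x \<notin> K" using out[of "e / norm x"] e(1) x0 by auto
      have "t *\<^sub>R x \<in> ball (s *\<^sub>R x) e"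
        using t(1) x0 by (rule ray_ball)
      then show False using e(2) t(2) by blast
    qed
    then show ?thesis using sK clK by (simp add: frontier_def)
  qed
  have ray_compact: "compact {t \<in> {r..}. t *\<^sub>R x \<in> K}" if x0: "x \<noteq> 0" and "0 \<le> r" for x r
  proof -
    obtain B where B: "\<And>y. y \<in> K \<Longrightarrow> norm y \<le> B" using compact_imp_bounded[OF cK] unfolding bounded_iff by blast
    have "bounded {t \<in> {r..}. t *\<^sub>R x \<in> K}"
    proof (rule boundedI)
      fix t assume "t \<in> {t \<in> {r..}. t *\<^sub>R x \<in> K}"
      then show "norm t \<le> B / norm x" using B[of "t *\<^sub>R x"] x0 by (simp add: field_simps)
    qed
    moreover have "closed ({r..} \<inter> (\<lambda>t. t *\<^sub>R x) -` K)"
      by (intro continuous_closed_preimage continuous_intros) (use clK in auto)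
    moreover have "{t \<in> {r..}. t *\<^sub>R x \<in> K} = {r..} \<inter> (\<lambda>t. t *\<^sub>R x) -` K" by auto
    ultimately show ?thesis by (simp add: compact_eq_bounded_closed)
  qed
  have exit: "\<exists>t\<ge>1. t *\<^sub>R x \<in> frontier K \<and> (\<forall>s>t. s *\<^sub>R x \<notin> K)" if x: "x \<in> K" "x \<noteq> 0" for x
  proof -
    define T where "T = {t \<in> {1..}. t *\<^sub>R x \<in> K}"
    have "T \<noteq> {}" using x by (auto simp: T_def intro!: exI[of _ 1])
    moreover have "compact T" unfolding T_def using x(2) by (intro ray_compact) auto
    ultimately obtain t where t: "t \<in> T" "\<And>s. s \<in> T \<Longrightarrow> s \<le> t"
      using compact_attains_sup[of T] by blast
    then have t: "1 \<le> t" "t *\<^sub>R x \<in> K" "\<And>s. 1 \<le> s \<Longrightarrow> s *\<^sub>R x \<in> K \<Longrightarrow> s \<le> t"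
      by (auto simp: T_def)
    have out: "s *\<^sub>R x \<notin> K" if "t < s" for s using t(1) t(3)[of s] that by auto
    have "t *\<^sub>R x \<in> frontier K"
    proof (rule frontierI[OF t(2) x(2)])
      fix d :: real assume "0 < d"
      then show "\<exists>s. \<bar>s - t\<bar> < d \<and> s *\<^sub>R x \<notin> K"
        using out[of "t + d / 2"] by (intro exI[of _ "t + d / 2"]) auto
    qed
    then show ?thesis using t out by auto
  qed
  obtain x1 where x1: "x1 \<in> K" "x1 \<notin> Z"
  proof -
    have "interior K \<noteq> {}" by fact
    then have "\<not> negligible (interior K)" by (intro open_not_negligible) auto
    then have "\<not> negligible K" using negligible_subset[OF _ interior_subset] by blast
    moreover have "negligible Z" using Z by (simp add: negligible_iff_null_sets null_sets_completionI)
    ultimately show thesis using that negligible_subset by blast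
  qed
  have "x1 \<noteq> 0" using x1 by (auto simp: Z_def)
  obtain t1 where t1: "1 \<le> t1" "t1 *\<^sub>R x1 \<in> frontier K" "\<forall>s>t1. s *\<^sub>R x1 \<notin> K" using exit[OF x1(1) \<open>x1 \<noteq> 0\<close>] by blast
  obtain n1 where n1: "outward_unit_normal K (t1 *\<^sub>R x1) n1"
    using reg[OF t1(2)] ZN[OF x1(2)] t1(1) by force
  have c: "0 < c"
  proof (rule ccontr)
    assume "\<not> 0 < c"
    obtain d where d: "0 < d" "\<forall>t. \<bar>t - t1\<bar> < d \<longrightarrow> (t *\<^sub>R x1 \<in> K \<longleftrightarrow> (t - t1) * c \<le> 0)"
      using step[OF n1 _ \<open>x1 \<noteq> 0\<close>] t1(1) by force
    have "(t1 + d / 2) *\<^sub>R x1 \<in> K" using d \<open>\<not> 0 < c\<close> by (simp add: mult_nonneg_nonpos)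
    then show False using t1(3) d(1) by simp
  qed
  have step': "\<exists>d>0. \<forall>t. \<bar>t - s\<bar> < d \<longrightarrow> (t *\<^sub>R x \<in> K \<longleftrightarrow> t \<le> s)"
    if xZ: "x \<notin> Z" and s: "0 < s" "s *\<^sub>R x \<in> frontier K" for x s
  proof -
    have "x \<noteq> 0" using xZ by (auto simp: Z_def)
    obtain n where "outward_unit_normal K (s *\<^sub>R x) n" using reg[OF s(2) ZN[OF xZ s(1)]] by blast
    from step[OF this s(1) \<open>x \<noteq> 0\<close>] show ?thesis using c by (simp add: mult_le_0_iff)
  qed
  have inward: "s *\<^sub>R x \<in> K" if x: "x \<notin> Z" and s: "0 < s" "s \<le> t" and t: "t *\<^sub>R x \<in> K" for x s t
  proof (rule ccontr)
    assume out: "s *\<^sub>R x \<notin> K"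
    have "x \<noteq> 0" using x by (auto simp: Z_def)
    have "compact {t \<in> {s..}. t *\<^sub>R x \<in> K}" using ray_compact[OF \<open>x \<noteq> 0\<close>] s by simp
    moreover have "{t \<in> {s..}. t *\<^sub>R x \<in> K} \<noteq> {}" using s t by auto
    ultimately obtain u where u: "s \<le> u" "u *\<^sub>R x \<in> K" and least: "\<And>v. s \<le> v \<Longrightarrow> v *\<^sub>R x \<in> K \<Longrightarrow> u \<le> v"
      using compact_attains_inf[of "{t \<in> {s..}. t *\<^sub>R x \<in> K}"] by auto
    have "s < u" using u out by (cases "s = u") auto
    have "u *\<^sub>R x \<in> frontier K"
    proof (rule frontierI[OF u(2) \<open>x \<noteq> 0\<close>])
      fix d :: real assume "0 < d"
      then show "\<exists>t. \<bar>t - u\<bar> < d \<and> t *\<^sub>R x \<notin> K"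
        using least[of "max s (u - d / 2)"] \<open>s < u\<close> by (intro exI[of _ "max s (u - d / 2)"]) (auto simp: max_def split: if_splits)
    qed
    have "0 < u" using s \<open>s < u\<close> by simp
    from step'[OF x this \<open>u *\<^sub>R x \<in> frontier K\<close>] obtain d where d: "0 < d" "\<forall>t. \<bar>t - u\<bar> < d \<longrightarrow> (t *\<^sub>R x \<in> K \<longleftrightarrow> t \<le> u)" by blast
    then have "max s (u - d / 2) *\<^sub>R x \<in> K" using \<open>s < u\<close> by (auto simp: max_def)
    then show False using least[of "max s (u - d / 2)"] d(1) \<open>s < u\<close> by (auto simp: max_def split: if_splits)
  qed
  have ray: "t *\<^sub>R x \<in> K \<longleftrightarrow> t \<le> s" if x: "x \<notin> Z" and s: "0 < s" "s *\<^sub>R x \<in> frontier K" and t: "0 < t" for x s t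
  proof
    assume tK: "t *\<^sub>R x \<in> K"
    show "t \<le> s"
    proof (rule ccontr)
      assume "\<not> t \<le> s"
      obtain d where d: "0 < d" "\<forall>t. \<bar>t - s\<bar> < d \<longrightarrow> (t *\<^sub>R x \<in> K \<longleftrightarrow> t \<le> s)" using step'[OF x s] by blast
      define r where "r = min t (s + d / 2)"
      have "r *\<^sub>R x \<in> K" using s(1) \<open>\<not> t \<le> s\<close> d(1) by (intro inward[OF x _ _ tK]) (auto simp: r_def)
      moreover have "\<bar>r - s\<bar> < d" "s < r" using \<open>\<not> t \<le> s\<close> d(1) by (auto simp: r_def)
      ultimately show False using d(2) by force
    qed
  next
    assume "t \<le> s"
    moreover have "s *\<^sub>R x \<in> K" using s(2) clK by (auto simp: frontier_def)
    ultimately show "t *\<^sub>R x \<in> K" using inward[OF x t] by blast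
  qed
  have cone: "0 < c / (n \<bullet> x)" "1 \<le> c / (n \<bullet> x)" "(c / (n \<bullet> x)) *\<^sub>R x \<in> frontier K" "(c / (n \<bullet> x)) *\<^sub>R x \<in> F n"
    if "x \<in> flat_cone n c (F n)" for x n
    using that c by (auto simp: flat_cone_def F_def)
  have disj: "n = n'" if nn: "n \<in> \<N>" "n' \<in> \<N>" and y: "y \<in> F n" "y \<in> F n'" for n n' y
  proof -
    have ny: "n \<bullet> y = c" "n' \<bullet> y = c" "y \<notin> N" using y by (auto simp: F_def)
    have sign: "\<exists>s. (s = 1 \<or> s = -1) \<and> (s *\<^sub>R m, s * c) \<in> \<H>" if "m \<in> \<N>" for m
      using that by (cases "(m, c) \<in> \<H>") (auto simp: \<N>_def intro: exI[of _ "1::real"] exI[of _ "-1::real"])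
    obtain s where s: "s = 1 \<or> s = -1" "(s *\<^sub>R n, s * c) \<in> \<H>" using sign[OF nn(1)] by blast
    obtain s' where s': "s' = 1 \<or> s' = -1" "(s' *\<^sub>R n', s' * c) \<in> \<H>" using sign[OF nn(2)] by blast
    have "s' *\<^sub>R n' = s *\<^sub>R n \<or> s' *\<^sub>R n' = - (s *\<^sub>R n)"
    proof (rule ccontr)
      assume "\<not> ?thesis"
      then have "(s *\<^sub>R n, s * c, s' *\<^sub>R n', s' * c) \<in> \<C>" using s s' by (auto simp: \<C>_def)
      then show False using ny by (force simp: N_def)
    qed
    then have "n' = n \<or> n' = - n" using s(1) s'(1) by (auto simp: minus_equation_iff)
    then show ?thesis using ny c by auto
  qed
  show thesis
  proof (rule that[of \<N> F \<C> Z])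
    show "0 < c" "finite \<N>" "finite \<C>" "Z \<in> null_sets lborel" by fact+
    show "norm n = 1" if "n \<in> \<N>" for n using that H(2) by (force simp: \<N>_def)
    have "N \<in> sets borel" unfolding N_def
    proof (intro sets.finite_UN finC)
      fix p assume "p \<in> \<C>"
      show "(case p of (a, b, a', b') \<Rightarrow> {x. a \<bullet> x = b \<and> a' \<bullet> x = b'}) \<in> sets borel"
        by (cases p) simp
    qed
    then show "F n \<in> sets borel" if "n \<in> \<N>" for n
      unfolding F_def by (intro sets.Diff sets.Int) auto
    show "F n \<subseteq> {x. n \<bullet> x = c}" if "n \<in> \<N>" for n by (auto simp: F_def)
    show "F n \<inter> F n' = {}" if "n \<in> \<N>" "n' \<in> \<N>" "n \<noteq> n'" for n n' using disj that by blast
    show "norm a = 1 \<and> norm a' = 1 \<and> a' \<noteq> a \<and> a' \<noteq> - a" if "(a, b, a', b') \<in> \<C>" for a b a' b'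
      using CD[OF that] .
    show "(\<Union>n\<in>\<N>. F n) \<subseteq> frontier K" by (auto simp: F_def)
    show "frontier K \<subseteq> (\<Union>n\<in>\<N>. F n) \<union> (\<Union>(a, b, a', b')\<in>\<C>. {x. a \<bullet> x = b \<and> a' \<bullet> x = b'})"
      unfolding N_def[symmetric] using reg by blast
    show "\<exists>x n. outward_unit_normal K x n" using n1 by blast
    show "x \<in> K \<longleftrightarrow> (\<exists>n\<in>\<N>. x \<in> flat_cone n c (F n))" if x: "x \<notin> Z" for x
    proof
      assume xK: "x \<in> K"
      have "x \<noteq> 0" using x by (auto simp: Z_def)
      obtain t where t: "1 \<le> t" "t *\<^sub>R x \<in> frontier K" using exit[OF xK \<open>x \<noteq> 0\<close>] by blast
      then obtain n where n: "n \<in> \<N>" "t *\<^sub>R x \<in> F n" using reg[OF t(2)] ZN[OF x] by force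
      then have nx: "n \<bullet> x = c / t" using t(1) by (auto simp: F_def field_simps)
      then have "0 < n \<bullet> x" "n \<bullet> x \<le> c" "c / (n \<bullet> x) = t"
        using t(1) c by (auto simp: divide_le_eq)
      then have "x \<in> flat_cone n c (F n)" using n(2) by (simp add: flat_cone_def)
      then show "\<exists>n\<in>\<N>. x \<in> flat_cone n c (F n)" using n(1) by blast
    next
      assume "\<exists>n\<in>\<N>. x \<in> flat_cone n c (F n)"
      then obtain n where "x \<in> flat_cone n c (F n)" by blast
      from cone[OF this] show "x \<in> K" using ray[OF x, of "c / (n \<bullet> x)" 1] by simp
    qed
    show "n = n'" if x: "x \<notin> Z" and n: "n \<in> \<N>" "n' \<in> \<N>" and xc: "x \<in> flat_cone n c (F n)" "x \<in> flat_cone n' c (F n')" for x n n'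
    proof -
      note c1 = cone[OF xc(1)] and c2 = cone[OF xc(2)]
      have "(c / (n \<bullet> x)) *\<^sub>R x \<in> K" "(c / (n' \<bullet> x)) *\<^sub>R x \<in> K"
        using ray[OF x c1(1,3) c1(1)] ray[OF x c2(1,3) c2(1)] by auto
      then have "c / (n \<bullet> x) = c / (n' \<bullet> x)"
        using ray[OF x c1(1,3) c2(1)] ray[OF x c2(1,3) c1(1)] by (intro antisym) auto
      then show ?thesis using disj[OF n] c1(4) c2(4) by metis
    qed
    show "t *\<^sub>R ((c / (n \<bullet> x)) *\<^sub>R x) \<in> K" if x: "x \<notin> Z" and "x \<in> flat_cone n c (F n)" "0 < t" "t \<le> 1" for x n t
    proof -
      note c1 = cone[OF that(2)]
      have "0 < t * (c / (n \<bullet> x))" "t * (c / (n \<bullet> x)) \<le> c / (n \<bullet> x)"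
        using c1(1) that(3,4) mult_pos_pos mult_left_le_one_le[of "c / (n \<bullet> x)" t] by (auto simp: less_imp_le simp del: times_divide_eq_right)
      then show ?thesis using ray[OF x c1(1,3)] by (simp del: times_divide_eq_right)
    qed
  qed
qed

section \<open>The inequality for a centred cell\<close>

lemma star_weight_eq:
  assumes "0 < D"
  shows "real D * star_weight D k = real (k div 2 + 1) * real ((k + 1) div 2 + D)"
proof -
  have "\<lfloor>real k / 2\<rfloor> = int (k div 2)" "\<lfloor>(real k + 1) / 2\<rfloor> = int ((k + 1) div 2)"
    using floor_divide_of_nat_eq[of k 2] floor_divide_of_nat_eq[of "k + 1" 2] by (simp_all add: add.commute)
  then show ?thesis using assms by (simp add: star_weight_def)
qed

text \<open>The one-variable inequality in the form in which it meets \<open>flat_cone_polar\<close>.\<close>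

lemma poly_ray_bound:
  assumes D: "0 < D" and deg: "degree q \<le> k" and nonneg: "\<And>t. 0 < t \<Longrightarrow> t \<le> 1 \<Longrightarrow> 0 \<le> poly q t"
  shows "ennreal (poly q 1) \<le> ennreal (star_weight D k) *
    (\<integral>\<^sup>+t. ennreal (real D * t ^ (D - 1)) * indicator {0<..1} t * ennreal (poly q t) \<partial>lborel)"
proof -
  have cl: "closure {0<..<1} \<subseteq> {t. 0 \<le> poly q t}"
    using nonneg by (intro closure_minimal closed_Collect_le continuous_intros) auto
  then have nonneg': "0 \<le> poly q t" if "0 \<le> t" "t \<le> 1" for t using that by auto
  obtain d where d: "D = d + 1" using D by (metis Suc_eq_plus1 not0_implies_Suc not_gr_zero)
  then have d': "D - Suc 0 = d" by simp
  define f where "f = (\<lambda>t. poly q t * t ^ d)"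
  have [measurable]: "f \<in> borel_measurable borel"
    unfolding f_def by (intro borel_measurable_continuous_onI continuous_intros)
  have "set_integrable lborel {0..1} f"
    unfolding f_def by (intro borel_integrable_atLeastAtMost' continuous_intros)
  then have "(\<integral>\<^sup>+t. ennreal (indicator {0..1} t *\<^sub>R f t) \<partial>lborel) = ennreal (moment d q)"
    using nonneg' set_borel_integral_eq_integral(2)[of "{0..1}" f]
    by (subst nn_integral_eq_integral)
      (auto simp: set_integrable_def set_lebesgue_integral_def f_def moment_def indicator_def)
  moreover have "(\<integral>\<^sup>+t. ennreal (real D * t ^ (D - 1)) * indicator {0<..1} t * ennreal (poly q t) \<partial>lborel) =
      (\<integral>\<^sup>+t. ennreal (real D) * ennreal (indicator {0..1} t *\<^sub>R f t) \<partial>lborel)"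
  proof (rule nn_integral_cong_AE)
    have "AE t in lborel. t \<noteq> (0::real)" by (rule AE_lborel_singleton)
    then show "AE t in lborel. ennreal (real D * t ^ (D - 1)) * indicator {0<..1} t * ennreal (poly q t) =
      ennreal (real D) * ennreal (indicator {0..1} t *\<^sub>R f t)"
      by eventually_elim
        (use nonneg' in \<open>auto simp: indicator_def f_def d' mult_ac simp flip: ennreal_mult ennreal_mult'\<close>)
  qed
  moreover have "\<dots> = ennreal (real D) * (\<integral>\<^sup>+t. ennreal (indicator {0..1} t *\<^sub>R f t) \<partial>lborel)"
    by (rule nn_integral_cmult) measurable
  moreover have "0 \<le> star_weight D k" by (simp add: star_weight_def)
  moreover have "0 \<le> moment d q" by (intro moment_nonneg nonneg')
  moreover have "poly q 1 \<le> star_weight D k * (real D * moment d q)"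
    using nonneg_poly_endpoint_bound[OF deg nonneg', of d] star_weight_eq[OF D, of k]
    by (simp add: d mult_ac)
  ultimately show ?thesis by (simp add: ennreal_leI flip: ennreal_mult)
qed

lemma nn_integral_facet:
  fixes H :: "'a::euclidean_space measure"
  assumes H: "sets H = sets borel"
    and k: "\<And>A. A \<in> sets borel \<Longrightarrow> A \<subseteq> F \<Longrightarrow> emeasure H A = \<kappa> * emeasure lborel (flat_cone n c A)"
    and F: "F \<in> sets borel" and f [measurable]: "f \<in> borel_measurable borel"
  shows "(\<integral>\<^sup>+y. indicator F y * f y \<partial>H) =
    \<kappa> * (\<integral>\<^sup>+x. indicator (flat_cone n c F) x * f ((c / (n \<bullet> x)) *\<^sub>R x) \<partial>lborel)"
proof -
  have [measurable_cong]: "sets H = sets borel" by fact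
  have [measurable]: "F \<in> sets borel" by fact
  define P where "P = (\<lambda>x. (c / (n \<bullet> x)) *\<^sub>R x)"
  have P [measurable]: "P \<in> borel_measurable borel" unfolding P_def by measurable
  define \<rho> where "\<rho> = density lborel (indicator (flat_cone n c F))"
  have P' [measurable]: "P \<in> borel_measurable \<rho>" unfolding \<rho>_def by measurable
  have "density H (indicator F) = scale_measure \<kappa> (distr \<rho> borel P)"
  proof (rule measure_eqI)
    fix A assume "A \<in> sets (density H (indicator F))"
    then have A: "A \<in> sets borel" using H by simp
    have PA: "P -` A \<in> sets borel" using measurable_sets[OF P A] by simp
    have "emeasure (density H (indicator F)) A = emeasure H (F \<inter> A)"
      using A F H by (intro emeasure_restricted) auto
    also have "\<dots> = \<kappa> * emeasure lborel (flat_cone n c (F \<inter> A))"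
      using A F by (intro k) auto
    also have "flat_cone n c (F \<inter> A) = flat_cone n c F \<inter> P -` A"
      by (auto simp: flat_cone_def P_def)
    also have "emeasure lborel (flat_cone n c F \<inter> P -` A) = emeasure \<rho> (P -` A)"
      unfolding \<rho>_def using PA by (intro emeasure_restricted[symmetric]) auto
    also have "\<dots> = emeasure (distr \<rho> borel P) A"
      using A by (subst emeasure_distr) (auto simp: \<rho>_def)
    finally show "emeasure (density H (indicator F)) A = emeasure (scale_measure \<kappa> (distr \<rho> borel P)) A" by simp
  qed (simp add: H)
  then have "(\<integral>\<^sup>+y. f y \<partial>density H (indicator F)) = \<kappa> * (\<integral>\<^sup>+y. f y \<partial>distr \<rho> borel P)"
    by (simp add: nn_integral_scale_measure)
  then show ?thesis
    by (simp add: nn_integral_density nn_integral_distr \<rho>_def) (simp add: P_def)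
qed

text \<open>With \<open>\<kappa>\<close> the factor between surface measure and cone volume, the cones over the facets give
\<open>\<integral> W dH \<le> \<kappa> M \<integral> W\<close> (boundary on the left, \<open>K\<close> on the right) and \<open>\<kappa> vol K \<le> H (frontier K)\<close>.
Dividing one by the other eliminates \<open>\<kappa>\<close>.\<close>

lemma centred_cell_bound:
  fixes K :: "(real^'n) set" and W :: "real^'n \<Rightarrow> real"
  assumes K: "solid_polytope K"
    and supp: "\<And>x n. outward_unit_normal K x n \<Longrightarrow> n \<bullet> x = c"
    and cont: "continuous_on UNIV W"
    and ray: "\<And>x. \<exists>q. degree q \<le> k \<and> (\<forall>t. W (t *\<^sub>R x) = poly q t)"
    and nonneg: "\<And>x. x \<in> K \<Longrightarrow> 0 \<le> W x"
  shows "boundary_average K W \<le> star_weight CARD('n) k * cell_average K W"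
proof -
  define D where "D = CARD('n)"
  have D: "0 < D" "DIM(real^'n) = D" by (simp_all add: D_def)
  define H where "H = (hausdorff_measure (D - 1) :: (real^'n) measure)"
  define M where "M = star_weight D k"
  have M0: "0 \<le> M" by (simp add: M_def star_weight_def)
  have H [measurable_cong]: "sets H = sets borel" by (simp add: H_def)
  have W [measurable]: "W \<in> borel_measurable borel" using cont by (rule borel_measurable_continuous_onI)
  have cK: "compact K" and iK: "interior K \<noteq> {}" using solid_polytope_compact[OF K] by auto
  then have clK: "closed K" by (simp add: compact_imp_closed)
  have [measurable]: "K \<in> sets borel" "frontier K \<in> sets borel" using clK by auto
  have fK: "frontier K \<subseteq> K" using clK by (simp add: frontier_def closure_closed)
  define I where "I = (LINT x:K|lborel. W x)"
  define v where "v = measure lborel K"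
  define b where "b = (LINT x:frontier K|H. W x)"
  define h where "h = measure H (frontier K)"
  have I0: "0 \<le> I" unfolding I_def set_lebesgue_integral_def
    using nonneg by (intro integral_nonneg_AE) (auto simp: indicator_def)
  have goal: "boundary_average K W = b / h" "cell_average K W = I / v"
    unfolding boundary_average_def cell_average_def average_def D(2) b_def h_def I_def v_def H_def
    by (rule refl)+
  have v_fin: "emeasure lborel K < \<infinity>" using compact_imp_bounded[OF cK] by (rule emeasure_bounded_finite)
  have v: "0 < v" "emeasure lborel K = ennreal v"
  proof -
    show ev: "emeasure lborel K = ennreal v" using v_fin by (simp add: v_def emeasure_eq_ennreal_measure)
    have "\<not> negligible (interior K)" using iK by (intro open_not_negligible) auto
    then have "\<not> negligible K" using negligible_subset[OF _ interior_subset] by blast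
    then have "emeasure lborel K \<noteq> 0"
      by (auto simp: negligible_iff_null_sets intro!: null_sets_completionI null_setsI)
    then show "0 < v" unfolding ev by (simp add: v_def less_le)
  qed
  show ?thesis
  proof (cases "h = 0")
    case True
    then show ?thesis using M0 I0 v by (simp add: goal M_def D_def)
  next
    case False
    then have "emeasure H (frontier K) \<noteq> top" by (auto simp: h_def measure_def)
    then have h: "0 < h" "emeasure H (frontier K) = ennreal h"
      using False unfolding h_def by (auto simp: less_le emeasure_eq_ennreal_measure)
    obtain \<N> F \<C> Z where c: "0 < c" and \<N>: "finite \<N>" "\<And>n. n \<in> \<N> \<Longrightarrow> norm n = 1"
      and F: "\<And>n. n \<in> \<N> \<Longrightarrow> F n \<in> sets borel" "\<And>n. n \<in> \<N> \<Longrightarrow> F n \<subseteq> {x. n \<bullet> x = c}"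
        "\<And>n n'. n \<in> \<N> \<Longrightarrow> n' \<in> \<N> \<Longrightarrow> n \<noteq> n' \<Longrightarrow> F n \<inter> F n' = {}"
      and \<C>: "finite \<C>" "\<And>a b a' b'. (a, b, a', b') \<in> \<C> \<Longrightarrow> norm a = 1 \<and> norm a' = 1 \<and> a' \<noteq> a \<and> a' \<noteq> - a"
      and front: "(\<Union>n\<in>\<N>. F n) \<subseteq> frontier K"
        "frontier K \<subseteq> (\<Union>n\<in>\<N>. F n) \<union> (\<Union>(a, b, a', b')\<in>\<C>. {x. a \<bullet> x = b \<and> a' \<bullet> x = b'})"
      and Z: "Z \<in> null_sets lborel"
      and cover: "\<And>x. x \<notin> Z \<Longrightarrow> x \<in> K \<longleftrightarrow> (\<exists>n\<in>\<N>. x \<in> flat_cone n c (F n))"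
      and uniq: "\<And>x n n'. x \<notin> Z \<Longrightarrow> n \<in> \<N> \<Longrightarrow> n' \<in> \<N> \<Longrightarrow> x \<in> flat_cone n c (F n) \<Longrightarrow> x \<in> flat_cone n' c (F n') \<Longrightarrow> n = n'"
      and seg: "\<And>x n t. x \<notin> Z \<Longrightarrow> n \<in> \<N> \<Longrightarrow> x \<in> flat_cone n c (F n) \<Longrightarrow> 0 < t \<Longrightarrow> t \<le> 1 \<Longrightarrow> t *\<^sub>R ((c / (n \<bullet> x)) *\<^sub>R x) \<in> K"
      and ex_normal: "\<exists>x n. outward_unit_normal K x n"
      by (rule constant_support_cone_decomposition[OF K supp]) (assumption, rule that)
    have tr: "emeasure H ((+) v -` A) = emeasure H A" if "A \<in> sets borel" for v A
      unfolding H_def using that by (rule hausdorff_translation)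
    have orth: "emeasure H (f -` A) = emeasure H A" if "orthogonal_transformation f" "A \<in> sets borel" for f A
      unfolding H_def using that by (rule hausdorff_orthogonal)
    obtain x0 e where x0: "outward_unit_normal K x0 e" using ex_normal by blast
    then obtain r where r: "0 < r" "K \<inter> ball x0 r = {y \<in> ball x0 r. e \<bullet> (y - x0) \<le> 0}"
      unfolding outward_unit_normal_def by blast
    have near: "y \<in> K \<longleftrightarrow> e \<bullet> (y - x0) \<le> 0" if "dist x0 y < r" for y
      using arg_cong[OF r(2), of "\<lambda>S. y \<in> S"] that by simp
    have e1: "norm e = 1" using x0 by (simp add: outward_unit_normal_def)
    \<comment> \<open>a translate of this patch of hyperplane is contained in the boundary\<close>
    have patch: "emeasure H ({x. e \<bullet> x = 0} \<inter> ball 0 r) < \<infinity>"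
    proof -
      define S where "S = (+) (- x0) -` ({x. e \<bullet> x = 0} \<inter> ball 0 r)"
      have "S \<subseteq> frontier K"
      proof
        fix y assume "y \<in> S"
        then have y: "e \<bullet> (y - x0) = 0" "dist x0 y < r"
          by (auto simp: S_def inner_add_right inner_diff_right dist_norm norm_minus_commute)
        then have "y \<in> K" using near by simp
        moreover have "y \<notin> interior K"
        proof
          assume "y \<in> interior K"
          then obtain s where s: "0 < s" "ball y s \<subseteq> K" by (auto simp: mem_interior)
          \<comment> \<open>a step along \<open>e\<close> short enough to stay in both balls leaves the half space\<close>
          define u where "u = min (s / 2) ((r - dist x0 y) / 2)"
          have u: "0 < u" "u < s" "u < r - dist x0 y" using s(1) y(2) by (auto simp: u_def min_def)
          have "dist y (y + u *\<^sub>R e) = u" using u(1) e1 by (simp add: dist_norm)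
          then have "y + u *\<^sub>R e \<in> ball y s" "dist x0 (y + u *\<^sub>R e) < r"
            using u dist_triangle[of x0 "y + u *\<^sub>R e" y] by (simp, linarith)
          then have "y + u *\<^sub>R e \<in> K" "dist x0 (y + u *\<^sub>R e) < r" using s(2) by blast+
          then have "e \<bullet> (y + u *\<^sub>R e - x0) \<le> 0" using near by blast
          moreover have "e \<bullet> (y + u *\<^sub>R e - x0) = u"
            using y(1) e1 by (simp add: inner_add_right inner_diff_right dot_square_norm)
          ultimately show False using u(1) by simp
        qed
        ultimately show "y \<in> frontier K" using clK by (simp add: frontier_def)
      qed
      then have "emeasure H S \<le> emeasure H (frontier K)" by (intro emeasure_mono) (auto simp: H)
      moreover have "{x. e \<bullet> x = 0} \<inter> ball 0 r \<in> sets borel" by measurable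
      ultimately show ?thesis using tr[of "{x. e \<bullet> x = 0} \<inter> ball 0 r" "- x0"] h(2)
        by (simp add: S_def order_le_less_trans)
    qed
    obtain \<kappa> where \<kappa>: "\<And>n A. norm n = 1 \<Longrightarrow> A \<in> sets borel \<Longrightarrow> A \<subseteq> {x. n \<bullet> x = c} \<Longrightarrow>
       emeasure H A = \<kappa> * emeasure lborel (flat_cone n c A)"
      by (rule rigid_measure_on_hyperplane[OF H tr orth e1 r(1) patch c]) (assumption, assumption, assumption, rule that)
    define N where "N = (\<Union>(a, b, a', b')\<in>\<C>. {x. a \<bullet> x = b \<and> a' \<bullet> x = b'})"
    have N: "N \<in> null_sets H"
    proof -
      have "(case p of (a, b, a', b') \<Rightarrow> {x. a \<bullet> x = b \<and> a' \<bullet> x = b'}) \<in> null_sets H" if p: "p \<in> \<C>" for p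
      proof -
        obtain a b a' b' where p_eq: "p = (a, b, a', b')" by (cases p)
        have "emeasure H {x. a \<bullet> x = b \<and> a' \<bullet> x = b'} = 0"
          using \<C>(2)[OF p[unfolded p_eq]] by (intro rigid_measure_codim_2_null[OF tr \<kappa> c]) auto
        then show ?thesis by (auto simp: p_eq H intro!: null_setsI)
      qed
      then show ?thesis unfolding N_def using \<C>(1) by (intro null_sets_UN' countable_finite)
    qed
    define C where "C = (\<lambda>n. flat_cone n c (F n))"
    have C [measurable]: "C n \<in> sets borel" if "n \<in> \<N>" for n unfolding C_def using F(1)[OF that] by (rule flat_cone_borel)
    have AEZ: "AE x in lborel. x \<notin> Z" using Z by (rule AE_not_in)
    have sumC: "(\<Sum>n\<in>\<N>. indicator (C n) x) = (indicator K x :: ennreal)" if x: "x \<notin> Z" for x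
    proof (cases "x \<in> K")
      case True
      then obtain n where n: "n \<in> \<N>" "x \<in> C n" using cover[OF x] unfolding C_def by blast
      have "x \<in> C m \<longleftrightarrow> m = n" if "m \<in> \<N>" for m
        using uniq[OF x that n(1)] n(2) unfolding C_def by blast
      then have "indicator (C m) x = (if m = n then 1 else 0 :: ennreal)" if "m \<in> \<N>" for m
        using that by (simp add: indicator_def)
      then have "(\<Sum>n\<in>\<N>. indicator (C n) x) = (\<Sum>m\<in>\<N>. if m = n then 1 else 0 :: ennreal)" by (intro sum.cong) auto
      then show ?thesis using n(1) \<N>(1) True by simp
    next
      case False
      then have "x \<notin> C n" if "n \<in> \<N>" for n using cover[OF x] that unfolding C_def by blast
      then show ?thesis using False by simp
    qed
    have facet: "(\<integral>\<^sup>+y. indicator (F n) y * f y \<partial>H) = \<kappa> * (\<integral>\<^sup>+x. indicator (C n) x * f ((c / (n \<bullet> x)) *\<^sub>R x) \<partial>lborel)"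
      if "n \<in> \<N>" "f \<in> borel_measurable borel" for n f
      unfolding C_def using that F(2)[OF that(1)] \<N>(2)[OF that(1)]
      by (intro nn_integral_facet H \<kappa> F(1)) auto
    have vol: "\<kappa> * ennreal v \<le> ennreal h"
    proof -
      have "\<kappa> * ennreal v = \<kappa> * (\<integral>\<^sup>+x. indicator K x \<partial>lborel)" by (simp add: v(2))
      also have "(\<integral>\<^sup>+x. indicator K x \<partial>lborel) = (\<integral>\<^sup>+x. (\<Sum>n\<in>\<N>. indicator (C n) x) \<partial>lborel)"
        by (rule nn_integral_cong_AE, use AEZ in eventually_elim) (simp add: sumC)
      also have "\<dots> = (\<Sum>n\<in>\<N>. \<integral>\<^sup>+x. indicator (C n) x \<partial>lborel)"
        by (rule nn_integral_sum) measurable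
      also have "\<kappa> * \<dots> = (\<Sum>n\<in>\<N>. emeasure H (F n))"
        unfolding sum_distrib_left
      proof (rule sum.cong)
        fix n assume n: "n \<in> \<N>"
        show "\<kappa> * (\<integral>\<^sup>+x. indicator (C n) x \<partial>lborel) = emeasure H (F n)"
          using \<kappa>[OF \<N>(2)[OF n] F(1)[OF n] F(2)[OF n]] C[OF n] by (simp add: C_def)
      qed simp
      also have "\<dots> = emeasure H (\<Union>n\<in>\<N>. F n)"
        using F(1,3) \<N>(1) H by (intro sum_emeasure) (auto simp: disjoint_family_on_def)
      also have "\<dots> \<le> ennreal h" unfolding h(2)[symmetric] using front(1) H by (intro emeasure_mono) auto
      finally show ?thesis .
    qed
    have ray_ineq: "ennreal (W y) \<le> ennreal M *
        (\<integral>\<^sup>+t. ennreal (real D * t ^ (D - 1)) * indicator {0<..1} t * ennreal (W (t *\<^sub>R y)) \<partial>lborel)"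
      if "\<And>t. 0 < t \<Longrightarrow> t \<le> 1 \<Longrightarrow> t *\<^sub>R y \<in> K" for y
    proof -
      obtain q where q: "degree q \<le> k" "\<And>t. W (t *\<^sub>R y) = poly q t" using ray[of y] by blast
      have "W y = poly q 1" using q(2)[of 1] by simp
      moreover have "0 \<le> poly q t" if "0 < t" "t \<le> 1" for t
        using nonneg[OF \<open>\<And>t. 0 < t \<Longrightarrow> t \<le> 1 \<Longrightarrow> t *\<^sub>R y \<in> K\<close>[OF that]] by (simp add: q(2))
      ultimately show ?thesis unfolding q(2) M_def using poly_ray_bound[OF D(1) q(1)] by simp
    qed
    have "(\<integral>\<^sup>+y. indicator (frontier K) y * ennreal (W y) \<partial>H) \<le> (\<integral>\<^sup>+y. (\<Sum>n\<in>\<N>. indicator (F n) y * ennreal (W y)) \<partial>H)"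
    proof (rule nn_integral_mono_AE)
      have "AE y in H. y \<notin> N" using N by (rule AE_not_in)
      then show "AE y in H. indicator (frontier K) y * ennreal (W y) \<le> (\<Sum>n\<in>\<N>. indicator (F n) y * ennreal (W y))"
      proof eventually_elim
        case (elim y)
        show ?case
        proof (cases "y \<in> frontier K")
          case True
          then obtain n where n: "n \<in> \<N>" "y \<in> F n" using front(2) elim by (auto simp: N_def)
          then show ?thesis
            using member_le_sum[of n \<N> "\<lambda>n. indicator (F n) y * ennreal (W y)"] \<N>(1) True by simp
        qed simp
      qed
    qed
    also have "\<dots> = (\<Sum>n\<in>\<N>. \<integral>\<^sup>+y. indicator (F n) y * ennreal (W y) \<partial>H)"
    proof (rule nn_integral_sum)
      fix n assume "n \<in> \<N>"
      then have [measurable]: "F n \<in> sets borel" by (rule F(1))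
      show "(\<lambda>y. indicator (F n) y * ennreal (W y)) \<in> borel_measurable H" by measurable
    qed
    also have "\<dots> = \<kappa> * (\<Sum>n\<in>\<N>. \<integral>\<^sup>+x. indicator (C n) x * ennreal (W ((c / (n \<bullet> x)) *\<^sub>R x)) \<partial>lborel)"
      unfolding sum_distrib_left using facet[of _ "\<lambda>x. ennreal (W x)"] by (intro sum.cong) auto
    also have "\<dots> \<le> \<kappa> * (\<Sum>n\<in>\<N>. ennreal M * (\<integral>\<^sup>+x. indicator (C n) x * ennreal (W x) \<partial>lborel))"
    proof (intro mult_left_mono sum_mono)
      fix n assume n: "n \<in> \<N>"
      have [measurable]: "C n \<in> sets borel" using n by (rule C)
      define G where "G = (\<lambda>x. \<integral>\<^sup>+t. ennreal (real D * t ^ (D - 1)) * indicator {0<..1} t *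
          ennreal (W (t *\<^sub>R ((c / (n \<bullet> x)) *\<^sub>R x))) \<partial>lborel)"
      have "(\<integral>\<^sup>+x. indicator (C n) x * ennreal (W ((c / (n \<bullet> x)) *\<^sub>R x)) \<partial>lborel) \<le>
        (\<integral>\<^sup>+x. ennreal M * (indicator (C n) x * G x) \<partial>lborel)"
      proof (rule nn_integral_mono_AE, use AEZ in eventually_elim)
        fix x assume x: "x \<notin> Z"
        show "indicator (C n) x * ennreal (W ((c / (n \<bullet> x)) *\<^sub>R x)) \<le> ennreal M * (indicator (C n) x * G x)"
        proof (cases "x \<in> C n")
          case True
          then have "ennreal (W ((c / (n \<bullet> x)) *\<^sub>R x)) \<le> ennreal M * G x"
            unfolding G_def C_def by (intro ray_ineq seg[OF x n])
          then show ?thesis using True by simp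
        qed simp
      qed
      also have "\<dots> = ennreal M * (\<integral>\<^sup>+x. indicator (C n) x * G x \<partial>lborel)"
        unfolding G_def by (rule nn_integral_cmult) measurable
      also have "(\<integral>\<^sup>+x. indicator (C n) x * G x \<partial>lborel) = (\<integral>\<^sup>+x. indicator (C n) x * ennreal (W x) \<partial>lborel)"
        using flat_cone_polar[OF c F(1)[OF n], of "\<lambda>x. ennreal (W x)" n] unfolding G_def C_def D(2) by simp
      finally show "(\<integral>\<^sup>+x. indicator (C n) x * ennreal (W ((c / (n \<bullet> x)) *\<^sub>R x)) \<partial>lborel) \<le>
        ennreal M * (\<integral>\<^sup>+x. indicator (C n) x * ennreal (W x) \<partial>lborel)" .
    qed simp
    also have "\<dots> = \<kappa> * (ennreal M * (\<integral>\<^sup>+x. (\<Sum>n\<in>\<N>. indicator (C n) x * ennreal (W x)) \<partial>lborel))"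
      by (subst nn_integral_sum) (simp_all add: sum_distrib_left)
    also have "(\<integral>\<^sup>+x. (\<Sum>n\<in>\<N>. indicator (C n) x * ennreal (W x)) \<partial>lborel) = (\<integral>\<^sup>+x. ennreal (indicator K x *\<^sub>R W x) \<partial>lborel)"
    proof (rule nn_integral_cong_AE, use AEZ in eventually_elim)
      fix x assume x: "x \<notin> Z"
      show "(\<Sum>n\<in>\<N>. indicator (C n) x * ennreal (W x)) = ennreal (indicator K x *\<^sub>R W x)"
        unfolding sum_distrib_right[symmetric] sumC[OF x] by (simp add: indicator_def)
    qed
    also have "\<dots> = ennreal I"
      unfolding I_def set_lebesgue_integral_def using nonneg
      by (intro nn_integral_eq_integral borel_integrable_compact cK continuous_on_subset[OF cont])
        (auto simp: indicator_def)
    finally have main: "(\<integral>\<^sup>+y. indicator (frontier K) y * ennreal (W y) \<partial>H) \<le> \<kappa> * (ennreal M * ennreal I)" .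
    have "\<kappa> \<noteq> top"
    proof
      assume "\<kappa> = top"
      then show False using vol v(1) by (simp add: ennreal_top_mult top_unique)
    qed
    then obtain \<kappa>' where \<kappa>': "\<kappa> = ennreal \<kappa>'" "0 \<le> \<kappa>'" by (cases \<kappa>) auto
    have k_le: "\<kappa>' * v \<le> h" using vol \<kappa>' v(1) h(1) by (simp flip: ennreal_mult)
    have "b \<le> \<kappa>' * (M * I)"
    proof -
      have "b = enn2real (\<integral>\<^sup>+y. ennreal (indicator (frontier K) y *\<^sub>R W y) \<partial>H)"
        unfolding b_def set_lebesgue_integral_def
        using nonneg fK by (intro integral_eq_nn_integral) (auto simp: indicator_def)
      also have "(\<integral>\<^sup>+y. ennreal (indicator (frontier K) y *\<^sub>R W y) \<partial>H) = (\<integral>\<^sup>+y. indicator (frontier K) y * ennreal (W y) \<partial>H)"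
        by (intro nn_integral_cong) (auto simp: indicator_def)
      also have "enn2real \<dots> \<le> enn2real (\<kappa> * (ennreal M * ennreal I))"
        using main by (intro enn2real_mono) (auto simp: \<kappa>' ennreal_mult_less_top)
      also have "\<dots> = \<kappa>' * (M * I)" using \<kappa>' M0 I0 by (simp flip: ennreal_mult)
      finally show ?thesis .
    qed
    also have "\<dots> \<le> (h / v) * (M * I)"
      using k_le v(1) M0 I0 by (intro mult_right_mono) (auto simp: field_simps)
    finally have "b / h \<le> M * (I / v)" using h(1) by (simp add: field_simps)
    then show ?thesis by (simp add: goal M_def D_def)
  qed
qed

section \<open>Regular simplices\<close>

text \<open>Expanding \<open>\<Sum>v. (dist u v)\<^sup>2\<close> around the centroid expresses \<open>norm (u - p)\<close> by quantities that do not
depend on the vertex \<open>u\<close>; the mutual inner products then follow from \<open>\<Sum>v. v - p = 0\<close>.\<close>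

lemma regular_simplex_centroid:
  fixes C :: "'a::euclidean_space set"
  assumes C: "finite C" "card C = d + 1" "0 < d"
    and l: "\<And>u v. u \<in> C \<Longrightarrow> v \<in> C \<Longrightarrow> u \<noteq> v \<Longrightarrow> dist u v = l"
    and p: "p = (\<Sum>v\<in>C. v) /\<^sub>R real (card C)"
  obtains a where "0 < a" "\<And>u. u \<in> C \<Longrightarrow> (u - p) \<bullet> (u - p) = a"
    "\<And>u v. u \<in> C \<Longrightarrow> v \<in> C \<Longrightarrow> u \<noteq> v \<Longrightarrow> (u - p) \<bullet> (v - p) = - a / real d"
proof -
  define w where "w = (\<lambda>u. u - p)"
  define S where "S = (\<Sum>v\<in>C. w v \<bullet> w v)"
  define a where "a = (real d * l\<^sup>2 - S) / real (d + 1)"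
  have "real (card C) *\<^sub>R p = (\<Sum>v\<in>C. v)" using C(2) by (simp add: p)
  then have "(\<Sum>v\<in>C. w v) = 0" by (simp add: w_def sum_subtractf sum_constant_scaleR del: sum_constant)
  then have sum0: "(\<Sum>v\<in>C. x \<bullet> w v) = 0" for x by (simp flip: inner_sum_right)
  have dist2: "(dist u v)\<^sup>2 = w u \<bullet> w u + w v \<bullet> w v - 2 * (w u \<bullet> w v)" for u v
    by (simp add: dist_norm w_def power2_norm_eq_inner inner_diff_left inner_diff_right inner_commute)
  have a: "w u \<bullet> w u = a" if u: "u \<in> C" for u
  proof -
    have "(\<Sum>v\<in>C. (dist u v)\<^sup>2) = (dist u u)\<^sup>2 + (\<Sum>v\<in>C - {u}. (dist u v)\<^sup>2)"
      using C(1) u by (rule sum.remove)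
    also have "\<dots> = (\<Sum>v\<in>C - {u}. (dist u v)\<^sup>2)" by simp
    also have "\<dots> = (\<Sum>v\<in>C - {u}. l\<^sup>2)" using l[OF u] by (intro sum.cong) auto
    also have "\<dots> = real d * l\<^sup>2" using C u by simp
    finally have "real d * l\<^sup>2 = (\<Sum>v\<in>C. w u \<bullet> w u + w v \<bullet> w v - 2 * (w u \<bullet> w v))"
      by (simp add: dist2)
    also have "\<dots> = real (d + 1) * (w u \<bullet> w u) + S - 2 * (\<Sum>v\<in>C. w u \<bullet> w v)"
      using C(2) by (simp add: sum.distrib sum_subtractf S_def sum_distrib_left)
    finally show ?thesis by (simp add: sum0 a_def field_simps)
  qed
  have inner: "w u \<bullet> w v = a - l\<^sup>2 / 2" if "u \<in> C" "v \<in> C" "u \<noteq> v" for u v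
    using dist2[of u v] a[OF that(1)] a[OF that(2)] l[OF that] by (simp add: field_simps)
  have b: "w u \<bullet> w v = - a / real d" if uv: "u \<in> C" "v \<in> C" "u \<noteq> v" for u v
  proof -
    have "0 = (\<Sum>v\<in>C. w u \<bullet> w v)" by (simp add: sum0)
    also have "\<dots> = w u \<bullet> w u + (\<Sum>v\<in>C - {u}. w u \<bullet> w v)" using C(1) uv(1) by (rule sum.remove)
    also have "(\<Sum>v\<in>C - {u}. w u \<bullet> w v) = (\<Sum>v\<in>C - {u}. a - l\<^sup>2 / 2)"
      using uv(1) by (intro sum.cong inner) auto
    also have "\<dots> = real d * (a - l\<^sup>2 / 2)" using C uv by simp
    finally have "0 = a + real d * (w u \<bullet> w v)" unfolding inner[OF uv] using a uv by simp
    then show ?thesis using C(3) by (simp add: field_simps)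
  qed
  have "0 < a"
  proof (rule ccontr)
    assume "\<not> 0 < a"
    have "u = p" if "u \<in> C" for u
    proof -
      have "w u \<bullet> w u \<le> 0" using a[OF that] \<open>\<not> 0 < a\<close> by simp
      then have "w u = 0" by (meson inner_gt_zero_iff not_less)
      then show ?thesis by (simp add: w_def)
    qed
    then have "C \<subseteq> {p}" by auto
    then have "card C \<le> 1" using card_mono[of "{p}" C] by simp
    then show False using C by simp
  qed
  then show thesis using that[of a] a b by (simp add: w_def)
qed

text \<open>At a boundary point \<open>x\<close> with outward normal \<open>n\<close>, some vertex \<open>j\<close> lies strictly below the supporting
hyperplane. Its barycentric coordinate vanishes on the face through \<open>x\<close>. Relative to the centroid
this coordinate is an affine function of \<open>w \<bullet> y\<close>, where \<open>w\<close> is the vector to \<open>j\<close>, so \<open>w \<bullet> y\<close> is constant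
on a relatively open piece of the supporting hyperplane. Hence \<open>w\<close> is a multiple of \<open>n\<close>, and
\<open>n \<bullet> x\<close> depends only on \<open>norm w\<close>, which is the same for all vertices.\<close>

lemma regular_simplex_star_regular:
  fixes K :: "'a::euclidean_space set"
  assumes "regular_simplex DIM('a) K"
  shows "star_regular K"
proof -
  define d where "d = DIM('a)"
  have d: "0 < d" by (simp add: d_def)
  obtain C l where indep: "\<not> affine_dependent C" and card_int: "int (card C) = int d + 1"
    and K: "K = convex hull C" and l': "\<forall>u\<in>C. \<forall>v\<in>C. u \<noteq> v \<longrightarrow> dist u v = l"
    using assms unfolding regular_simplex_def d_def by (elim exE conjE)
  have l: "dist u v = l" if "u \<in> C" "v \<in> C" "u \<noteq> v" for u v using l' that by blast
  have card: "card C = d + 1" using card_int by linarith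
  then have fin: "finite C" by (intro card_ge_0_finite) simp
  have ne: "C \<noteq> {}" using card by auto
  have hullK: "\<exists>\<mu>. (\<forall>v\<in>C. 0 \<le> \<mu> v) \<and> sum \<mu> C = 1 \<and> (\<Sum>v\<in>C. \<mu> v *\<^sub>R v) = y" if "y \<in> K" for y
    using that unfolding K convex_hull_finite[OF fin] by blast
  have convK: "convex K" by (simp add: K convex_convex_hull)
  have solid: "solid_polytope K"
  proof -
    have "aff_dim C = int (card C) - 1" using aff_dim_affine_independent[OF indep] by simp
    then have "affine hull C = UNIV" using card_int aff_dim_eq_full[of C] by (simp add: d_def)
    then have "affine hull K = UNIV" by (simp add: K affine_hull_convex_hull)
    then have "interior K = rel_interior K" by (simp add: rel_interior_interior)
    moreover have "rel_interior K \<noteq> {}" using ne convK rel_interior_eq_empty[of K] by (simp add: K)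
    moreover have "polytope K" using fin by (auto simp: polytope_def K)
    ultimately show ?thesis unfolding solid_polytope_def by (intro exI[of _ "{K}"]) auto
  qed
  have star: "starlike K" using convK ne by (intro convex_imp_starlike) (auto simp: K)
  define p where "p = (\<Sum>v\<in>C. v) /\<^sub>R real (card C)"
  obtain a where a: "0 < a" "\<And>u. u \<in> C \<Longrightarrow> (u - p) \<bullet> (u - p) = a"
    "\<And>u v. u \<in> C \<Longrightarrow> v \<in> C \<Longrightarrow> u \<noteq> v \<Longrightarrow> (u - p) \<bullet> (v - p) = - a / real d"
    using regular_simplex_centroid[OF fin card d l p_def] by blast
  define K' where "K' = (\<lambda>y. y - p) ` K"
  have K': "y \<in> K' \<longleftrightarrow> y + p \<in> K" for y by (auto simp: K'_def image_iff intro!: bexI[of _ "y + p"])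
  have convK': "convex K'" unfolding K'_def using convex_translation_subtract[OF convK, of p] by simp
  have "n \<bullet> x = sqrt a / real d" if out: "outward_unit_normal K' x n" for x n
  proof -
    obtain e where xF: "x \<in> frontier K'" and n1: "norm n = 1" and e: "0 < e"
      "K' \<inter> ball x e = {y \<in> ball x e. n \<bullet> (y - x) \<le> 0}"
      using out by (auto simp: outward_unit_normal_def)
    have nn: "n \<bullet> n = 1" using n1 by (simp add: dot_square_norm)
    have near: "y \<in> K' \<longleftrightarrow> n \<bullet> (y - x) \<le> 0" if "dist x y < e" for y
      using e(2) that by (metis (no_types, lifting) IntD1 IntI mem_Collect_eq mem_ball)
    have xK: "x \<in> K'" using near[of x] e(1) by simp
    have below: "n \<bullet> (y - x) \<le> 0" if y: "y \<in> K'" for y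
    proof -
      define s where "s = min 1 (e / (2 * (norm (y - x) + 1)))"
      have nz: "0 < norm (y - x) + 1" by (simp add: add_nonneg_pos)
      have s: "0 < s" "s \<le> 1" using e(1) nz by (auto simp: s_def)
      have "s * norm (y - x) \<le> e / (2 * (norm (y - x) + 1)) * norm (y - x)"
        by (intro mult_right_mono) (auto simp: s_def)
      also have "\<dots> < e"
      proof -
        have "e * norm (y - x) < e * (2 * (norm (y - x) + 1))" using e(1) by (intro mult_strict_left_mono) (auto intro: add_nonneg_pos)
        then show ?thesis using nz by (simp add: divide_less_eq)
      qed
      finally have "dist x (x + s *\<^sub>R (y - x)) < e" using s(1) by (simp add: dist_norm)
      moreover have "x + s *\<^sub>R (y - x) \<in> K'"
      proof -
        have "(1 - s) *\<^sub>R x + s *\<^sub>R y \<in> K'" using convexD[OF convK' xK y, of "1 - s" s] s by simp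
        moreover have "(1 - s) *\<^sub>R x + s *\<^sub>R y = x + s *\<^sub>R (y - x)" by (simp add: algebra_simps)
        ultimately show ?thesis by simp
      qed
      ultimately have "n \<bullet> (s *\<^sub>R (y - x)) \<le> 0" using near by fastforce
      then show ?thesis using s(1) by (simp add: mult_le_0_iff)
    qed
    have vertex: "v - p \<in> K'" if "v \<in> C" for v using that by (simp add: K' K hull_inc)
    have bary: "\<exists>\<mu>. (\<forall>v\<in>C. 0 \<le> \<mu> v) \<and> sum \<mu> C = 1 \<and> (\<forall>q. q \<bullet> y = (\<Sum>v\<in>C. \<mu> v * (q \<bullet> (v - p))))"
      if "y \<in> K'" for y
    proof -
      have "y + p \<in> K" using that by (simp add: K')
      from hullK[OF this] obtain \<mu> where mu: "\<forall>v\<in>C. 0 \<le> \<mu> v" "sum \<mu> C = 1" "(\<Sum>v\<in>C. \<mu> v *\<^sub>R v) = y + p" by blast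
      have "q \<bullet> y = (\<Sum>v\<in>C. \<mu> v * (q \<bullet> (v - p)))" for q
      proof -
        have "(\<Sum>v\<in>C. \<mu> v * (q \<bullet> (v - p))) = q \<bullet> (\<Sum>v\<in>C. \<mu> v *\<^sub>R v) - sum \<mu> C * (q \<bullet> p)"
          by (simp add: inner_sum_right inner_diff_right right_diff_distrib sum_subtractf sum_distrib_right)
        then show ?thesis by (simp add: mu inner_add_right)
      qed
      then show ?thesis using mu by blast
    qed
    have shifted: "n \<bullet> (y - x) = (\<Sum>v\<in>C. \<mu> v * (n \<bullet> (v - p - x)))"
      if "sum \<mu> C = 1" "\<forall>q. q \<bullet> y = (\<Sum>v\<in>C. \<mu> v * (q \<bullet> (v - p)))" for y \<mu>
    proof -
      have "(\<Sum>v\<in>C. \<mu> v * (n \<bullet> (v - p - x))) = (\<Sum>v\<in>C. \<mu> v * (n \<bullet> (v - p))) - sum \<mu> C * (n \<bullet> x)"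
        by (simp add: inner_diff_right right_diff_distrib sum_subtractf sum_distrib_right)
      then show ?thesis using that by (simp add: inner_diff_right)
    qed
    have "\<exists>j\<in>C. n \<bullet> (j - p - x) < 0"
    proof (rule ccontr)
      assume "\<not> ?thesis"
      then have all: "0 \<le> n \<bullet> (v - p - x)" if "v \<in> C" for v using bspec[OF _ that] not_le by auto
      \<comment> \<open>a point of the simplex strictly below the supporting hyperplane; not all vertices can lie on it\<close>
      define y where "y = x - (e / 2) *\<^sub>R n"
      have "y \<in> K'" using near[of y] e(1) n1 nn by (simp add: y_def dist_norm)
      then obtain \<mu> where mu: "\<forall>v\<in>C. 0 \<le> \<mu> v" "sum \<mu> C = 1" "\<forall>q. q \<bullet> y = (\<Sum>v\<in>C. \<mu> v * (q \<bullet> (v - p)))"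
        using bary by blast
      have "0 \<le> n \<bullet> (y - x)" unfolding shifted[OF mu(2,3)] using mu(1) all by (intro sum_nonneg) auto
      then show False using e(1) nn by (simp add: y_def)
    qed
    then obtain j where j: "j \<in> C" "n \<bullet> (j - p - x) < 0" by blast
    define w where "w = j - p"
    have face: "w \<bullet> y = - a / real d" if y: "y \<in> K'" "n \<bullet> (y - x) = 0" for y
    proof -
      obtain \<mu> where mu: "\<forall>v\<in>C. 0 \<le> \<mu> v" "sum \<mu> C = 1" "\<forall>q. q \<bullet> y = (\<Sum>v\<in>C. \<mu> v * (q \<bullet> (v - p)))"
        using bary[OF y(1)] by blast
      have "(\<Sum>v\<in>C. - (\<mu> v * (n \<bullet> (v - p - x)))) = 0"
        using shifted[OF mu(2,3)] y(2) by (simp add: sum_negf)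
      moreover have "0 \<le> - (\<mu> v * (n \<bullet> (v - p - x)))" if "v \<in> C" for v
        using mu(1) below[OF vertex[OF that]] that by (simp add: mult_nonneg_nonpos)
      ultimately have "- (\<mu> j * (n \<bullet> (j - p - x))) = 0"
        using fin j(1) by (simp only: sum_nonneg_eq_0_iff)
      then have mj: "\<mu> j = 0" using j(2) by simp
      have "w \<bullet> y = (\<Sum>v\<in>C. \<mu> v * (w \<bullet> (v - p)))" using mu(3) by blast
      also have "\<dots> = (\<Sum>v\<in>C. \<mu> v * (- a / real d))"
      proof (rule sum.cong)
        fix v assume "v \<in> C"
        then show "\<mu> v * (w \<bullet> (v - p)) = \<mu> v * (- a / real d)"
          using mj a(3)[OF j(1), of v] by (cases "v = j") (auto simp: w_def)
      qed simp
      also have "\<dots> = - a / real d" unfolding sum_distrib_right[symmetric] mu(2) by simp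
      finally show ?thesis .
    qed
    have perp: "w \<bullet> u = 0" if u: "n \<bullet> u = 0" for u
    proof -
      define s where "s = e / (2 * (norm u + 1))"
      have nz: "0 < norm u + 1" by (simp add: add_nonneg_pos)
      have s: "0 < s" using e(1) nz by (simp add: s_def)
      have "s * norm u < e"
      proof -
        have "e * norm u < e * (2 * (norm u + 1))" using e(1) by (intro mult_strict_left_mono) (auto intro: add_nonneg_pos)
        then show ?thesis using nz by (simp add: s_def divide_less_eq)
      qed
      then have "x + s *\<^sub>R u \<in> K'" using near[of "x + s *\<^sub>R u"] u s by (simp add: dist_norm)
      then have "w \<bullet> (x + s *\<^sub>R u) = - a / real d" using u by (intro face) simp_all
      moreover have "w \<bullet> x = - a / real d" using xK by (intro face) simp_all
      ultimately show ?thesis using s by (simp add: inner_add_right)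
    qed
    \<comment> \<open>\<open>\<beta>\<^sup>2 = a\<close>, and \<open>\<beta> < 0\<close> because \<open>w\<close> points below the supporting hyperplane\<close>
    define \<beta> where "\<beta> = n \<bullet> w"
    have w: "w = \<beta> *\<^sub>R n"
    proof -
      define u where "u = w - \<beta> *\<^sub>R n"
      have nu: "n \<bullet> u = 0" using nn by (simp add: u_def \<beta>_def inner_diff_right)
      have "u \<bullet> u = w \<bullet> u - \<beta> * (n \<bullet> u)" by (simp add: u_def inner_diff_left)
      then have "u \<bullet> u = 0" using perp[OF nu] nu by simp
      then show ?thesis by (simp add: u_def)
    qed
    have beta2: "\<beta> * \<beta> = a" using a(2)[OF j(1)] nn unfolding w_def[symmetric] by (simp add: w)
    then have b0: "\<beta> \<noteq> 0" using a(1) by auto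
    have "\<beta> * (n \<bullet> x) = - (\<beta> * \<beta>) / real d"
      using face[OF xK] unfolding beta2 by (simp add: w)
    then have "\<beta> * (real d * (n \<bullet> x) + \<beta>) = 0" using d by (simp add: field_simps)
    then have "real d * (n \<bullet> x) + \<beta> = 0" using b0 by (simp only: mult_eq_0_iff) simp
    then have nx: "n \<bullet> x = - \<beta> / real d" using d by (simp add: field_simps)
    have "\<beta> < n \<bullet> x" using j(2) by (simp add: \<beta>_def w_def inner_diff_right)
    moreover have "- \<beta> / real d \<le> 0" if "0 \<le> \<beta>" using that by simp
    ultimately have "\<beta> < 0" unfolding nx by linarith
    then have "- \<beta> = sqrt a" using beta2 by (intro real_sqrt_unique[symmetric]) (auto simp: power2_eq_square)
    then show ?thesis using nx by simp
  qed
  then show ?thesis unfolding star_regular_def K'_def using solid star by blast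
qed

section \<open>Translation to a centred cell\<close>

lemma average_translation:
  fixes M :: "'a::euclidean_space measure"
  assumes M: "sets M = sets borel"
    and inv: "\<And>v A. A \<in> sets borel \<Longrightarrow> emeasure M ((+) v -` A) = emeasure M A"
    and A: "A \<in> sets borel" and f: "f \<in> borel_measurable borel"
  shows "average M ((\<lambda>y. y - p) ` A) (\<lambda>x. f (x + p)) = average M A f"
proof -
  define T where "T = (\<lambda>y. y + p)"
  have T: "T \<in> measurable M borel" "T \<in> measurable borel borel"
    unfolding measurable_cong_sets[OF M refl] T_def by measurable
  have spM: "space M = UNIV" using sets_eq_imp_space_eq[OF M] by simp
  have image: "(\<lambda>y. y - p) ` A = T -` A" by (force simp: T_def image_iff)
  have vim: "(+) p -` S = T -` S" for S by (auto simp: T_def add.commute)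
  have em: "emeasure M (T -` S) = emeasure M S" if "S \<in> sets borel" for S
    using inv[OF that, of p] by (simp add: vim)
  have distr: "distr M borel T = M"
    by (rule measure_eqI) (use T spM M in \<open>auto simp: emeasure_distr em\<close>)
  have "(LINT x:A|M. f x) = (LINT x|distr M borel T. indicator A x *\<^sub>R f x)"
    by (simp add: distr set_lebesgue_integral_def)
  also have "\<dots> = (LINT x|M. indicator A (T x) *\<^sub>R f (T x))"
    using A f by (intro integral_distr T(1) borel_measurable_scaleR borel_measurable_indicator) auto
  also have "\<dots> = (LINT x:(\<lambda>y. y - p) ` A|M. f (x + p))"
    unfolding set_lebesgue_integral_def image
    by (intro Bochner_Integration.integral_cong) (auto simp: indicator_def T_def)
  finally have "(LINT x:A|M. f x) = (LINT x:(\<lambda>y. y - p) ` A|M. f (x + p))" .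
  moreover have "measure M ((\<lambda>y. y - p) ` A) = measure M A"
    unfolding measure_def image by (simp add: em[OF A])
  ultimately show ?thesis by (simp add: average_def)
qed

text \<open>The variable \<open>x $ i\<close> of each monomial becomes the linear polynomial \<open>[:p $ i, x $ i:]\<close> in \<open>t\<close>.\<close>

lemma polynomial_on_line:
  assumes "polynomial_of_degree_le k U"
  shows "\<exists>q. degree q \<le> k \<and> (\<forall>t. U (t *\<^sub>R x + p) = poly q t)"
proof -
  obtain c where U: "\<And>x. U x = (\<Sum>\<alpha> | (\<Sum>i\<in>UNIV. \<alpha> i) \<le> k. c \<alpha> * (\<Prod>i\<in>UNIV. (x $ i) ^ \<alpha> i))"
    using assms unfolding polynomial_of_degree_le_def by blast
  define q where "q = (\<Sum>\<alpha> | (\<Sum>i\<in>UNIV. \<alpha> i) \<le> k. smult (c \<alpha>) (\<Prod>i\<in>UNIV. [:p $ i, x $ i:] ^ \<alpha> i))"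
  have "degree (\<Prod>i\<in>UNIV. [:p $ i, x $ i:] ^ \<alpha> i) \<le> (\<Sum>i\<in>UNIV. \<alpha> i)" for \<alpha>
  proof -
    have "degree (\<Prod>i\<in>UNIV. [:p $ i, x $ i:] ^ \<alpha> i) \<le> (\<Sum>i\<in>UNIV. degree ([:p $ i, x $ i:] ^ \<alpha> i))"
      using degree_prod_sum_le[OF finite, of "\<lambda>i. [:p $ i, x $ i:] ^ \<alpha> i" UNIV] by (simp add: comp_def)
    also have "\<dots> \<le> (\<Sum>i\<in>UNIV. \<alpha> i)"
    proof (rule sum_mono)
      fix i
      have "degree ([:p $ i, x $ i:] ^ \<alpha> i) \<le> degree [:p $ i, x $ i:] * \<alpha> i" by (rule degree_power_le)
      also have "\<dots> \<le> 1 * \<alpha> i" by (intro mult_right_mono) auto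
      finally show "degree ([:p $ i, x $ i:] ^ \<alpha> i) \<le> \<alpha> i" by simp
    qed
    finally show ?thesis .
  qed
  then have "degree (smult (c \<alpha>) (\<Prod>i\<in>UNIV. [:p $ i, x $ i:] ^ \<alpha> i)) \<le> k" if "(\<Sum>i\<in>UNIV. \<alpha> i) \<le> k" for \<alpha>
    using that by (meson degree_smult_le order_trans)
  then have "degree q \<le> k"
    unfolding q_def
    by (cases "finite {\<alpha> :: 'a \<Rightarrow> nat. (\<Sum>i\<in>UNIV. \<alpha> i) \<le> k}") (rule degree_sum_le, simp_all del: degree_smult_eq)
  moreover have "U (t *\<^sub>R x + p) = poly q t" for t
    unfolding U q_def by (simp add: poly_sum poly_prod add.commute)
  ultimately show ?thesis by blast
qed

lemma polynomial_continuous: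
  assumes "polynomial_of_degree_le k U"
  shows "continuous_on S U"
proof -
  obtain c where U: "\<And>x. U x = (\<Sum>\<alpha> | (\<Sum>i\<in>UNIV. \<alpha> i) \<le> k. c \<alpha> * (\<Prod>i\<in>UNIV. (x $ i) ^ \<alpha> i))"
    using assms unfolding polynomial_of_degree_le_def by blast
  show ?thesis unfolding U by (intro continuous_intros)
qed

lemma star_regular_bound:
  fixes K :: "(real^'n) set"
  assumes K: "star_regular K" and U: "polynomial_of_degree_le k U" and nonneg: "\<And>x. x \<in> K \<Longrightarrow> 0 \<le> U x"
  shows "boundary_average K U \<le> star_weight CARD('n) k * cell_average K U"
proof -
  obtain p c where supp: "\<And>x n. outward_unit_normal ((\<lambda>y. y - p) ` K) x n \<Longrightarrow> n \<bullet> x = c"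
    and solid: "solid_polytope K"
    using K unfolding star_regular_def by blast
  have Ub: "U \<in> borel_measurable borel"
    by (rule borel_measurable_continuous_onI[OF polynomial_continuous[OF U]])
  define K' where "K' = (\<lambda>y. y - p) ` K"
  define W where "W = (\<lambda>x. U (x + p))"
  have "solid_polytope K'"
  proof -
    obtain \<F> where F: "finite \<F>" "\<F> \<noteq> {}" "\<forall>P\<in>\<F>. polytope P \<and> interior P \<noteq> {}" "K = \<Union>\<F>"
      using solid by (auto simp: solid_polytope_def)
    have "polytope ((+) (- p) ` P) \<and> interior ((+) (- p) ` P) \<noteq> {}" if "P \<in> \<F>" for P
      using F(3) that unfolding polytope_translation_eq interior_translation by simp
    moreover have "K' = \<Union>((\<lambda>P. (+) (- p) ` P) ` \<F>)" unfolding K'_def F(4) by auto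
    ultimately show ?thesis
      unfolding solid_polytope_def using F(1,2) by (intro exI[of _ "(\<lambda>P. (+) (- p) ` P) ` \<F>"]) auto
  qed
  then have "boundary_average K' W \<le> star_weight CARD('n) k * cell_average K' W"
  proof (rule centred_cell_bound)
    show "n \<bullet> x = c" if "outward_unit_normal K' x n" for x n using supp that by (simp add: K'_def)
    show "continuous_on UNIV W"
      unfolding W_def by (intro continuous_on_compose2[OF polynomial_continuous[OF U, of UNIV]] continuous_intros) auto
    show "\<exists>q. degree q \<le> k \<and> (\<forall>t. W (t *\<^sub>R x) = poly q t)" for x
      using polynomial_on_line[OF U] by (simp add: W_def)
    show "0 \<le> W x" if "x \<in> K'" for x using that nonneg by (auto simp: K'_def W_def)
  qed
  moreover have "boundary_average K' W = boundary_average K U"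
  proof -
    have "frontier K' = (\<lambda>y. y - p) ` frontier K"
      using frontier_translation[of "- p" K] by (simp add: K'_def)
    then show ?thesis
      unfolding boundary_average_def W_def
      using average_translation[OF sets_hausdorff_measure hausdorff_translation _ Ub, of "frontier K"] by simp
  qed
  moreover have "cell_average K' W = cell_average K U"
    unfolding cell_average_def W_def K'_def
  proof (rule average_translation[OF sets_lborel _ _ Ub])
    show "K \<in> sets borel" using solid_polytope_compact(1)[OF solid] by (intro borel_closed compact_imp_closed)
    show "emeasure lborel ((+) v -` A) = emeasure lborel A" if "A \<in> sets borel" for v :: "real^'n" and A
      using emeasure_distr[of "(+) v" lborel borel A] that by (simp add: lborel_distr_plus)
  qed
  ultimately show ?thesis by simp
qed

theorem theorem6p15:
  shows "(\<forall>(K :: (real^'n) set) (k :: nat).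
            star_regular K \<longrightarrow> admissible_interior_weight K k (star_weight CARD('n) k)) \<and>
         (\<forall>(K :: (real^'n) set) (k :: nat).
            regular_simplex CARD('n) K \<longrightarrow> interior_weight_bound K k \<le> ereal (star_weight CARD('n) k))"
proof -
  have bound: "interior_weight_bound K k \<le> ereal (star_weight CARD('n) k)"
    if K: "star_regular K" for K :: "(real^'n) set" and k
    unfolding interior_weight_bound_def
  proof (rule Sup_least)
    fix r assume "r \<in> {ereal (boundary_average K U / cell_average K U) | U.
      polynomial_of_degree_le k U \<and> (\<forall>x\<in>K. 0 \<le> U x) \<and> 0 < cell_average K U}"
    then obtain U where r: "r = ereal (boundary_average K U / cell_average K U)"
      and U: "polynomial_of_degree_le k U" "\<And>x. x \<in> K \<Longrightarrow> 0 \<le> U x" "0 < cell_average K U"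
      by blast
    show "r \<le> ereal (star_weight CARD('n) k)"
      using star_regular_bound[OF K U(1,2)] U(3) by (simp add: r divide_le_eq)
  qed
  have "star_regular K" if "regular_simplex CARD('n) K" for K :: "(real^'n) set"
    using that regular_simplex_star_regular[of K] by simp
  with bound show ?thesis by (simp add: admissible_interior_weight_def)
qed

end
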